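(* Let $M$, $N$ and $Q$ be pointwise finite-dimensional (pfd) modules, and write $N = \bigoplus_{i\in \Lambda} N_i$ with each $N_i$ indecomposable. Suppose each $N_i$ is pointwise at most one-dimensional; that is, $\dim((N_i)_p)\leq 1$ for all $p\in \mathbb{P}$. Then $$f_R(M,Q)\leq f_R(M,N)+f_R(N,Q).$$
   Context: Fix a field $k$. $\mathbb{P}$ is a poset (regarded as a category) equipped with functions $\mathbb{P}_\epsilon\colon\mathbb{P}\to\mathbb{P}$ for all $\epsilon\in\mathbb{R}$ such that $\mathbb{P}_0=\mathrm{id}$; $p\le q$ implies $\mathbb{P}_\epsilon(p)\le\mathbb{P}_\epsilon(q)$; $\mathbb{P}_\epsilon(p)\ge p$ for $\epsilon\ge0$; and $\mathbb{P}_{\epsilon+\delta}=\mathbb{P}_\epsilon\circ\mathbb{P}_\delta$. A module is a functor $M\colon\mathbb{P}\to\mathbf{Vec}_k$, with vector spaces $M_p$ and maps $M_{p\to q}$ for $p\le q$; morphisms are natural transformations. $M$ is pfd if every $M_p$ is finite-dimensional. The shift $M(\epsilon)$ is given by $M(\epsilon)_p=M_{\mathbb{P}_\epsilon(p)}$, $M(\epsilon)_{p\to q}=M_{\mathbb{P}_\epsilon(p)\to\mathbb{P}_\epsilon(q)}$. For $\epsilon\le\delta$, $M_{\epsilon\to\delta}\colon M(\epsilon)\to M(\delta)$ is the morphism with $(M_{\epsilon\to\delta})_p=M_{\mathbb{P}_\epsilon(p)\to\mathbb{P}_\delta(p)}$. Every pfd module is a direct sum $\bigoplus_{i\in\Lambda}M_i$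 of nonzero indecomposable modules, essentially uniquely; $B(M)$ is the multiset $\{M_i\}_{i\in\Lambda}$ of isomorphism classes. For $\epsilon\ge0$ let $\mathrm{Im}_\epsilon(M)=\operatorname{im}(M_{-\epsilon\to0})\subseteq M$ and $\mathrm{Ker}_\epsilon(M)=\ker(M_{0\to\epsilon})\subseteq M$. $\mathrm{EN}_\epsilon(M)$ is the collection of modules isomorphic to some $M_1/M_2$ with $M_2\subseteq M_1\subseteq M$ submodules, $\mathrm{Im}_\epsilon(M)\subseteq M_1$ and $M_2\subseteq\mathrm{Ker}_\epsilon(M)$. An $\epsilon$-refinement of a pfd module $M$ is a module isomorphic to $\bigoplus_{M'\in B(M)}N'$ where $N'\in\mathrm{EN}_\epsilon(M')$ for each $M'\in B(M)$. For pfd modules, $f_R(M,N)=\inf\{\epsilon\ge0\mid\text{there is a module } Q\text{ that is an }\epsilon\text{-refinement of both }M\text{ and }N\}\in[0,\infty]$ (with $\inf\emptyset=\infty$). *)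

theory Defs
  imports
    "HOL-Library.Extended_Nonnegative_Real"
    "HOL-Algebra.AbelCoset"
    "Jordan_Normal_Form.Missing_VectorSpace"
begin

section \<open>Vector spaces: quotients and direct sums\<close>

text \<open>Vector spaces are \<^typ>\<open>('k, 'v) module\<close> records satisfying \<^const>\<open>vectorspace\<close>; the inherited
  ring fields \<^const>\<open>mult\<close> and \<^const>\<open>one\<close> carry no meaning and get dummy values.\<close>

definition quot_space :: "('k, 'v) module \<Rightarrow> 'v set \<Rightarrow> ('k, 'v set) module" where
  "quot_space V W =
    \<lparr>carrier = a_rcosets\<^bsub>V\<^esub> W,
     mult = (\<lambda>_ _. W),
     one = W,
     zero = W,
     add = (<+>\<^bsub>V\<^esub>),
     smult = (\<lambda>a X. \<Union>x\<in>X. W +>\<^bsub>V\<^esub> (a \<odot>\<^bsub>V\<^esub> x))\<rparr>"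

definition dsum_space :: "'i set \<Rightarrow> ('i \<Rightarrow> ('k, 'v) module) \<Rightarrow> ('k, 'i \<Rightarrow> 'v) module" where
  "dsum_space I V =
    \<lparr>carrier = {x \<in> \<Pi>\<^sub>E i\<in>I. carrier (V i). finite {i \<in> I. x i \<noteq> \<zero>\<^bsub>V i\<^esub>}},
     mult = (\<lambda>_ _. \<lambda>i\<in>I. \<zero>\<^bsub>V i\<^esub>),
     one = (\<lambda>i\<in>I. \<zero>\<^bsub>V i\<^esub>),
     zero = (\<lambda>i\<in>I. \<zero>\<^bsub>V i\<^esub>),
     add = (\<lambda>x y. \<lambda>i\<in>I. x i \<oplus>\<^bsub>V i\<^esub> y i),
     smult = (\<lambda>a x. \<lambda>i\<in>I. a \<odot>\<^bsub>V i\<^esub> x i)\<rparr>"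

section \<open>Modules over a poset\<close>

locale poset_flow =
  fixes P :: "real \<Rightarrow> 'p::order \<Rightarrow> 'p"
  assumes flow_zero: "P 0 = id"
    and flow_mono: "p \<le> q \<Longrightarrow> P \<epsilon> p \<le> P \<epsilon> q"
    and flow_ge: "0 \<le> \<epsilon> \<Longrightarrow> p \<le> P \<epsilon> p"
    and flow_add: "P (\<epsilon> + \<delta>) = P \<epsilon> \<circ> P \<delta>"

text \<open>For a module \<open>M\<close>, \<open>space_at M p\<close> is $M_p$ and \<open>map_at M p q\<close> is $M_{p\to q}$, meaningful
  only for \<open>p \<le> q\<close> and on the carrier of \<open>space_at M p\<close>.\<close>

record ('p, 'k, 'v) pmod =
  space_at :: "'p \<Rightarrow> ('k, 'v) module"
  map_at :: "'p \<Rightarrow> 'p \<Rightarrow> 'v \<Rightarrow> 'v"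

locale pmodule =
  fixes K :: "('k, 'm) ring_scheme" and M :: "('p::order, 'k, 'v) pmod"
  assumes space: "vectorspace K (space_at M p)"
    and map: "p \<le> q \<Longrightarrow> linear_map K (space_at M p) (space_at M q) (map_at M p q)"
    and map_id: "x \<in> carrier (space_at M p) \<Longrightarrow> map_at M p p x = x"
    and map_comp: "\<lbrakk>p \<le> q; q \<le> r; x \<in> carrier (space_at M p)\<rbrakk> \<Longrightarrow>
      map_at M p r x = map_at M q r (map_at M p q x)"

locale pmodule_hom = M: pmodule K M + N: pmodule K N
  for K :: "('k, 'm) ring_scheme"
    and M :: "('p::order, 'k, 'v) pmod" and N :: "('p, 'k, 'w) pmod" +
  fixes f :: "'p \<Rightarrow> 'v \<Rightarrow> 'w"
  assumes component: "linear_map K (space_at M p) (space_at N p) (f p)"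
    and natural: "\<lbrakk>p \<le> q; x \<in> carrier (space_at M p)\<rbrakk> \<Longrightarrow>
      f q (map_at M p q x) = map_at N p q (f p x)"

definition pmodule_iso ::
  "('k, 'm) ring_scheme \<Rightarrow> ('p::order, 'k, 'v) pmod \<Rightarrow> ('p, 'k, 'w) pmod \<Rightarrow> bool" where
  "pmodule_iso K M N \<longleftrightarrow> (\<exists>f. pmodule_hom K M N f \<and>
    (\<forall>p. bij_betw (f p) (carrier (space_at M p)) (carrier (space_at N p))))"

definition pfd :: "('k, 'm) ring_scheme \<Rightarrow> ('p::order, 'k, 'v) pmod \<Rightarrow> bool" where
  "pfd K M \<longleftrightarrow> pmodule K M \<and> (\<forall>p. vectorspace.fin_dim K (space_at M p))"

definition zero_pmodule :: "('p::order, 'k, 'v) pmod \<Rightarrow> bool" where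
  "zero_pmodule M \<longleftrightarrow> (\<forall>p. carrier (space_at M p) = {\<zero>\<^bsub>space_at M p\<^esub>})"

text \<open>A submodule is given by its family of underlying sets.\<close>

definition subpmodule ::
  "('k, 'm) ring_scheme \<Rightarrow> ('p \<Rightarrow> 'v set) \<Rightarrow> ('p::order, 'k, 'v) pmod \<Rightarrow> bool" where
  "subpmodule K U M \<longleftrightarrow> (\<forall>p. subspace K (U p) (space_at M p)) \<and>
    (\<forall>p q. p \<le> q \<longrightarrow> map_at M p q ` U p \<subseteq> U q)"

definition restrict_pmodule :: "('p::order, 'k, 'v) pmod \<Rightarrow> ('p \<Rightarrow> 'v set) \<Rightarrow> ('p, 'k, 'v) pmod" where
  "restrict_pmodule M U =
    \<lparr>space_at = (\<lambda>p. (space_at M p)\<lparr>carrier := U p\<rparr>), map_at = map_at M\<rparr>"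

definition quot_pmodule :: "('p::order, 'k, 'v) pmod \<Rightarrow> ('p \<Rightarrow> 'v set) \<Rightarrow> ('p, 'k, 'v set) pmod" where
  "quot_pmodule M U =
    \<lparr>space_at = (\<lambda>p. quot_space (space_at M p) (U p)),
     map_at = (\<lambda>p q X. \<Union>x\<in>X. U q +>\<^bsub>space_at M q\<^esub> map_at M p q x)\<rparr>"

definition dsum_pmodule ::
  "'i set \<Rightarrow> ('i \<Rightarrow> ('p::order, 'k, 'v) pmod) \<Rightarrow> ('p, 'k, 'i \<Rightarrow> 'v) pmod" where
  "dsum_pmodule I M =
    \<lparr>space_at = (\<lambda>p. dsum_space I (\<lambda>i. space_at (M i) p)),
     map_at = (\<lambda>p q x. \<lambda>i\<in>I. map_at (M i) p q (x i))\<rparr>"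

text \<open>Indecomposability is expressed with internal direct sums. Indecomposable modules are nonzero.\<close>

definition indecomposable :: "('k, 'm) ring_scheme \<Rightarrow> ('p::order, 'k, 'v) pmod \<Rightarrow> bool" where
  "indecomposable K M \<longleftrightarrow> pmodule K M \<and> \<not> zero_pmodule M \<and>
    (\<forall>U W. subpmodule K U M \<and> subpmodule K W M \<and>
        (\<forall>p. U p <+>\<^bsub>space_at M p\<^esub> W p = carrier (space_at M p) \<and>
             U p \<inter> W p = {\<zero>\<^bsub>space_at M p\<^esub>}) \<longrightarrow>
      zero_pmodule (restrict_pmodule M U) \<or> zero_pmodule (restrict_pmodule M W))"

text \<open>The family \<open>(M' i)\<close>, \<open>i \<in> I\<close>, presents \<open>M\<close> as a direct sum of nonzero indecomposables,
  i.e. its isomorphism classes, with multiplicity, form the multiset $B(M)$.\<close>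

definition decomposition :: "('k, 'm) ring_scheme \<Rightarrow> ('p::order, 'k, 'v) pmod \<Rightarrow>
    'i set \<Rightarrow> ('i \<Rightarrow> ('p, 'k, 'w) pmod) \<Rightarrow> bool" where
  "decomposition K M I M' \<longleftrightarrow>
    (\<forall>i\<in>I. indecomposable K (M' i)) \<and> pmodule_iso K M (dsum_pmodule I M')"

text \<open>By the convention of \<^const>\<open>vectorspace.dim\<close> the value is meaningful only in the presence of
  \<^const>\<open>vectorspace.fin_dim\<close>.\<close>

definition pointwise_dim_le_one :: "('k, 'm) ring_scheme \<Rightarrow> ('p::order, 'k, 'v) pmod \<Rightarrow> bool" where
  "pointwise_dim_le_one K M \<longleftrightarrow>
    (\<forall>p. vectorspace.fin_dim K (space_at M p) \<and> vectorspace.dim K (space_at M p) \<le> 1)"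

section \<open>Shifts, neighborhoods and refinements\<close>

definition shift ::
  "(real \<Rightarrow> 'p \<Rightarrow> 'p) \<Rightarrow> real \<Rightarrow> ('p::order, 'k, 'v) pmod \<Rightarrow> ('p, 'k, 'v) pmod" where
  "shift P \<epsilon> M =
    \<lparr>space_at = (\<lambda>p. space_at M (P \<epsilon> p)), map_at = (\<lambda>p q. map_at M (P \<epsilon> p) (P \<epsilon> q))\<rparr>"

text \<open>The morphism $M_{\epsilon\to\delta}\colon M(\epsilon)\to M(\delta)$, for \<open>\<epsilon> \<le> \<delta>\<close>.\<close>

definition shift_hom ::
  "(real \<Rightarrow> 'p \<Rightarrow> 'p) \<Rightarrow> real \<Rightarrow> real \<Rightarrow> ('p::order, 'k, 'v) pmod \<Rightarrow> 'p \<Rightarrow> 'v \<Rightarrow> 'v" where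
  "shift_hom P \<epsilon> \<delta> M = (\<lambda>p. map_at M (P \<epsilon> p) (P \<delta> p))"

definition Im_shift ::
  "(real \<Rightarrow> 'p \<Rightarrow> 'p) \<Rightarrow> real \<Rightarrow> ('p::order, 'k, 'v) pmod \<Rightarrow> 'p \<Rightarrow> 'v set" where
  "Im_shift P \<epsilon> M p = shift_hom P (-\<epsilon>) 0 M p ` carrier (space_at (shift P (-\<epsilon>) M) p)"

definition Ker_shift ::
  "(real \<Rightarrow> 'p \<Rightarrow> 'p) \<Rightarrow> real \<Rightarrow> ('p::order, 'k, 'v) pmod \<Rightarrow> 'p \<Rightarrow> 'v set" where
  "Ker_shift P \<epsilon> M p =
    {x \<in> carrier (space_at M p). shift_hom P 0 \<epsilon> M p x = \<zero>\<^bsub>space_at (shift P \<epsilon> M) p\<^esub>}"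

definition EN :: "('k, 'm) ring_scheme \<Rightarrow> (real \<Rightarrow> 'p \<Rightarrow> 'p) \<Rightarrow> real \<Rightarrow>
    ('p::order, 'k, 'v) pmod \<Rightarrow> ('p, 'k, 'w) pmod set" where
  "EN K P \<epsilon> M = {N. \<exists>M1 M2. subpmodule K M1 M \<and> subpmodule K M2 M \<and>
    (\<forall>p. M2 p \<subseteq> M1 p \<and> Im_shift P \<epsilon> M p \<subseteq> M1 p \<and> M2 p \<subseteq> Ker_shift P \<epsilon> M p) \<and>
    pmodule_iso K N (quot_pmodule (restrict_pmodule M M1) M2)}"

text \<open>The existential quantifiers range over fixed types, which are large enough for pfd \<open>M\<close>: each
  summand is nonzero at some \<open>p\<close> and at most $\dim M_p$ of them are nonzero at a given \<open>p\<close>, so the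
  summands can be indexed by a subset of \<^typ>\<open>'p \<times> nat\<close>; each summand is isomorphic to a submodule
  of \<open>M\<close>, hence to a module with elements in \<^typ>\<open>'v\<close>; and its subquotients consist of cosets. Since
  decompositions of a pfd module are essentially unique, it does not matter which one represents
  $B(M)$.\<close>

definition refinement :: "('k, 'm) ring_scheme \<Rightarrow> (real \<Rightarrow> 'p \<Rightarrow> 'p) \<Rightarrow> real \<Rightarrow>
    ('p::order, 'k, 'v) pmod \<Rightarrow> ('p, 'k, 'w) pmod \<Rightarrow> bool" where
  "refinement K P \<epsilon> M R \<longleftrightarrow>
    (\<exists>(I :: ('p \<times> nat) set) (M' :: 'p \<times> nat \<Rightarrow> ('p, 'k, 'v) pmod)
      (N' :: 'p \<times> nat \<Rightarrow> ('p, 'k, 'v set) pmod).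
      decomposition K M I M' \<and> (\<forall>i\<in>I. N' i \<in> EN K P \<epsilon> (M' i)) \<and>
      pmodule_iso K R (dsum_pmodule I N'))"

text \<open>A refinement of a pfd module is again pfd, hence isomorphic to a module with elements in
  \<^typ>\<open>nat \<Rightarrow> 'k\<close>, as every finite-dimensional space embeds there; so the common refinement may be
  sought in that type.\<close>

definition f_R :: "('k, 'm) ring_scheme \<Rightarrow> (real \<Rightarrow> 'p \<Rightarrow> 'p) \<Rightarrow>
    ('p::order, 'k, 'v) pmod \<Rightarrow> ('p, 'k, 'w) pmod \<Rightarrow> ennreal" where
  "f_R K P M N = Inf {ennreal \<epsilon> | \<epsilon>. 0 \<le> \<epsilon> \<and>
    (\<exists>Q :: ('p, 'k, nat \<Rightarrow> 'k) pmod. refinement K P \<epsilon> M Q \<and> refinement K P \<epsilon> N Q)}"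

end

theory Submission
  imports Defs
begin

text \<open>Let $R_1$ be an $\epsilon$-refinement of $M$ and of $N$, and $R_2$ a $\delta$-refinement of $N$
  and of $Q$. Both are subquotients of $N$, say $R_1 \cong U/V$ and $R_2 \cong U'/V'$. Suppose that
  these four submodules are homogeneous for one decomposition of $N$ into summands of dimension at
  most one at every point. Put $S = U \cap U'$, and let $T$ consist of the $x \in S$ each of whose
  components lies in $V$ or in $V'$. Two subspaces of a line are comparable, so $T$ is a submodule, and
  $S/T$ is a subquotient of both $R_1$ and $R_2$, by submodules that satisfy the conditions for
  $\mathrm{EN}_\delta$ and $\mathrm{EN}_\epsilon$ (\<open>common_subquotient\<close>). It is the common
  $(\epsilon+\delta)$-refinement of $M$ and $Q$.

  Two conflicts between decompositions have to be settled. A refinement of $N$ is built from some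
  decomposition of $N$ into indecomposables, which may differ for $R_1$ and for $R_2$. And $S/T$ is
  homogeneous for the decomposition of $R_1$ that comes from $N$, whereas a refinement of $M$ must be
  homogeneous for the one that comes from $M$. Both are settled by the theorem \<open>exchange\<close>, a form of the
  Krull-Remak-Schmidt theorem. Call a thin summand with connected support a brick; every thin
  decomposition can be refined to bricks (\<open>refine_to_bricks\<close>). For any second decomposition \<open>\<pi>\<close> of the same
  module there is an automorphism \<open>\<theta>\<close> that maps each brick into a single summand of \<open>\<pi>\<close>. So \<open>\<theta>\<close> carries
  submodules homogeneous for the bricks to submodules homogeneous for \<open>\<pi>\<close> (\<open>transfer_from_thin\<close>). If the
  summands of \<open>\<pi>\<close> are indecomposable, no two bricks end up in the same one, and the inverse of \<open>\<theta>\<close>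
  transports homogeneity in the other direction (\<open>transfer_from_indecomposables\<close>).

  The theorem \<open>exchange\<close> holds for the following reason. Nonzero maps between lines compose to nonzero maps, so
  at a point \<open>p\<close> the relation ``some homomorphism from \<open>a\<close> to \<open>b\<close> is nonzero at \<open>p\<close>'' is a preorder on the finitely
  many bricks living there. An endomorphism of a brick that is nonzero at one point is nonzero on the whole
  support, so bricks related in both directions are isomorphic. Every endomorphism is block triangular for this
  preorder, with one diagonal block for each isomorphism class of bricks. It is an
  automorphism as soon as its diagonal blocks are injective (\<open>injective_if_diag_injective\<close>), and for each
  isomorphism class this needs to be known at a single point only (\<open>diag_injective_conn\<close>). There, a
  Steinitz argument applies: a basis vector \<open>u\<close> is the sum of its components \<open>\<pi>\<^sub>j u\<close>, so it can be exchanged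
  for one of them (\<open>select_summands\<close>).

  Internal direct sums are encoded by families of idempotent endomorphisms, and a subquotient $U/V$ by a
  surjection with domain $U$ and kernel $V$, so that cosets occur only in the comparison with
  $\mathrm{EN}_\epsilon$.\<close>

section \<open>Linear algebra with explicit carriers\<close>

lemma linear_map_iff:
  "linear_map K V W f \<longleftrightarrow> vectorspace K V \<and> vectorspace K W \<and>
    (\<forall>x\<in>carrier V. f x \<in> carrier W) \<and>
    (\<forall>x\<in>carrier V. \<forall>y\<in>carrier V. f (x \<oplus>\<^bsub>V\<^esub> y) = f x \<oplus>\<^bsub>W\<^esub> f y) \<and>
    (\<forall>k\<in>carrier K. \<forall>x\<in>carrier V. f (k \<odot>\<^bsub>V\<^esub> x) = k \<odot>\<^bsub>W\<^esub> f x)"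
  unfolding linear_map_def mod_hom_def mod_hom_axioms_def module_hom_def vectorspace_def
  by auto

lemma subspace_iff:
  assumes "vectorspace K V"
  shows "subspace K W V \<longleftrightarrow> W \<subseteq> carrier V \<and> \<zero>\<^bsub>V\<^esub> \<in> W \<and>
    (\<forall>x\<in>W. \<forall>y\<in>W. x \<oplus>\<^bsub>V\<^esub> y \<in> W) \<and> (\<forall>k\<in>carrier K. \<forall>x\<in>W. k \<odot>\<^bsub>V\<^esub> x \<in> W)"
  using assms unfolding subspace_def submodule_def vectorspace_def by auto

text \<open>Quotient spaces and copies of a space in another type are both images of a map that
  respects the operations, which lets the axioms be checked once for all of them.\<close>

lemma vectorspace_image:
  assumes "vectorspace K V"
    and surj: "f ` carrier V = carrier W"
    and add: "\<And>x y. x \<in> carrier V \<Longrightarrow> y \<in> carrier V \<Longrightarrow> f (x \<oplus>\<^bsub>V\<^esub> y) = f x \<oplus>\<^bsub>W\<^esub> f y"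
    and smult: "\<And>k x. k \<in> carrier K \<Longrightarrow> x \<in> carrier V \<Longrightarrow> f (k \<odot>\<^bsub>V\<^esub> x) = k \<odot>\<^bsub>W\<^esub> f x"
    and zero: "f \<zero>\<^bsub>V\<^esub> = \<zero>\<^bsub>W\<^esub>"
  shows "vectorspace K W"
proof -
  interpret V: vectorspace K V by fact
  have ex: "\<exists>x\<in>carrier V. y = f x" if "y \<in> carrier W" for y
    using surj that by auto
  have cl: "f x \<in> carrier W" if "x \<in> carrier V" for x
    using surj that by auto
  show ?thesis
  proof (rule vs_criteria)
    show "field K" by (rule V.field_axioms)
    show "\<zero>\<^bsub>W\<^esub> \<in> carrier W" using cl[OF V.M.zero_closed] zero by simp
    show "\<forall>v w. v \<in> carrier W \<and> w \<in> carrier W \<longrightarrow> v \<oplus>\<^bsub>W\<^esub> w \<in> carrier W"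
      using cl by (auto dest!: ex simp flip: add)
    show "\<forall>v\<in>carrier W. \<exists>neg_v\<in>carrier W. v \<oplus>\<^bsub>W\<^esub> neg_v = \<zero>\<^bsub>W\<^esub>"
    proof
      fix v assume "v \<in> carrier W"
      then obtain x where x: "x \<in> carrier V" "v = f x" using ex by blast
      then have "v \<oplus>\<^bsub>W\<^esub> f (\<ominus>\<^bsub>V\<^esub> x) = \<zero>\<^bsub>W\<^esub>"
        by (simp add: V.M.r_neg zero flip: add)
      then show "\<exists>neg_v\<in>carrier W. v \<oplus>\<^bsub>W\<^esub> neg_v = \<zero>\<^bsub>W\<^esub>" using x cl by auto
    qed
    show "\<forall>c v. c \<in> carrier K \<and> v \<in> carrier W \<longrightarrow> c \<odot>\<^bsub>W\<^esub> v \<in> carrier W"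
      using cl by (auto dest!: ex simp flip: smult)
    show "\<forall>v w. v \<in> carrier W \<and> w \<in> carrier W \<longrightarrow> v \<oplus>\<^bsub>W\<^esub> w = w \<oplus>\<^bsub>W\<^esub> v"
      by (auto dest!: ex simp: V.M.add.m_comm simp flip: add)
    show "\<forall>v w x. v \<in> carrier W \<and> w \<in> carrier W \<and> x \<in> carrier W \<longrightarrow>
        v \<oplus>\<^bsub>W\<^esub> w \<oplus>\<^bsub>W\<^esub> x = v \<oplus>\<^bsub>W\<^esub> (w \<oplus>\<^bsub>W\<^esub> x)"
    proof (intro allI impI, elim conjE)
      fix v w x assume "v \<in> carrier W" "w \<in> carrier W" "x \<in> carrier W"
      then obtain a b c where "a \<in> carrier V" "b \<in> carrier V" "c \<in> carrier V"
        "v = f a" "w = f b" "x = f c" using ex by meson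
      then show "v \<oplus>\<^bsub>W\<^esub> w \<oplus>\<^bsub>W\<^esub> x = v \<oplus>\<^bsub>W\<^esub> (w \<oplus>\<^bsub>W\<^esub> x)"
        by (simp flip: add add: V.M.add.m_assoc)
    qed
    show "\<forall>v\<in>carrier W. v \<oplus>\<^bsub>W\<^esub> \<zero>\<^bsub>W\<^esub> = v"
      by (auto dest!: ex simp flip: add zero)
    show "\<forall>a b v. a \<in> carrier K \<and> b \<in> carrier K \<and> v \<in> carrier W \<longrightarrow>
        (a \<otimes>\<^bsub>K\<^esub> b) \<odot>\<^bsub>W\<^esub> v = a \<odot>\<^bsub>W\<^esub> (b \<odot>\<^bsub>W\<^esub> v)"
      by (auto dest!: ex simp: V.smult_assoc1 simp flip: smult)
    show "\<forall>v\<in>carrier W. \<one>\<^bsub>K\<^esub> \<odot>\<^bsub>W\<^esub> v = v"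
      by (auto dest!: ex simp flip: smult)
    show "\<forall>a b v. a \<in> carrier K \<and> b \<in> carrier K \<and> v \<in> carrier W \<longrightarrow>
        (a \<oplus>\<^bsub>K\<^esub> b) \<odot>\<^bsub>W\<^esub> v = a \<odot>\<^bsub>W\<^esub> v \<oplus>\<^bsub>W\<^esub> b \<odot>\<^bsub>W\<^esub> v"
    proof (intro allI impI, elim conjE)
      fix a b v assume "a \<in> carrier K" "b \<in> carrier K" "v \<in> carrier W"
      moreover then obtain x where "x \<in> carrier V" "v = f x" using ex by meson
      ultimately show "(a \<oplus>\<^bsub>K\<^esub> b) \<odot>\<^bsub>W\<^esub> v = a \<odot>\<^bsub>W\<^esub> v \<oplus>\<^bsub>W\<^esub> b \<odot>\<^bsub>W\<^esub> v"
        by (simp flip: add smult add: V.smult_l_distr)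
    qed
    show "\<forall>a v w. a \<in> carrier K \<and> v \<in> carrier W \<and> w \<in> carrier W \<longrightarrow>
        a \<odot>\<^bsub>W\<^esub> (v \<oplus>\<^bsub>W\<^esub> w) = a \<odot>\<^bsub>W\<^esub> v \<oplus>\<^bsub>W\<^esub> a \<odot>\<^bsub>W\<^esub> w"
    proof (intro allI impI, elim conjE)
      fix a v w assume "a \<in> carrier K" "v \<in> carrier W" "w \<in> carrier W"
      moreover then obtain x y where "x \<in> carrier V" "v = f x" "y \<in> carrier V" "w = f y"
        using ex by meson
      ultimately show "a \<odot>\<^bsub>W\<^esub> (v \<oplus>\<^bsub>W\<^esub> w) = a \<odot>\<^bsub>W\<^esub> v \<oplus>\<^bsub>W\<^esub> a \<odot>\<^bsub>W\<^esub> w"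
        by (simp flip: add smult add: V.smult_r_distr)
    qed
  qed
qed

text \<open>An injective map sends a basis to a linearly independent set with as many
  elements as the dimension, hence to a basis.\<close>

lemma injective_endo_surjective:
  assumes T: "linear_map K V V T" and fd: "vectorspace.fin_dim K V" and inj: "inj_on T (carrier V)"
  shows "T ` carrier V = carrier V"
proof -
  interpret V: vectorspace K V using T by (simp add: linear_map_iff)
  interpret T: linear_map K V V T by fact
  obtain \<beta> where \<beta>: "finite \<beta>" "V.basis \<beta>" using V.finite_basis_exists[OF fd] by blast
  then have \<beta>V: "\<beta> \<subseteq> carrier V" and li: "\<not> V.lin_dep \<beta>" by (simp_all add: V.basis_def)
  have T\<beta>: "finite (T ` \<beta>)" "T ` \<beta> \<subseteq> carrier V" using \<beta>(1) \<beta>V by auto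
  note image = T.lincomb_linear_image[OF inj \<beta>V _ \<beta>(1)]
  have "\<not> V.lin_dep (T ` \<beta>)"
  proof (rule V.finite_lin_indpt2[OF T\<beta>], rule ballI)
    fix a w assume a: "a \<in> T ` \<beta> \<rightarrow> carrier K" "V.lincomb a (T ` \<beta>) = \<zero>\<^bsub>V\<^esub>" and "w \<in> T ` \<beta>"
    then obtain v where v: "v \<in> \<beta>" "w = T v" by blast
    have aT: "a \<circ> T \<in> \<beta> \<rightarrow> carrier K" using a(1) by auto
    have "T (V.lincomb (a \<circ> T) \<beta>) = T \<zero>\<^bsub>V\<^esub>" using image[OF a(1)] a(2) T.f0_is_0 by metis
    then have "V.lincomb (a \<circ> T) \<beta> = \<zero>\<^bsub>V\<^esub>"
      using inj_onD[OF inj] V.lincomb_closed[OF \<beta>V aT] by blast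
    then have "(a \<circ> T) v = \<zero>\<^bsub>K\<^esub>"
      using V.not_lindepD[OF li \<beta>(1) subset_refl] aT v(1) by blast
    then show "a w = \<zero>\<^bsub>K\<^esub>" using v by simp
  qed
  moreover have "card (T ` \<beta>) = V.dim"
    using card_image[OF inj_on_subset[OF inj \<beta>V]] V.dim_basis[OF \<beta>] by simp
  ultimately have "V.basis (T ` \<beta>)" using V.dim_li_is_basis[OF fd T\<beta>] by simp
  then have span: "V.span (T ` \<beta>) = carrier V" by (simp add: V.basis_def)
  show ?thesis
  proof
    show "T ` carrier V \<subseteq> carrier V" by auto
    show "carrier V \<subseteq> T ` carrier V"
    proof
      fix y assume "y \<in> carrier V"
      then obtain a where a: "a \<in> T ` \<beta> \<rightarrow> carrier K" "V.lincomb a (T ` \<beta>) = y"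
        using V.finite_in_span[OF T\<beta>] span by blast
      have "a \<circ> T \<in> \<beta> \<rightarrow> carrier K" using a(1) by auto
      then show "y \<in> T ` carrier V" using image[OF a(1)] a(2) V.lincomb_closed[OF \<beta>V] by blast
    qed
  qed
qed

lemma coset_eq:
  assumes "vectorspace K V" and W: "subspace K W V" and "x \<in> carrier V" "w \<in> W"
  shows "W +>\<^bsub>V\<^esub> (w \<oplus>\<^bsub>V\<^esub> x) = W +>\<^bsub>V\<^esub> x"
proof -
  interpret V: vectorspace K V by fact
  note W = W[unfolded subspace_iff[OF assms(1)]]
  have wV: "w \<in> carrier V" using W assms by blast
  have neg: "\<ominus>\<^bsub>V\<^esub> w \<in> W"
    using W assms(4) wV by (metis V.R.a_inv_closed V.R.one_closed V.smult_minus_1)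
  show ?thesis
  proof (rule Set.set_eqI)
    fix y
    show "y \<in> W +>\<^bsub>V\<^esub> (w \<oplus>\<^bsub>V\<^esub> x) \<longleftrightarrow> y \<in> W +>\<^bsub>V\<^esub> x"
    proof
      assume "y \<in> W +>\<^bsub>V\<^esub> (w \<oplus>\<^bsub>V\<^esub> x)"
      then obtain v where v: "v \<in> W" "y = v \<oplus>\<^bsub>V\<^esub> (w \<oplus>\<^bsub>V\<^esub> x)" by (auto simp: a_r_coset_def')
      then have "v \<in> carrier V" using W by blast
      then have "y = (v \<oplus>\<^bsub>V\<^esub> w) \<oplus>\<^bsub>V\<^esub> x" using v wV assms(3) by (simp add: V.M.a_assoc)
      then show "y \<in> W +>\<^bsub>V\<^esub> x" using W v(1) assms(4) by (auto simp: a_r_coset_def')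
    next
      assume "y \<in> W +>\<^bsub>V\<^esub> x"
      then obtain v where v: "v \<in> W" "y = v \<oplus>\<^bsub>V\<^esub> x" by (auto simp: a_r_coset_def')
      then have vV: "v \<in> carrier V" using W by blast
      have "y = (v \<oplus>\<^bsub>V\<^esub> \<ominus>\<^bsub>V\<^esub> w) \<oplus>\<^bsub>V\<^esub> (w \<oplus>\<^bsub>V\<^esub> x)"
        using v vV wV assms(3) by (simp add: V.M.a_assoc V.M.r_neg1)
      then show "y \<in> W +>\<^bsub>V\<^esub> (w \<oplus>\<^bsub>V\<^esub> x)" using W v(1) neg by (auto simp: a_r_coset_def')
    qed
  qed
qed

text \<open>In dimension at most one, any nonzero vector is a basis.\<close>

lemma dim_le_one_multiple:
  assumes "vectorspace K V" and fd: "vectorspace.fin_dim K V" and dim: "vectorspace.dim K V \<le> 1"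
    and x: "x \<in> carrier V" "x \<noteq> \<zero>\<^bsub>V\<^esub>" and y: "y \<in> carrier V"
  shows "\<exists>k\<in>carrier K. y = k \<odot>\<^bsub>V\<^esub> x"
proof -
  interpret V: vectorspace K V by fact
  have lc: "V.lincomb a {x} = a x \<odot>\<^bsub>V\<^esub> x" if "a \<in> {x} \<rightarrow> carrier K" for a
    using that x unfolding V.lincomb_def by simp
  have "\<not> V.lin_dep {x}"
  proof (rule V.finite_lin_indpt2)
    fix a assume a: "a \<in> {x} \<rightarrow> carrier K" "V.lincomb a {x} = \<zero>\<^bsub>V\<^esub>"
    have "a x = \<zero>\<^bsub>K\<^esub>"
    proof (rule ccontr)
      assume nz: "a x \<noteq> \<zero>\<^bsub>K\<^esub>"
      have aK: "a x \<in> carrier K" using a by simp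
      have "x = inv\<^bsub>K\<^esub> (a x) \<odot>\<^bsub>V\<^esub> \<zero>\<^bsub>V\<^esub>"
        by (rule V.mult_inverse[OF aK x(1) _ nz]) (use a lc in simp)
      then show False using x(2) aK nz V.field_Units by simp
    qed
    then show "\<forall>v\<in>{x}. a v = \<zero>\<^bsub>K\<^esub>" by simp
  qed (use x in auto)
  then have "V.basis {x}" using V.dim_li_is_basis[OF fd, of "{x}"] dim x by simp
  then have "y \<in> V.span {x}" using y by (simp add: V.basis_def)
  then obtain a where "a \<in> {x} \<rightarrow> carrier K" "V.lincomb a {x} = y"
    using V.finite_in_span[of "{x}" y] x by auto
  then show ?thesis using lc by (intro bexI[of _ "a x"]) auto
qed

section \<open>Morphisms of modules over a poset\<close>

abbreviation car :: "('p, 'k, 'v) pmod \<Rightarrow> 'p \<Rightarrow> 'v set" where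
  "car M p \<equiv> carrier (space_at M p)"

abbreviation zer :: "('p, 'k, 'v) pmod \<Rightarrow> 'p \<Rightarrow> 'v" where
  "zer M p \<equiv> \<zero>\<^bsub>space_at M p\<^esub>"

sublocale pmodule \<subseteq> V: vectorspace K "space_at M p" for p
  by (rule space)

context pmodule
begin

lemma map_closed [simp]: "p \<le> q \<Longrightarrow> x \<in> car M p \<Longrightarrow> map_at M p q x \<in> car M q"
  using map unfolding linear_map_iff by blast

lemma map_add: "p \<le> q \<Longrightarrow> x \<in> car M p \<Longrightarrow> y \<in> car M p \<Longrightarrow>
    map_at M p q (x \<oplus>\<^bsub>space_at M p\<^esub> y) = map_at M p q x \<oplus>\<^bsub>space_at M q\<^esub> map_at M p q y"
  using map unfolding linear_map_iff by blast

lemma map_smult: "p \<le> q \<Longrightarrow> k \<in> carrier K \<Longrightarrow> x \<in> car M p \<Longrightarrow>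
    map_at M p q (k \<odot>\<^bsub>space_at M p\<^esub> x) = k \<odot>\<^bsub>space_at M q\<^esub> map_at M p q x"
  using map unfolding linear_map_iff by blast

lemma map_zero [simp]: "p \<le> q \<Longrightarrow> map_at M p q (zer M p) = zer M q"
  using map linear_map.T0_is_0 by blast

end

context pmodule_hom
begin

lemma hom_closed [simp]: "x \<in> car M p \<Longrightarrow> f p x \<in> car N p"
  using component unfolding linear_map_iff by blast

lemma hom_add: "x \<in> car M p \<Longrightarrow> y \<in> car M p \<Longrightarrow>
    f p (x \<oplus>\<^bsub>space_at M p\<^esub> y) = f p x \<oplus>\<^bsub>space_at N p\<^esub> f p y"
  using component unfolding linear_map_iff by blast

lemma hom_smult: "k \<in> carrier K \<Longrightarrow> x \<in> car M p \<Longrightarrow>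
    f p (k \<odot>\<^bsub>space_at M p\<^esub> x) = k \<odot>\<^bsub>space_at N p\<^esub> f p x"
  using component unfolding linear_map_iff by blast

lemma hom_zero [simp]: "f p (zer M p) = zer N p"
  by (rule linear_map.T0_is_0[OF component])

lemma hom_minus: "x \<in> car M p \<Longrightarrow> y \<in> car M p \<Longrightarrow>
    f p (x \<ominus>\<^bsub>space_at M p\<^esub> y) = f p x \<ominus>\<^bsub>space_at N p\<^esub> f p y"
  by (rule linear_map.T_minus[OF component])

lemma hom_inj:
  assumes "\<And>x. x \<in> car M p \<Longrightarrow> f p x = zer N p \<Longrightarrow> x = zer M p"
  shows "inj_on (f p) (car M p)"
proof (rule inj_onI)
  fix x y assume xy: "x \<in> car M p" "y \<in> car M p" "f p x = f p y"
  then have "f p (x \<ominus>\<^bsub>space_at M p\<^esub> y) = f p y \<ominus>\<^bsub>space_at N p\<^esub> f p y"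
    by (simp only: hom_minus)
  also have "\<dots> = zer N p"
    using N.V.M.r_neg[OF hom_closed[OF xy(2)]] by (simp only: a_minus_def)
  finally have "f p (x \<ominus>\<^bsub>space_at M p\<^esub> y) = zer N p" .
  then have "x \<ominus>\<^bsub>space_at M p\<^esub> y = zer M p" using assms xy by simp
  then show "x = y" using xy by simp
qed

end

lemma pmodule_homI:
  assumes "pmodule K M" "pmodule K N"
    and "\<And>p x. x \<in> car M p \<Longrightarrow> f p x \<in> car N p"
    and "\<And>p x y. x \<in> car M p \<Longrightarrow> y \<in> car M p \<Longrightarrow>
      f p (x \<oplus>\<^bsub>space_at M p\<^esub> y) = f p x \<oplus>\<^bsub>space_at N p\<^esub> f p y"
    and "\<And>p k x. k \<in> carrier K \<Longrightarrow> x \<in> car M p \<Longrightarrow>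
      f p (k \<odot>\<^bsub>space_at M p\<^esub> x) = k \<odot>\<^bsub>space_at N p\<^esub> f p x"
    and "\<And>p q x. p \<le> q \<Longrightarrow> x \<in> car M p \<Longrightarrow> f q (map_at M p q x) = map_at N p q (f p x)"
  shows "pmodule_hom K M N f"
  by (intro pmodule_hom.intro pmodule_hom_axioms.intro assms(1,2))
    (unfold linear_map_iff, intro conjI ballI pmodule.space assms(1-5), assumption+, rule assms(6))

lemma pmodule_hom_id: "pmodule K M \<Longrightarrow> pmodule_hom K M M (\<lambda>p x. x)"
  by (rule pmodule_homI) auto

lemma pmodule_hom_comp:
  assumes "pmodule_hom K L M f" "pmodule_hom K M N g"
  shows "pmodule_hom K L N (\<lambda>p x. g p (f p x))"
proof -
  interpret f: pmodule_hom K L M f by fact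
  interpret g: pmodule_hom K M N g by fact
  show ?thesis
    by (rule pmodule_homI)
      (simp_all add: f.M.pmodule_axioms g.N.pmodule_axioms f.hom_add g.hom_add f.hom_smult
        g.hom_smult f.natural g.natural)
qed

lemma pmodule_hom_inverse:
  assumes "pmodule_hom K M N f" and bij: "\<And>p. bij_betw (f p) (car M p) (car N p)"
  defines "g \<equiv> \<lambda>p. inv_into (car M p) (f p)"
  shows "pmodule_hom K N M g"
    and "\<And>p x. x \<in> car M p \<Longrightarrow> g p (f p x) = x"
    and "\<And>p y. y \<in> car N p \<Longrightarrow> f p (g p y) = y"
    and "\<And>p y. y \<in> car N p \<Longrightarrow> g p y \<in> car M p"
    and "\<And>p. bij_betw (g p) (car N p) (car M p)"
proof -
  interpret f: pmodule_hom K M N f by fact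
  show l: "g p (f p x) = x" if "x \<in> car M p" for p x
    using bij[of p] that unfolding g_def bij_betw_def by simp
  show r: "f p (g p y) = y" if "y \<in> car N p" for p y
    using bij[of p] that unfolding g_def bij_betw_def by (simp add: f_inv_into_f)
  show c: "g p y \<in> car M p" if "y \<in> car N p" for p y
    using bij[of p] that unfolding g_def bij_betw_def by (metis inv_into_into)
  show "bij_betw (g p) (car N p) (car M p)" for p
    unfolding g_def using bij by (rule bij_betw_inv_into)
  show "pmodule_hom K N M g"
  proof (rule pmodule_homI)
    fix p x y assume "x \<in> car N p" "y \<in> car N p"
    then show "g p (x \<oplus>\<^bsub>space_at N p\<^esub> y) = g p x \<oplus>\<^bsub>space_at M p\<^esub> g p y"
      using l[of "g p x \<oplus>\<^bsub>space_at M p\<^esub> g p y" p] c r by (simp add: f.hom_add)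
  next
    fix p k x assume "k \<in> carrier K" "x \<in> car N p"
    then show "g p (k \<odot>\<^bsub>space_at N p\<^esub> x) = k \<odot>\<^bsub>space_at M p\<^esub> g p x"
      using l[of "k \<odot>\<^bsub>space_at M p\<^esub> g p x" p] c r by (simp add: f.hom_smult)
  next
    fix p q x assume "p \<le> q" "x \<in> car N p"
    then show "g q (map_at N p q x) = map_at M p q (g p x)"
      using l[of "map_at M p q (g p x)" q] c r by (simp add: f.natural)
  qed (simp_all add: c f.M.pmodule_axioms f.N.pmodule_axioms)
qed

lemma pmodule_iso_sym: "pmodule_iso K M N \<Longrightarrow> pmodule_iso K N M"
  unfolding pmodule_iso_def using pmodule_hom_inverse(1,5) by blast

lemma subpmodule_iff:
  assumes "pmodule K M"
  shows "subpmodule K U M \<longleftrightarrow>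
    (\<forall>p. U p \<subseteq> car M p \<and> zer M p \<in> U p \<and>
      (\<forall>x\<in>U p. \<forall>y\<in>U p. x \<oplus>\<^bsub>space_at M p\<^esub> y \<in> U p) \<and>
      (\<forall>k\<in>carrier K. \<forall>x\<in>U p. k \<odot>\<^bsub>space_at M p\<^esub> x \<in> U p)) \<and>
    (\<forall>p q. p \<le> q \<longrightarrow> (\<forall>x\<in>U p. map_at M p q x \<in> U q))"
  unfolding subpmodule_def subspace_iff[OF pmodule.space[OF assms]] by (simp add: image_subset_iff)

lemma (in pmodule) linear_finsum:
  assumes "linear_map K (space_at M p) (space_at M q) T" "finite S" "g \<in> S \<rightarrow> car M p"
  shows "T (finsum (space_at M p) g S) = finsum (space_at M q) (\<lambda>a. T (g a)) S"
  using assms(2,3)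
proof (induction S)
  case empty
  then show ?case using linear_map.T0_is_0[OF assms(1)] by simp
next
  case (insert a S)
  have T: "\<forall>x\<in>car M p. T x \<in> car M q"
    "\<forall>x\<in>car M p. \<forall>y\<in>car M p. T (x \<oplus>\<^bsub>space_at M p\<^esub> y) = T x \<oplus>\<^bsub>space_at M q\<^esub> T y"
    using assms(1) unfolding linear_map_iff by blast+
  have g: "g a \<in> car M p" "g \<in> S \<rightarrow> car M p" using insert.prems by auto
  then have "(\<lambda>b. T (g b)) \<in> S \<rightarrow> car M q" "T (g a) \<in> car M q" using T by auto
  then show ?case
    using insert.hyps insert.IH g T V.M.finsum_closed[OF g(2)] by simp
qed

section \<open>Decompositions by orthogonal idempotents\<close>

text \<open>An internal direct sum $M = \bigoplus_a e_a M$. The last two assumptions together stand for the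
  formula $x = \sum_a e_a x$, which is available in the form of the induction rule \<open>decomp_induct\<close>.\<close>

locale decomp = pmodule K M
  for K :: "('k, 'm) ring_scheme" and M :: "('p::order, 'k, 'v) pmod" +
  fixes A :: "'a set" and e :: "'a \<Rightarrow> 'p \<Rightarrow> 'v \<Rightarrow> 'v"
  assumes proj_hom: "a \<in> A \<Longrightarrow> pmodule_hom K M M (e a)"
    and proj_idem: "a \<in> A \<Longrightarrow> x \<in> car M p \<Longrightarrow> e a p (e a p x) = e a p x"
    and proj_orth: "a \<in> A \<Longrightarrow> b \<in> A \<Longrightarrow> a \<noteq> b \<Longrightarrow> x \<in> car M p \<Longrightarrow> e a p (e b p x) = zer M p"
    and proj_fin: "x \<in> car M p \<Longrightarrow> finite {a \<in> A. e a p x \<noteq> zer M p}"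
    and proj_sep: "x \<in> car M p \<Longrightarrow> (\<And>a. a \<in> A \<Longrightarrow> e a p x = zer M p) \<Longrightarrow> x = zer M p"

context decomp
begin

lemma proj_closed [simp]: "a \<in> A \<Longrightarrow> x \<in> car M p \<Longrightarrow> e a p x \<in> car M p"
  using pmodule_hom.hom_closed[OF proj_hom] .

lemma proj_zero [simp]: "a \<in> A \<Longrightarrow> e a p (zer M p) = zer M p"
  using pmodule_hom.hom_zero[OF proj_hom] .

lemmas proj_add = pmodule_hom.hom_add[OF proj_hom]
lemmas proj_smult = pmodule_hom.hom_smult[OF proj_hom]
lemmas proj_minus = pmodule_hom.hom_minus[OF proj_hom]
lemmas proj_natural = pmodule_hom.natural[OF proj_hom]

text \<open>A property that is stable under addition passes from the components of \<open>x\<close> to \<open>x\<close>: subtracting one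
  nonzero component leaves the others unchanged, so the finite number of nonzero components drops.\<close>

lemma decomp_induct [consumes 1, case_names zero add proj]:
  assumes x: "x \<in> car M p"
    and zero: "Q (zer M p)"
    and add: "\<And>y z. y \<in> car M p \<Longrightarrow> z \<in> car M p \<Longrightarrow> Q y \<Longrightarrow> Q z \<Longrightarrow> Q (y \<oplus>\<^bsub>space_at M p\<^esub> z)"
    and proj: "\<And>a. a \<in> A \<Longrightarrow> Q (e a p x)"
  shows "Q x"
  using x proj
proof (induction "card {a \<in> A. e a p x \<noteq> zer M p}" arbitrary: x rule: less_induct)
  case less
  show ?case
  proof (cases "\<forall>a\<in>A. e a p x = zer M p")
    case True
    then show ?thesis using proj_sep[OF less.prems(1)] zero by metis
  next
    case False
    then obtain a where a: "a \<in> A" "e a p x \<noteq> zer M p" by blast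
    define y where "y = x \<ominus>\<^bsub>space_at M p\<^esub> e a p x"
    have y: "y \<in> car M p" using a less.prems(1) by (simp add: y_def)
    have ey: "e b p y = (if b = a then zer M p else e b p x)" if b: "b \<in> A" for b
    proof -
      have "e b p y = e b p x \<ominus>\<^bsub>space_at M p\<^esub> e b p (e a p x)"
        unfolding y_def using a b less.prems(1) by (simp add: proj_minus)
      then show ?thesis
        using a b less.prems(1) proj_idem[OF a(1) less.prems(1)] proj_orth[OF b a(1) _ less.prems(1)]
          V.M.r_neg[OF proj_closed[OF a(1) less.prems(1)]]
        by (auto simp: a_minus_def)
    qed
    have sub: "{b \<in> A. e b p y \<noteq> zer M p} \<subset> {b \<in> A. e b p x \<noteq> zer M p}"
    proof
      show "{b \<in> A. e b p y \<noteq> zer M p} \<subseteq> {b \<in> A. e b p x \<noteq> zer M p}"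
        using ey by (auto split: if_splits)
      have "a \<in> {b \<in> A. e b p x \<noteq> zer M p} - {b \<in> A. e b p y \<noteq> zer M p}"
        using a ey by simp
      then show "{b \<in> A. e b p y \<noteq> zer M p} \<noteq> {b \<in> A. e b p x \<noteq> zer M p}" by blast
    qed
    have "Q y"
    proof (rule less.hyps[OF _ y])
      show "card {b \<in> A. e b p y \<noteq> zer M p} < card {b \<in> A. e b p x \<noteq> zer M p}"
        using sub proj_fin[OF less.prems(1)] by (rule psubset_card_mono[rotated])
      show "Q (e b p y)" if "b \<in> A" for b
        using that ey less.prems(2) zero by auto
    qed
    moreover have "x = y \<oplus>\<^bsub>space_at M p\<^esub> e a p x"
      unfolding y_def using a less.prems(1) by (simp add: a_minus_def V.M.add.m_assoc V.M.l_neg)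
    ultimately show ?thesis
      using add y less.prems a(1) proj_closed by metis
  qed
qed

lemma hom_eqI:
  assumes "pmodule_hom K M N f" "pmodule_hom K M N g"
    and x: "x \<in> car M p" and eq: "\<And>a. a \<in> A \<Longrightarrow> f p (e a p x) = g p (e a p x)"
  shows "f p x = g p x"
  using x
proof (induction rule: decomp_induct)
  case zero
  show ?case using assms(1,2)[THEN pmodule_hom.hom_zero] by simp
next
  case (add y z)
  then show ?case using assms(1,2)[THEN pmodule_hom.hom_add] by simp
qed (use eq in simp)

end

text \<open>A projection that kills a finite generating set at \<open>p\<close> vanishes at \<open>p\<close>, and each generator has only
  finitely many nonzero components.\<close>

lemma (in decomp) finite_support:
  assumes "V.fin_dim p"
  shows "finite {a \<in> A. \<exists>x\<in>car M p. e a p x \<noteq> zer M p}"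
proof -
  obtain G where G: "finite G" "G \<subseteq> car M p" "V.span p G = car M p"
    using assms unfolding V.fin_dim_def by blast
  have "{a \<in> A. \<exists>x\<in>car M p. e a p x \<noteq> zer M p} \<subseteq> (\<Union>g\<in>G. {a \<in> A. e a p g \<noteq> zer M p})"
  proof
    fix a assume "a \<in> {a \<in> A. \<exists>x\<in>car M p. e a p x \<noteq> zer M p}"
    then obtain x where a: "a \<in> A" and x: "x \<in> car M p" "e a p x \<noteq> zer M p" by blast
    have "subspace K {y \<in> car M p. e a p y = zer M p} (space_at M p)"
      unfolding subspace_iff[OF space] using a by (auto simp: proj_add proj_smult)
    then have "submodule K {y \<in> car M p. e a p y = zer M p} (space_at M p)"
      by (rule subspace.submod)
    then have "\<not> G \<subseteq> {y \<in> car M p. e a p y = zer M p}"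
      using V.span_is_subset[of G "{y \<in> car M p. e a p y = zer M p}" p] G(3) x by blast
    then show "a \<in> (\<Union>g\<in>G. {a \<in> A. e a p g \<noteq> zer M p})" using a G(2) by blast
  qed
  moreover have "finite (\<Union>g\<in>G. {a \<in> A. e a p g \<noteq> zer M p})"
    using G proj_fin by blast
  ultimately show ?thesis by (rule finite_subset)
qed

text \<open>For a submodule \<open>U\<close> this says that \<open>U\<close> is the direct sum of its intersections with the summands.\<close>

definition homogeneous :: "'a set \<Rightarrow> ('a \<Rightarrow> 'p \<Rightarrow> 'v \<Rightarrow> 'v) \<Rightarrow> ('p \<Rightarrow> 'v set) \<Rightarrow> bool" where
  "homogeneous A e U \<longleftrightarrow> (\<forall>a\<in>A. \<forall>p. \<forall>x\<in>U p. e a p x \<in> U p)"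

lemma (in decomp) homogeneous_memI:
  assumes "subpmodule K U M" "x \<in> car M p" "\<And>a. a \<in> A \<Longrightarrow> e a p x \<in> U p"
  shows "x \<in> U p"
  using assms(2)
proof (induction rule: decomp_induct)
  case (proj a)
  then show ?case by (rule assms(3))
qed (use assms(1)[unfolded subpmodule_iff[OF pmodule_axioms]] in blast)+

locale locally_finite_decomp = decomp K M A e
  for K :: "('k, 'm) ring_scheme" and M :: "('p::order, 'k, 'v) pmod"
    and A :: "'a set" and e :: "'a \<Rightarrow> 'p \<Rightarrow> 'v \<Rightarrow> 'v" +
  assumes support_finite: "finite {a \<in> A. \<exists>x\<in>car M p. e a p x \<noteq> zer M p}"

context locally_finite_decomp
begin

text \<open>An endomorphism can be prescribed on each summand separately: at every point the sum
  $\sum_a h_a e_a$ has only finitely many nonzero terms.\<close>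

lemma assemble_endo:
  assumes h: "\<And>a. a \<in> A \<Longrightarrow> pmodule_hom K M M (h a)"
  shows "\<exists>\<theta>. pmodule_hom K M M \<theta> \<and>
    (\<forall>a\<in>A. \<forall>p. \<forall>x\<in>car M p. \<theta> p (e a p x) = h a p (e a p x))"
proof -
  define S where "S p = {a \<in> A. \<exists>x\<in>car M p. e a p x \<noteq> zer M p}" for p
  have S: "finite (S p)" "S p \<subseteq> A" for p using support_finite by (auto simp: S_def)
  have he: "pmodule_hom K M M (\<lambda>p x. h a p (e a p x))" if "a \<in> A" for a
    using pmodule_hom_comp[OF proj_hom h] that by blast
  note hec = pmodule_hom.hom_closed[OF he]
  define \<theta> where "\<theta> p x = finsum (space_at M p) (\<lambda>a. h a p (e a p x)) (S p)" for p x
  have cl: "(\<lambda>a. h a p (e a p x)) \<in> S p \<rightarrow> car M p" if "x \<in> car M p" for p x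
    using hec S that by blast
  have mono: "\<theta> p x = finsum (space_at M p) (\<lambda>a. h a p (e a p x)) B"
    if x: "x \<in> car M p" and B: "S p \<subseteq> B" "finite B" "B \<subseteq> A" for p x B
    unfolding \<theta>_def
  proof (rule V.M.add.finprod_mono_neutral_cong_left)
    show "h a p (e a p x) = zer M p" if "a \<in> B - S p" for a
    proof -
      have "a \<in> A" "e a p x = zer M p" using that B x by (auto simp: S_def)
      then show ?thesis using pmodule_hom.hom_zero[OF h] by simp
    qed
    show "(\<lambda>a. h a p (e a p x)) \<in> B \<rightarrow> car M p" using hec x B by blast
  qed (use B in auto)
  have "pmodule_hom K M M \<theta>"
  proof (rule pmodule_homI)
    fix p x assume x: "x \<in> car M p"
    then show "\<theta> p x \<in> car M p" unfolding \<theta>_def by (rule V.M.finsum_closed[OF cl])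
  next
    fix p x y assume xy: "x \<in> car M p" "y \<in> car M p"
    have "\<theta> p (x \<oplus>\<^bsub>space_at M p\<^esub> y) =
      finsum (space_at M p) (\<lambda>a. h a p (e a p x) \<oplus>\<^bsub>space_at M p\<^esub> h a p (e a p y)) (S p)"
      unfolding \<theta>_def
    proof (rule V.M.finsum_cong'[OF refl])
      show "(\<lambda>a. h a p (e a p x) \<oplus>\<^bsub>space_at M p\<^esub> h a p (e a p y)) \<in> S p \<rightarrow> car M p"
        using cl[OF xy(1)] cl[OF xy(2)] by auto
      show "h a p (e a p (x \<oplus>\<^bsub>space_at M p\<^esub> y)) =
          h a p (e a p x) \<oplus>\<^bsub>space_at M p\<^esub> h a p (e a p y)" if "a \<in> S p" for a
        using pmodule_hom.hom_add[OF he xy] that S by blast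
    qed
    also have "\<dots> = \<theta> p x \<oplus>\<^bsub>space_at M p\<^esub> \<theta> p y"
      unfolding \<theta>_def by (rule V.M.finsum_addf[OF cl[OF xy(1)] cl[OF xy(2)]])
    finally show "\<theta> p (x \<oplus>\<^bsub>space_at M p\<^esub> y) = \<theta> p x \<oplus>\<^bsub>space_at M p\<^esub> \<theta> p y" .
  next
    fix p k x assume kx: "k \<in> carrier K" "x \<in> car M p"
    have "\<theta> p (k \<odot>\<^bsub>space_at M p\<^esub> x) =
      finsum (space_at M p) (\<lambda>a. k \<odot>\<^bsub>space_at M p\<^esub> h a p (e a p x)) (S p)"
      unfolding \<theta>_def
    proof (rule V.M.finsum_cong'[OF refl])
      show "(\<lambda>a. k \<odot>\<^bsub>space_at M p\<^esub> h a p (e a p x)) \<in> S p \<rightarrow> car M p"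
        using cl[OF kx(2)] kx by auto
      show "h a p (e a p (k \<odot>\<^bsub>space_at M p\<^esub> x)) = k \<odot>\<^bsub>space_at M p\<^esub> h a p (e a p x)"
        if "a \<in> S p" for a
        using pmodule_hom.hom_smult[OF he kx] that S by blast
    qed
    also have "\<dots> = k \<odot>\<^bsub>space_at M p\<^esub> \<theta> p x"
      unfolding \<theta>_def by (rule V.finsum_smult_ldistr[OF S(1) kx(1) cl[OF kx(2)], symmetric])
    finally show "\<theta> p (k \<odot>\<^bsub>space_at M p\<^esub> x) = k \<odot>\<^bsub>space_at M p\<^esub> \<theta> p x" .
  next
    fix p q x assume pq: "p \<le> q" and x: "x \<in> car M p"
    let ?B = "S p \<union> S q"
    have B: "S p \<subseteq> ?B" "S q \<subseteq> ?B" "finite ?B" "?B \<subseteq> A" using S by auto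
    have "\<theta> q (map_at M p q x) =
        finsum (space_at M q) (\<lambda>a. h a q (e a q (map_at M p q x))) ?B"
      by (rule mono) (use B x pq in auto)
    also have "\<dots> = finsum (space_at M q) (\<lambda>a. map_at M p q (h a p (e a p x))) ?B"
    proof (rule V.M.finsum_cong'[OF refl])
      show "(\<lambda>a. map_at M p q (h a p (e a p x))) \<in> ?B \<rightarrow> car M q"
        using map_closed[OF pq hec[OF _ x]] B by blast
      show "h a q (e a q (map_at M p q x)) = map_at M p q (h a p (e a p x))" if "a \<in> ?B" for a
        using pmodule_hom.natural[OF he pq x] that B by blast
    qed
    also have "\<dots> = map_at M p q (finsum (space_at M p) (\<lambda>a. h a p (e a p x)) ?B)"
      by (rule linear_finsum[OF map[OF pq], symmetric]) (use hec x B in auto)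
    also have "\<dots> = map_at M p q (\<theta> p x)" using mono[OF x B(1,3,4)] by simp
    finally show "\<theta> q (map_at M p q x) = map_at M p q (\<theta> p x)" .
  qed (rule pmodule_axioms)+
  moreover have "\<theta> p (e a p x) = h a p (e a p x)" if a: "a \<in> A" and x: "x \<in> car M p" for a p x
  proof -
    let ?B = "insert a (S p)"
    have B: "S p \<subseteq> ?B" "finite ?B" "?B \<subseteq> A" using S a by auto
    have c: "h a p (e a p x) \<in> car M p" using hec a x by blast
    have "\<theta> p (e a p x) = finsum (space_at M p) (\<lambda>b. h b p (e b p (e a p x))) ?B"
      by (rule mono) (use B x a in auto)
    also have "\<dots> = finsum (space_at M p) (\<lambda>b. if a = b then h a p (e a p x) else zer M p) ?B"
    proof (rule V.M.finsum_cong'[OF refl])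
      show "(\<lambda>b. if a = b then h a p (e a p x) else zer M p) \<in> ?B \<rightarrow> car M p" using c by auto
      show "h b p (e b p (e a p x)) = (if a = b then h a p (e a p x) else zer M p)" if "b \<in> ?B" for b
        using that B a x proj_idem[OF a x] proj_orth[OF _ a _ x, of b] pmodule_hom.hom_zero[OF h]
        by auto
    qed
    also have "\<dots> = h a p (e a p x)"
      by (rule V.M.add.finprod_singleton) (use B c in auto)
    finally show ?thesis .
  qed
  ultimately show ?thesis by blast
qed

end

section \<open>Thin decompositions\<close>

text \<open>Each summand is zero or a line at every point.\<close>

locale thin_decomp = locally_finite_decomp K M A e
  for K :: "('k, 'm) ring_scheme" and M :: "('p::order, 'k, 'v) pmod"
    and A :: "'a set" and e :: "'a \<Rightarrow> 'p \<Rightarrow> 'v \<Rightarrow> 'v" +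
  assumes thin: "a \<in> A \<Longrightarrow> x \<in> car M p \<Longrightarrow> y \<in> car M p \<Longrightarrow> e a p x \<noteq> zer M p \<Longrightarrow>
    \<exists>k\<in>carrier K. e a p y = k \<odot>\<^bsub>space_at M p\<^esub> e a p x"

context thin_decomp
begin

definition supp :: "'a \<Rightarrow> 'p set" where
  "supp a = {p. \<exists>x\<in>car M p. e a p x \<noteq> zer M p}"

text \<open>If \<open>edge a p q\<close> then the transition map from \<open>p\<close> to \<open>q\<close> restricts to an isomorphism of lines on the summand \<open>a\<close>;
  see \<open>edge_lift\<close> and \<open>edge_inj\<close>.\<close>

definition edge :: "'a \<Rightarrow> 'p \<Rightarrow> 'p \<Rightarrow> bool" where
  "edge a p q \<longleftrightarrow> p \<le> q \<and> (\<exists>x\<in>car M p. map_at M p q (e a p x) \<noteq> zer M q)"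

definition conn :: "'a \<Rightarrow> ('p \<times> 'p) set" where
  "conn a = {(p, q). edge a p q \<or> edge a q p}\<^sup>*"

lemma suppI: "x \<in> car M p \<Longrightarrow> e a p x \<noteq> zer M p \<Longrightarrow> p \<in> supp a"
  unfolding supp_def by blast

lemma edge_supp:
  assumes "a \<in> A" "edge a p q"
  shows "p \<in> supp a" "q \<in> supp a"
proof -
  obtain x where x: "p \<le> q" "x \<in> car M p" "map_at M p q (e a p x) \<noteq> zer M q"
    using assms unfolding edge_def by blast
  show "p \<in> supp a"
  proof (rule suppI[OF x(2)])
    show "e a p x \<noteq> zer M p" using x by auto
  qed
  show "q \<in> supp a"
    using suppI[of "map_at M p q x" q a] x proj_natural[OF assms(1) x(1,2)] by simp
qed

text \<open>A linear map on a line is injective or zero.\<close>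

lemma thin_nonzero:
  assumes a: "a \<in> A" and T: "linear_map K (space_at M p) (space_at N q) T"
    and x: "x \<in> car M p" and nz: "T (e a p x) \<noteq> zer N q"
    and y: "y \<in> car M p" "e a p y \<noteq> zer M p"
  shows "T (e a p y) \<noteq> zer N q"
proof
  assume 0: "T (e a p y) = zer N q"
  interpret T: linear_map K "space_at M p" "space_at N q" T by fact
  obtain k where k: "k \<in> carrier K" "e a p x = k \<odot>\<^bsub>space_at M p\<^esub> e a p y"
    using thin[OF a y(1) x y(2)] by blast
  have "T (e a p x) = k \<odot>\<^bsub>space_at N q\<^esub> T (e a p y)"
    unfolding k(2) by (rule T.T_smult[OF k(1) proj_closed[OF a y(1)]])
  also have "\<dots> = zer N q"
    unfolding 0 by (rule module.smult_r_null[OF vectorspace.axioms(1)[OF T.W.vectorspace_axioms] k(1)])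
  finally show False using nz by simp
qed

lemma edge_lift:
  assumes a: "a \<in> A" and "edge a p q" and y: "y \<in> car M q"
  shows "\<exists>x\<in>car M p. map_at M p q (e a p x) = e a q y"
proof -
  obtain x where x: "p \<le> q" "x \<in> car M p" "map_at M p q (e a p x) \<noteq> zer M q"
    using assms unfolding edge_def by blast
  have nz: "e a q (map_at M p q x) \<noteq> zer M q"
    using x proj_natural[OF a x(1,2)] by simp
  obtain k where k: "k \<in> carrier K" "e a q y = k \<odot>\<^bsub>space_at M q\<^esub> e a q (map_at M p q x)"
    using thin[OF a map_closed[OF x(1,2)] y nz] by blast
  have "map_at M p q (e a p (k \<odot>\<^bsub>space_at M p\<^esub> x)) = e a q y"
    using k x a by (simp add: proj_smult map_smult proj_natural)
  then show ?thesis using k(1) x(2) by (intro bexI[of _ "k \<odot>\<^bsub>space_at M p\<^esub> x"]) simp_all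
qed

lemma edge_inj:
  assumes a: "a \<in> A" and "edge a p q" and y: "y \<in> car M p" "e a p y \<noteq> zer M p"
  shows "map_at M p q (e a p y) \<noteq> zer M q"
proof -
  obtain x where x: "p \<le> q" "x \<in> car M p" "map_at M p q (e a p x) \<noteq> zer M q"
    using assms unfolding edge_def by blast
  show ?thesis by (rule thin_nonzero[OF a map[OF x(1)] x(2,3) y])
qed

text \<open>The endomorphism $e_a h e_a$ commutes with the transition map along an edge, which is bijective on the
  summand \<open>a\<close>. So it vanishes at one end of the edge if and only if it vanishes at the other.\<close>

lemma loop_edge:
  assumes a: "a \<in> A" and h: "pmodule_hom K M M h" and pq: "edge a p q \<or> edge a q p"
    and nz: "\<exists>x\<in>car M p. e a p (h p (e a p x)) \<noteq> zer M p"
  shows "\<exists>x\<in>car M q. e a q (h q (e a q x)) \<noteq> zer M q"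
proof -
  interpret h: pmodule_hom K M M h by fact
  obtain x where x: "x \<in> car M p" "e a p (h p (e a p x)) \<noteq> zer M p" using nz by blast
  from pq show ?thesis
  proof
    assume E: "edge a p q"
    then have le: "p \<le> q" by (simp add: edge_def)
    have "map_at M p q (e a p (h p (e a p x))) \<noteq> zer M q"
      by (rule edge_inj[OF a E _ x(2)]) (use x a in simp)
    moreover have "map_at M p q (e a p (h p (e a p x))) = e a q (h q (e a q (map_at M p q x)))"
      using le x(1) a by (simp add: proj_natural h.natural)
    ultimately show ?thesis using map_closed[OF le x(1)] by metis
  next
    assume E: "edge a q p"
    then have le: "q \<le> p" by (simp add: edge_def)
    obtain y where y: "y \<in> car M q" "map_at M q p (e a q y) = e a p x"
      using edge_lift[OF a E x(1)] by blast
    have "map_at M q p (e a q (h q (e a q y))) = e a p (h p (e a p x))"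
      using le y a by (simp flip: proj_natural h.natural)
    then have "e a q (h q (e a q y)) \<noteq> zer M q" using x(2) le by auto
    then show ?thesis using y(1) by blast
  qed
qed

lemma loop_conn:
  assumes a: "a \<in> A" and h: "pmodule_hom K M M h" and pq: "(p, q) \<in> conn a"
    and nz: "\<exists>x\<in>car M p. e a p (h p (e a p x)) \<noteq> zer M p"
  shows "\<exists>x\<in>car M q. e a q (h q (e a q x)) \<noteq> zer M q"
  using pq nz unfolding conn_def
  by (induction rule: rtrancl_induct) (auto intro: loop_edge[OF a h])

text \<open>Finitely many lines span the space at \<open>p\<close>.\<close>

lemma finite_dimensional: "vectorspace.fin_dim K (space_at M p)"
proof -
  let ?S = "{a \<in> A. \<exists>x\<in>car M p. e a p x \<noteq> zer M p}"
  define u where "u a = (SOME x. x \<in> car M p \<and> e a p x \<noteq> zer M p)" for a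
  have u: "u a \<in> car M p \<and> e a p (u a) \<noteq> zer M p" if "a \<in> ?S" for a
    unfolding u_def by (rule someI_ex) (use that in blast)
  define B where "B = (\<lambda>a. e a p (u a)) ` ?S"
  have B: "finite B" using support_finite by (simp add: B_def)
  have BM: "B \<subseteq> car M p" unfolding B_def using u proj_closed by blast
  have sub: "subspace K (V.span p B) (space_at M p)" by (rule V.span_is_subspace[OF BM])
  note sp = sub[unfolded subspace_iff[OF space]]
  have "x \<in> V.span p B" if x: "x \<in> car M p" for x
    using x
  proof (induction rule: decomp_induct)
    case (proj a)
    show ?case
    proof (cases "e a p x = zer M p")
      case True
      then show ?thesis using sp by simp
    next
      case False
      then have a: "a \<in> ?S" using proj x by blast
      obtain k where k: "k \<in> carrier K" "e a p x = k \<odot>\<^bsub>space_at M p\<^esub> e a p (u a)"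
        using thin[OF proj conjunct1[OF u[OF a]] x conjunct2[OF u[OF a]]] by blast
      have "e a p (u a) \<in> V.span p B"
        by (rule V.span_mem[OF BM]) (use a in \<open>auto simp: B_def\<close>)
      then show ?thesis using sp k by simp
    qed
  qed (use sp in auto)
  then have "V.span p B = car M p" using sp by auto
  then show ?thesis unfolding V.fin_dim_def using B BM by blast
qed

definition component :: "'a \<Rightarrow> 'p \<Rightarrow> 'p set" where
  "component a p = {q \<in> supp a. (p, q) \<in> conn a}"

lemma conn_sym: "(p, q) \<in> conn a \<Longrightarrow> (q, p) \<in> conn a"
proof -
  have "sym (conn a)" unfolding conn_def by (rule sym_rtrancl) (auto simp: sym_def)
  then show "(p, q) \<in> conn a \<Longrightarrow> (q, p) \<in> conn a" by (rule symD)
qed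

lemma component_edge:
  assumes "a \<in> A" "edge a q r \<or> edge a r q" "q \<in> component a p"
  shows "r \<in> component a p"
proof -
  have "(p, q) \<in> conn a" using assms(3) by (simp add: component_def)
  then have "(p, r) \<in> conn a"
    unfolding conn_def by (rule rtrancl_into_rtrancl) (use assms(2) in simp)
  then show ?thesis using edge_supp[OF assms(1)] assms(2) by (auto simp: component_def)
qed

lemma component_self: "p \<in> supp a \<Longrightarrow> p \<in> component a p"
  by (simp add: component_def conn_def)

lemma component_eq:
  assumes "q \<in> component a p"
  shows "component a q = component a p"
proof -
  have pq: "(p, q) \<in> conn a" using assms by (simp add: component_def)
  have "(p, r) \<in> conn a \<longleftrightarrow> (q, r) \<in> conn a" for r
    using pq conn_sym[OF pq] unfolding conn_def by (meson rtrancl_trans)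
  then show ?thesis by (auto simp: component_def)
qed

end

text \<open>By \<open>loop_conn\<close>, connectedness of the support makes every endomorphism of a summand either zero
  or nonzero at all points of the support.\<close>

locale brick_decomp = thin_decomp K M A e
  for K :: "('k, 'm) ring_scheme" and M :: "('p::order, 'k, 'v) pmod"
    and A :: "'a set" and e :: "'a \<Rightarrow> 'p \<Rightarrow> 'v \<Rightarrow> 'v" +
  assumes supp_nonempty: "a \<in> A \<Longrightarrow> supp a \<noteq> {}"
    and connected: "a \<in> A \<Longrightarrow> p \<in> supp a \<Longrightarrow> q \<in> supp a \<Longrightarrow> (p, q) \<in> conn a"

text \<open>Transition maps of a thin summand vanish between different connected components of its support, so
  the restrictions to the components are again summands. By the second conclusion, submodules that are homogeneous
  for \<open>e\<close> remain so for \<open>f\<close>.\<close>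

theorem (in thin_decomp) refine_to_bricks:
  obtains B :: "('a \<times> 'p set) set" and f where "brick_decomp K M B f"
    and "\<And>b. b \<in> B \<Longrightarrow> \<exists>a\<in>A. \<forall>p. \<forall>x\<in>car M p. f b p x = e a p x \<or> f b p x = zer M p"
proof -
  define B where "B = {(a, component a p) | a p. a \<in> A \<and> p \<in> supp a}"
  define f where "f b p x = (if p \<in> snd b then e (fst b) p x else zer M p)" for b p x
  have BA: "fst b \<in> A" if "b \<in> B" for b using that by (auto simp: B_def)
  have Bc: "snd b = component (fst b) p" if "b \<in> B" "p \<in> snd b" for b p
    using that component_eq by (auto simp: B_def)
  have Bsupp: "p \<in> supp (fst b)" if "b \<in> B" "p \<in> snd b" for b p
    using that by (auto simp: B_def component_def)
  have Bedge: "q \<in> snd b" if "b \<in> B" "p \<in> snd b" "edge (fst b) p q \<or> edge (fst b) q p" for b p q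
    using that component_edge BA Bc by metis
  have fin: "finite {b \<in> B. \<exists>x\<in>car M p. f b p x \<noteq> zer M p}" for p
  proof (rule finite_subset)
    show "{b \<in> B. \<exists>x\<in>car M p. f b p x \<noteq> zer M p} \<subseteq>
        (\<lambda>a. (a, component a p)) ` {a \<in> A. \<exists>x\<in>car M p. e a p x \<noteq> zer M p}"
    proof
      fix b assume "b \<in> {b \<in> B. \<exists>x\<in>car M p. f b p x \<noteq> zer M p}"
      then obtain x where b: "b \<in> B" "x \<in> car M p" "f b p x \<noteq> zer M p" by blast
      then have "p \<in> snd b" "e (fst b) p x \<noteq> zer M p" by (auto simp: f_def split: if_splits)
      then show "b \<in> (\<lambda>a. (a, component a p)) ` {a \<in> A. \<exists>x\<in>car M p. e a p x \<noteq> zer M p}"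
        using b BA Bc by (intro image_eqI[of _ _ "fst b"]) (auto simp: prod_eq_iff)
    qed
  qed (use support_finite in simp)
  have T: "thin_decomp K M B f"
  proof (intro thin_decomp.intro locally_finite_decomp.intro decomp.intro pmodule_axioms
      decomp_axioms.intro locally_finite_decomp_axioms.intro thin_decomp_axioms.intro)
    fix b assume b: "b \<in> B"
    show "pmodule_hom K M M (f b)"
    proof (rule pmodule_homI)
      fix p q x assume pq: "p \<le> q" and x: "x \<in> car M p"
      have "map_at M p q (e (fst b) p x) = zer M q" if "(p \<in> snd b) \<noteq> (q \<in> snd b)"
        using Bedge[OF b] that pq x unfolding edge_def by metis
      then show "f b q (map_at M p q x) = map_at M p q (f b p x)"
        using proj_natural[OF BA[OF b] pq x] pq by (auto simp: f_def)
    qed (auto simp: f_def BA[OF b] proj_add proj_smult pmodule_axioms)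
  next
    fix b x p assume "b \<in> B" "x \<in> car M p"
    then show "f b p (f b p x) = f b p x" using BA by (auto simp: f_def proj_idem)
  next
    fix b c x p assume bc: "b \<in> B" "c \<in> B" "b \<noteq> c" and x: "x \<in> car M p"
    have "fst b \<noteq> fst c" if "p \<in> snd b" "p \<in> snd c"
      using Bc[OF bc(1) that(1)] Bc[OF bc(2) that(2)] bc(3) by (auto simp: prod_eq_iff)
    then show "f b p (f c p x) = zer M p"
      using BA bc x proj_orth by (auto simp: f_def)
  next
    fix x p assume "x \<in> car M p"
    then show "finite {b \<in> B. f b p x \<noteq> zer M p}"
      using fin[of p] by (elim finite_subset[rotated]) blast
  next
    fix x p assume x: "x \<in> car M p" and 0: "\<And>b. b \<in> B \<Longrightarrow> f b p x = zer M p"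
    show "x = zer M p"
    proof (rule proj_sep[OF x], rule ccontr)
      fix a assume a: "a \<in> A" "e a p x \<noteq> zer M p"
      have "p \<in> supp a" using suppI[of x p a] x a by simp
      then have "(a, component a p) \<in> B" "p \<in> component a p"
        using a component_self by (auto simp: B_def)
      then show False using 0[of "(a, component a p)"] a by (simp add: f_def)
    qed
  next
    fix b x p y assume "b \<in> B" "x \<in> car M p" "y \<in> car M p" "f b p x \<noteq> zer M p"
    then show "\<exists>k\<in>carrier K. f b p y = k \<odot>\<^bsub>space_at M p\<^esub> f b p x"
      using thin BA by (auto simp: f_def split: if_splits)
  qed (rule fin)
  then interpret F: thin_decomp K M B f .
  have Fsupp: "F.supp b = snd b" if b: "b \<in> B" for b
    using Bsupp[OF b] by (auto simp: F.supp_def supp_def f_def split: if_splits)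
  have Fedge: "F.edge b p q" if "p \<in> snd b" "edge (fst b) p q" for b p q
    using that by (auto simp: F.edge_def edge_def f_def)
  have "brick_decomp K M B f"
  proof (unfold_locales)
    fix b assume b: "b \<in> B"
    then show "F.supp b \<noteq> {}" using component_self by (force simp: Fsupp B_def)
    fix p q assume "p \<in> F.supp b" "q \<in> F.supp b"
    then have pq: "p \<in> snd b" "q \<in> snd b" using b by (simp_all add: Fsupp)
    then have "(p, q) \<in> conn (fst b)" using Bc[OF b] by (auto simp: component_def)
    then have "(p, q) \<in> F.conn b \<and> q \<in> snd b"
      unfolding conn_def
    proof (induction rule: rtrancl_induct)
      case base
      show ?case using pq by (simp add: F.conn_def)
    next
      case (step r s)
      then have s: "s \<in> snd b" using Bedge[OF b] by blast
      moreover have "F.edge b r s \<or> F.edge b s r" using Fedge step s by blast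
      ultimately show ?case
        using step unfolding F.conn_def by (blast intro: rtrancl_into_rtrancl)
    qed
    then show "(p, q) \<in> F.conn b" ..
  qed
  moreover have "\<exists>a\<in>A. \<forall>p. \<forall>x\<in>car M p. f b p x = e a p x \<or> f b p x = zer M p" if "b \<in> B" for b
    using BA[OF that] by (auto simp: f_def)
  ultimately show ?thesis using that by blast
qed

section \<open>Exchange of summands\<close>

context brick_decomp
begin

text \<open>Homomorphisms between the summands \<open>a\<close> and \<open>b\<close> are represented by endomorphisms \<open>f\<close> of \<open>M\<close>, as $e_b f e_a$.\<close>

definition linked :: "'p \<Rightarrow> 'a \<Rightarrow> 'a \<Rightarrow> bool" where
  "linked p a b \<longleftrightarrow> (\<exists>f. pmodule_hom K M M f \<and> (\<exists>x\<in>car M p. e b p (f p (e a p x)) \<noteq> zer M p))"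

text \<open>Two bricks that are linked in both directions at one point are isomorphic: the composite loop is nonzero on the
  whole support (\<open>similar_loop\<close>), so both maps are bijective at every point.\<close>

definition similar :: "'a \<Rightarrow> 'a \<Rightarrow> bool" where
  "similar a b \<longleftrightarrow> (\<exists>p. linked p a b \<and> linked p b a)"

definition iso_class :: "'a \<Rightarrow> 'a set" where
  "iso_class a = {b \<in> A. similar a b}"

text \<open>Regard \<open>\<theta>\<close> as a matrix of homomorphisms between bricks. The condition says that its diagonal
  block for the class \<open>c\<close> is injective at \<open>p\<close>.\<close>

definition diag_injective :: "'a set \<Rightarrow> 'p \<Rightarrow> ('p \<Rightarrow> 'v \<Rightarrow> 'v) \<Rightarrow> bool" where
  "diag_injective c p \<theta> \<longleftrightarrow> (\<forall>x\<in>car M p. (\<forall>b\<in>A - c. e b p x = zer M p) \<longrightarrow>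
    (\<forall>b\<in>c. e b p (\<theta> p x) = zer M p) \<longrightarrow> x = zer M p)"

lemma linkedI:
  "pmodule_hom K M M f \<Longrightarrow> x \<in> car M p \<Longrightarrow> e b p (f p (e a p x)) \<noteq> zer M p \<Longrightarrow> linked p a b"
  unfolding linked_def by blast

lemma linked_supp:
  assumes "a \<in> A" "b \<in> A" "linked p a b"
  shows "p \<in> supp a" "p \<in> supp b"
proof -
  obtain f x where f: "pmodule_hom K M M f" and x: "x \<in> car M p"
    and nz: "e b p (f p (e a p x)) \<noteq> zer M p" using assms unfolding linked_def by blast
  show "p \<in> supp b"
    by (rule suppI[OF _ nz]) (rule pmodule_hom.hom_closed[OF f proj_closed[OF assms(1) x]])
  show "p \<in> supp a"
  proof (rule suppI[OF x])
    show "e a p x \<noteq> zer M p" using nz pmodule_hom.hom_zero[OF f] assms(2) by auto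
  qed
qed

lemma linked_self: "p \<in> supp a \<Longrightarrow> a \<in> A \<Longrightarrow> linked p a a"
  unfolding supp_def using linkedI[OF pmodule_hom_id[OF pmodule_axioms]] by (auto simp: proj_idem)

text \<open>Nonzero maps between lines have a nonzero composite.\<close>

lemma linked_compose:
  assumes ab: "a \<in> A" "b \<in> A"
    and f: "pmodule_hom K M M f" and x: "x \<in> car M p" and fx: "e b p (f p (e a p x)) \<noteq> zer M p"
    and g: "pmodule_hom K M M g" and y: "y \<in> car M p" and gy: "e d p (g p (e b p y)) \<noteq> zer M p"
    and d: "d \<in> A"
  shows "e d p (g p (e b p (f p (e a p x)))) \<noteq> zer M p"
  by (rule thin_nonzero[OF ab(2) pmodule_hom.component[OF pmodule_hom_comp[OF g proj_hom[OF d]]] y gy])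
    (use x ab f fx in \<open>simp_all add: pmodule_hom.hom_closed[OF f]\<close>)

lemma hom_proj_comp:
  assumes "b \<in> A" "pmodule_hom K M M f" "pmodule_hom K M M g"
  shows "pmodule_hom K M M (\<lambda>p x. g p (e b p (f p x)))"
  by (rule pmodule_hom_comp[OF pmodule_hom_comp[OF assms(2) proj_hom[OF assms(1)]] assms(3)])

lemma linked_trans:
  assumes "a \<in> A" "b \<in> A" "d \<in> A" "linked p a b" "linked p b d"
  shows "linked p a d"
proof -
  obtain f x where f: "pmodule_hom K M M f" "x \<in> car M p" "e b p (f p (e a p x)) \<noteq> zer M p"
    using assms(4) unfolding linked_def by blast
  obtain g y where g: "pmodule_hom K M M g" "y \<in> car M p" "e d p (g p (e b p y)) \<noteq> zer M p"
    using assms(5) unfolding linked_def by blast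
  show ?thesis
    by (rule linkedI[OF hom_proj_comp[OF assms(2) f(1) g(1)] f(2)])
      (rule linked_compose[OF assms(1,2) f g assms(3)])
qed

lemma similar_loop:
  assumes ab: "a \<in> A" "b \<in> A" and "similar a b"
  obtains f g where "pmodule_hom K M M f" "pmodule_hom K M M g"
    "\<And>q. q \<in> supp a \<Longrightarrow> \<exists>z\<in>car M q. e a q (g q (e b q (f q (e a q z)))) \<noteq> zer M q"
proof -
  obtain p where l: "linked p a b" "linked p b a" using assms unfolding similar_def by blast
  obtain f x where f: "pmodule_hom K M M f" "x \<in> car M p" "e b p (f p (e a p x)) \<noteq> zer M p"
    using l(1) unfolding linked_def by blast
  obtain g y where g: "pmodule_hom K M M g" "y \<in> car M p" "e a p (g p (e b p y)) \<noteq> zer M p"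
    using l(2) unfolding linked_def by blast
  have nz: "\<exists>x\<in>car M p. e a p (g p (e b p (f p (e a p x)))) \<noteq> zer M p"
    using linked_compose[OF ab f g ab(1)] f(2) by blast
  have "\<exists>z\<in>car M q. e a q (g q (e b q (f q (e a q z)))) \<noteq> zer M q" if "q \<in> supp a" for q
    by (rule loop_conn[OF ab(1) hom_proj_comp[OF ab(2) f(1) g(1)] connected[OF ab(1) _ that] nz])
      (rule linked_supp[OF ab l(1)])
  then show ?thesis using that f(1) g(1) by blast
qed

lemma similar_linked:
  assumes ab: "a \<in> A" "b \<in> A" and "similar a b" and q: "q \<in> supp a"
  shows "linked q a b" "linked q b a"
proof -
  obtain f g where f: "pmodule_hom K M M f" and g: "pmodule_hom K M M g"
    and ex: "\<And>q. q \<in> supp a \<Longrightarrow> \<exists>z\<in>car M q. e a q (g q (e b q (f q (e a q z)))) \<noteq> zer M q"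
    using similar_loop[OF assms(1-3)] by blast
  obtain z where z: "z \<in> car M q" "e a q (g q (e b q (f q (e a q z)))) \<noteq> zer M q"
    using ex[OF q] by blast
  show "linked q b a"
    by (rule linkedI[OF g _ z(2)]) (use f z ab in \<open>simp add: pmodule_hom.hom_closed[OF f]\<close>)
  have "e b q (f q (e a q z)) \<noteq> zer M q"
    using z(2) pmodule_hom.hom_zero[OF g] ab by auto
  then show "linked q a b" by (rule linkedI[OF f z(1)])
qed

lemma similar_supp: "a \<in> A \<Longrightarrow> b \<in> A \<Longrightarrow> similar a b \<Longrightarrow> q \<in> supp a \<Longrightarrow> q \<in> supp b"
  using similar_linked linked_supp by blast

lemma similar_sym: "similar a b \<Longrightarrow> similar b a"
  unfolding similar_def by blast

lemma similar_refl: "a \<in> A \<Longrightarrow> similar a a"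
  unfolding similar_def using supp_nonempty linked_self by blast

lemma similar_trans:
  assumes "a \<in> A" "b \<in> A" "d \<in> A" "similar a b" "similar b d"
  shows "similar a d"
proof -
  obtain p where p: "p \<in> supp a" using supp_nonempty assms(1) by blast
  then have "p \<in> supp b" using similar_supp assms by blast
  then show ?thesis
    unfolding similar_def
    using similar_linked[OF assms(1,2,4) p] similar_linked[OF assms(2,3,5)] linked_trans assms(1-3)
    by meson
qed

text \<open>A loop through \<open>b\<close> that is nonzero at \<open>q\<close> would vanish on the image of the transition map of \<open>a\<close> if the transition
  map of \<open>b\<close> were zero.\<close>

lemma similar_edge:
  assumes ab: "a \<in> A" "b \<in> A" and "similar a b" and pq: "edge a p q"
  shows "edge b p q"
proof -
  obtain f g where f: "pmodule_hom K M M f" and g: "pmodule_hom K M M g"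
    and ex: "\<And>q. q \<in> supp a \<Longrightarrow> \<exists>z\<in>car M q. e a q (g q (e b q (f q (e a q z)))) \<noteq> zer M q"
    using similar_loop[OF assms(1-3)] by blast
  interpret f: pmodule_hom K M M f by fact
  obtain x where x: "p \<le> q" "x \<in> car M p" "map_at M p q (e a p x) \<noteq> zer M q"
    using pq unfolding edge_def by blast
  obtain z where z: "z \<in> car M q" "e a q (g q (e b q (f q (e a q z)))) \<noteq> zer M q"
    using ex[OF edge_supp(2)[OF ab(1) pq]] by blast
  have "e a q (g q (e b q (f q (e a q (map_at M p q x))))) \<noteq> zer M q"
    by (rule thin_nonzero[OF ab(1)
          pmodule_hom.component[OF hom_proj_comp[OF ab(2) f pmodule_hom_comp[OF g proj_hom[OF ab(1)]]]] z])
      (use x ab in \<open>simp_all add: proj_natural\<close>)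
  also have "f q (e a q (map_at M p q x)) = map_at M p q (f p (e a p x))"
    using x ab by (simp add: proj_natural f.natural)
  also have "e b q \<dots> = map_at M p q (e b p (f p (e a p x)))"
    using x ab by (simp add: proj_natural)
  finally have "map_at M p q (e b p (f p (e a p x))) \<noteq> zer M q"
    using pmodule_hom.hom_zero[OF g] ab(1) by auto
  then show ?thesis unfolding edge_def using x ab by (metis f.hom_closed proj_closed)
qed

lemma iso_class_sub: "iso_class a \<subseteq> A"
  by (auto simp: iso_class_def)

lemma iso_class_eq:
  assumes "a \<in> A" "b \<in> iso_class a"
  shows "iso_class b = iso_class a"
  using assms similar_trans similar_sym unfolding iso_class_def by blast

text \<open>All bricks of the class have an edge from \<open>p\<close> to \<open>q\<close>, so the transition map is an isomorphism between
  the parts of $M_p$ and $M_q$ that belong to the class, and it commutes with the diagonal block of \<open>\<theta>\<close>.\<close>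

lemma diag_injective_edge:
  assumes a: "a \<in> A" and pq: "edge a p q" and \<theta>: "pmodule_hom K M M \<theta>"
  shows "diag_injective (iso_class a) p \<theta> \<longleftrightarrow> diag_injective (iso_class a) q \<theta>"
proof -
  interpret \<theta>: pmodule_hom K M M \<theta> by fact
  have le: "p \<le> q" using pq by (simp add: edge_def)
  have E: "edge b p q" if "b \<in> iso_class a" for b
    using that similar_edge[OF a _ _ pq] by (auto simp: iso_class_def)
  note bA = subsetD[OF iso_class_sub]
  show ?thesis
  proof
    assume F: "diag_injective (iso_class a) p \<theta>"
    show "diag_injective (iso_class a) q \<theta>"
      unfolding diag_injective_def
    proof (intro ballI impI)
      fix x assume x: "x \<in> car M q" and off: "\<forall>b\<in>A - iso_class a. e b q x = zer M q"
        and on: "\<forall>b\<in>iso_class a. e b q (\<theta> q x) = zer M q"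
      have "\<exists>y\<in>car M p. (\<forall>b\<in>A - iso_class a. e b p y = zer M p) \<and> map_at M p q y = x"
        using x
      proof (induction rule: decomp_induct)
        case zero
        show ?case by (rule bexI[of _ "zer M p"]) (use le in auto)
      next
        case (add y z)
        then obtain y' z' where "y' \<in> car M p" "z' \<in> car M p"
          "\<forall>b\<in>A - iso_class a. e b p y' = zer M p" "\<forall>b\<in>A - iso_class a. e b p z' = zer M p"
          "map_at M p q y' = y" "map_at M p q z' = z" by blast
        then show ?case
          by (intro bexI[of _ "y' \<oplus>\<^bsub>space_at M p\<^esub> z'"]) (simp_all add: proj_add map_add[OF le])
      next
        case (proj b)
        show ?case
        proof (cases "b \<in> iso_class a")
          case True
          obtain y where y: "y \<in> car M p" "map_at M p q (e b p y) = e b q x"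
            using edge_lift[OF proj E[OF True] x] by blast
          show ?thesis
            by (rule bexI[of _ "e b p y"]) (use y proj True in \<open>auto intro: proj_orth\<close>)
        next
          case False
          then show ?thesis using off proj le by (intro bexI[of _ "zer M p"]) auto
        qed
      qed
      then obtain y where y: "y \<in> car M p" "\<forall>b\<in>A - iso_class a. e b p y = zer M p"
        "map_at M p q y = x" by blast
      have "e b p (\<theta> p y) = zer M p" if b: "b \<in> iso_class a" for b
      proof (rule ccontr)
        assume "e b p (\<theta> p y) \<noteq> zer M p"
        then have "map_at M p q (e b p (\<theta> p y)) \<noteq> zer M q"
          using edge_inj[OF bA[OF b] E[OF b]] y by simp
        moreover have "map_at M p q (e b p (\<theta> p y)) = e b q (\<theta> q x)"
          using y(1) le bA[OF b] by (simp add: proj_natural \<theta>.natural flip: y(3))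
        ultimately show False using on b by simp
      qed
      then have "y = zer M p" using F y unfolding diag_injective_def by blast
      then show "x = zer M q" using y(3) le by auto
    qed
  next
    assume F: "diag_injective (iso_class a) q \<theta>"
    show "diag_injective (iso_class a) p \<theta>"
      unfolding diag_injective_def
    proof (intro ballI impI)
      fix x assume x: "x \<in> car M p" and off: "\<forall>b\<in>A - iso_class a. e b p x = zer M p"
        and on: "\<forall>b\<in>iso_class a. e b p (\<theta> p x) = zer M p"
      have "e b q (map_at M p q x) = zer M q" if "b \<in> A - iso_class a" for b
        using that off x le by (simp add: proj_natural)
      moreover have "e b q (\<theta> q (map_at M p q x)) = zer M q" if "b \<in> iso_class a" for b
        using that on x le bA by (simp add: proj_natural \<theta>.natural)
      ultimately have 0: "map_at M p q x = zer M q"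
        using F x le unfolding diag_injective_def by simp
      show "x = zer M p"
      proof (rule proj_sep[OF x], rule ccontr)
        fix b assume b: "b \<in> A" "e b p x \<noteq> zer M p"
        then have "b \<in> iso_class a" using off by blast
        then have "map_at M p q (e b p x) \<noteq> zer M q" using edge_inj[OF b(1) E x b(2)] by blast
        then show False using 0 b x le by (simp flip: proj_natural)
      qed
    qed
  qed
qed

lemma diag_injective_conn:
  assumes a: "a \<in> A" and pq: "(p, q) \<in> conn a" and \<theta>: "pmodule_hom K M M \<theta>"
    and F: "diag_injective (iso_class a) p \<theta>"
  shows "diag_injective (iso_class a) q \<theta>"
  using pq F unfolding conn_def
  by (induction rule: rtrancl_induct) (use diag_injective_edge[OF a _ \<theta>] in blast)+

text \<open>Steinitz exchange for the vectors that generate the bricks of \<open>c\<close> at \<open>p\<close>. The bricks in \<open>F\<close> have already been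
  sent to summands of \<open>\<pi>\<close>, those in \<open>c - F\<close> are still fixed. If no choice of \<open>j\<close> worked for the next brick \<open>a\<close> with
  generator \<open>u\<close>, then each $\pi_j u$, hence also their sum \<open>u\<close>, would lie modulo the other classes in the image of the
  remaining bricks; but this image does not contain \<open>u\<close>, which is fixed at this stage.\<close>

lemma select_summands:
  assumes "decomp K M J \<pi>"
    and c: "c \<subseteq> A" "\<And>b. b \<in> c \<Longrightarrow> p \<in> supp b" and F: "finite F" "F \<subseteq> c"
  shows "\<exists>s. (\<forall>b\<in>F. s b \<in> J) \<and> (\<forall>\<theta>. pmodule_hom K M M \<theta> \<longrightarrow>
    (\<forall>b\<in>F. \<forall>x\<in>car M p. \<theta> p (e b p x) = \<pi> (s b) p (e b p x)) \<longrightarrow>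
    (\<forall>b\<in>c - F. \<forall>x\<in>car M p. \<theta> p (e b p x) = e b p x) \<longrightarrow> diag_injective c p \<theta>)"
  using F
proof (induction F rule: finite_induct)
  case empty
  have "diag_injective c p \<theta>" if \<theta>: "pmodule_hom K M M \<theta>"
    and id: "\<forall>b\<in>c - {}. \<forall>x\<in>car M p. \<theta> p (e b p x) = e b p x" for \<theta>
    unfolding diag_injective_def
  proof (intro ballI impI)
    fix x assume x: "x \<in> car M p" and off: "\<forall>b\<in>A - c. e b p x = zer M p"
      and on: "\<forall>b\<in>c. e b p (\<theta> p x) = zer M p"
    have "\<theta> p x = x"
    proof (rule hom_eqI[OF \<theta> pmodule_hom_id[OF pmodule_axioms] x])
      show "\<theta> p (e a p x) = e a p x" if "a \<in> A" for a
        using that id off x pmodule_hom.hom_zero[OF \<theta>] by (cases "a \<in> c") auto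
    qed
    then show "x = zer M p" using proj_sep[OF x] on off by (metis DiffI)
  qed
  then show ?case by blast
next
  case (insert a F)
  interpret P: decomp K M J \<pi> by fact
  have a: "a \<in> A" "a \<in> c" "a \<notin> F" using insert c by auto
  obtain s where sJ: "\<forall>b\<in>F. s b \<in> J"
    and s: "\<And>\<theta>. pmodule_hom K M M \<theta> \<Longrightarrow>
      \<forall>b\<in>F. \<forall>x\<in>car M p. \<theta> p (e b p x) = \<pi> (s b) p (e b p x) \<Longrightarrow>
      \<forall>b\<in>c - F. \<forall>x\<in>car M p. \<theta> p (e b p x) = e b p x \<Longrightarrow> diag_injective c p \<theta>"
    using insert.IH insert.prems by blast
  \<comment> \<open>The stage reached before \<open>a\<close> is treated.\<close>
  define h where "h b = (if b \<in> F then \<pi> (s b) else (\<lambda>p x. x))" for b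
  have "pmodule_hom K M M (h b)" for b
    using sJ P.proj_hom pmodule_hom_id[OF pmodule_axioms] by (simp add: h_def)
  then obtain \<theta>0 where \<theta>0: "pmodule_hom K M M \<theta>0"
    and \<theta>0e: "\<And>b p x. b \<in> A \<Longrightarrow> x \<in> car M p \<Longrightarrow> \<theta>0 p (e b p x) = h b p (e b p x)"
    using assemble_endo[of h] by blast
  interpret \<theta>0: pmodule_hom K M M \<theta>0 by fact
  have F0: "diag_injective c p \<theta>0"
    by (rule s[OF \<theta>0]) (use \<theta>0e c insert.prems in \<open>auto simp: h_def\<close>)
  obtain u where u: "u \<in> car M p" "e a p u \<noteq> zer M p"
    using c(2)[OF a(2)] unfolding supp_def by blast
  have "\<exists>j\<in>J. \<forall>\<theta>. pmodule_hom K M M \<theta> \<longrightarrow>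
    (\<forall>b\<in>insert a F. \<forall>x\<in>car M p. \<theta> p (e b p x) = \<pi> ((s(a := j)) b) p (e b p x)) \<longrightarrow>
    (\<forall>b\<in>c - insert a F. \<forall>x\<in>car M p. \<theta> p (e b p x) = e b p x) \<longrightarrow> diag_injective c p \<theta>"
  proof (rule ccontr)
    assume "\<not> ?thesis"
    then have ex: "\<exists>\<theta>. pmodule_hom K M M \<theta> \<and>
      (\<forall>b\<in>insert a F. \<forall>x\<in>car M p. \<theta> p (e b p x) = \<pi> ((s(a := j)) b) p (e b p x)) \<and>
      (\<forall>b\<in>c - insert a F. \<forall>x\<in>car M p. \<theta> p (e b p x) = e b p x) \<and> \<not> diag_injective c p \<theta>"
      if "j \<in> J" for j using that by blast
    \<comment> \<open>The components of \<open>z\<close> in the class \<open>c\<close> agree with those of the image of an element of the other bricks of \<open>c\<close>.\<close>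
    define W where "W z \<longleftrightarrow> (\<exists>y\<in>car M p. (\<forall>b\<in>A - (c - {a}). e b p y = zer M p) \<and>
      (\<forall>b\<in>c. e b p (z \<oplus>\<^bsub>space_at M p\<^esub> \<theta>0 p y) = zer M p))" for z
    have "W (e a p u)"
      using proj_closed[OF a(1) u(1)]
    proof (induction rule: P.decomp_induct)
      case zero
      show ?case unfolding W_def by (rule bexI[of _ "zer M p"]) (use c in auto)
    next
      case (add z z')
      then obtain y y' where y: "y \<in> car M p" "y' \<in> car M p"
        "\<forall>b\<in>A - (c - {a}). e b p y = zer M p" "\<forall>b\<in>A - (c - {a}). e b p y' = zer M p"
        "\<forall>b\<in>c. e b p (z \<oplus>\<^bsub>space_at M p\<^esub> \<theta>0 p y) = zer M p"
        "\<forall>b\<in>c. e b p (z' \<oplus>\<^bsub>space_at M p\<^esub> \<theta>0 p y') = zer M p"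
        unfolding W_def by blast
      have eq: "(z \<oplus>\<^bsub>space_at M p\<^esub> z') \<oplus>\<^bsub>space_at M p\<^esub> \<theta>0 p (y \<oplus>\<^bsub>space_at M p\<^esub> y') =
        (z \<oplus>\<^bsub>space_at M p\<^esub> \<theta>0 p y) \<oplus>\<^bsub>space_at M p\<^esub> (z' \<oplus>\<^bsub>space_at M p\<^esub> \<theta>0 p y')"
        using y(1,2) add by (simp add: \<theta>0.hom_add V.M.add.m_ac)
      show ?case
        unfolding W_def
      proof (rule bexI[of _ "y \<oplus>\<^bsub>space_at M p\<^esub> y'"], intro conjI ballI)
        fix b assume "b \<in> A - (c - {a})"
        then show "e b p (y \<oplus>\<^bsub>space_at M p\<^esub> y') = zer M p" using y by (simp add: proj_add)
      next
        fix b assume b: "b \<in> c"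
        then have bA: "b \<in> A" using c by blast
        have "e b p ((z \<oplus>\<^bsub>space_at M p\<^esub> \<theta>0 p y) \<oplus>\<^bsub>space_at M p\<^esub> (z' \<oplus>\<^bsub>space_at M p\<^esub> \<theta>0 p y')) =
          e b p (z \<oplus>\<^bsub>space_at M p\<^esub> \<theta>0 p y) \<oplus>\<^bsub>space_at M p\<^esub> e b p (z' \<oplus>\<^bsub>space_at M p\<^esub> \<theta>0 p y')"
          by (rule proj_add[OF bA]) (use y add in simp_all)
        also have "\<dots> = zer M p" using y b by (simp only: V.M.r_zero V.M.zero_closed)
        finally show "e b p ((z \<oplus>\<^bsub>space_at M p\<^esub> z') \<oplus>\<^bsub>space_at M p\<^esub> \<theta>0 p (y \<oplus>\<^bsub>space_at M p\<^esub> y')) = zer M p"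
          unfolding eq .
      qed (use y in simp)
    next
      case (proj j)
      obtain \<theta> x where \<theta>: "pmodule_hom K M M \<theta>"
        and \<theta>e: "\<forall>b\<in>insert a F. \<forall>x\<in>car M p. \<theta> p (e b p x) = \<pi> ((s(a := j)) b) p (e b p x)"
          "\<forall>b\<in>c - insert a F. \<forall>x\<in>car M p. \<theta> p (e b p x) = e b p x"
        and x: "x \<in> car M p" and off: "\<forall>b\<in>A - c. e b p x = zer M p"
        and on: "\<forall>b\<in>c. e b p (\<theta> p x) = zer M p" and nz: "x \<noteq> zer M p"
        using ex[OF proj] unfolding diag_injective_def by blast
      interpret \<theta>: pmodule_hom K M M \<theta> by fact
      have agree: "\<theta> p y = \<theta>0 p y"
        if y: "y \<in> car M p" "\<forall>b\<in>A - (c - {a}). e b p y = zer M p" for y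
      proof (rule hom_eqI[OF \<theta> \<theta>0 y(1)])
        fix b assume b: "b \<in> A"
        show "\<theta> p (e b p y) = \<theta>0 p (e b p y)"
        proof (cases "b \<in> c - {a}")
          case True
          then have "b \<noteq> a" "b \<in> c" by auto
          then show ?thesis using \<theta>e \<theta>0e[OF b y(1)] y(1) by (cases "b \<in> F") (auto simp: h_def)
        next
          case False
          then show ?thesis using y b by simp
        qed
      qed
      \<comment> \<open>Within the class, \<open>\<theta>\<close> differs from \<open>\<theta>0\<close> on the brick \<open>a\<close> only; \<open>x'\<close> is the part of \<open>x\<close> in the other bricks.\<close>
      define x' where "x' = x \<ominus>\<^bsub>space_at M p\<^esub> e a p x"
      have x': "x' \<in> car M p" using x a by (simp add: x'_def)
      have x'0: "e b p x' = zer M p" if "b \<in> A - (c - {a})" for b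
      proof -
        have "e b p x' = e b p x \<ominus>\<^bsub>space_at M p\<^esub> e b p (e a p x)"
          unfolding x'_def using that a x by (simp add: proj_minus)
        moreover have "e b p (e a p x) = e b p x"
          using that a x off proj_idem[OF a(1) x] proj_orth[OF _ a(1) _ x, of b]
          by (cases "b = a") auto
        ultimately show ?thesis
          using V.M.r_neg[of "e b p x" p] that x by (simp add: a_minus_def)
      qed
      have xx: "x = e a p x \<oplus>\<^bsub>space_at M p\<^esub> x'"
        unfolding x'_def using x a 
      by (simp add: a_minus_def V.M.add.m_lcomm[of "e a p x" p x] V.M.r_neg)
      have eax: "e a p x \<noteq> zer M p"
      proof
        assume 0: "e a p x = zer M p"
        then have "\<theta> p x = \<theta>0 p x" using agree[OF x] off by auto
        then show False using F0 x off on nz unfolding diag_injective_def by auto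
      qed
      obtain k where k: "k \<in> carrier K" "e a p u = k \<odot>\<^bsub>space_at M p\<^esub> e a p x"
        using thin[OF a(1) x u(1) eax] by blast
      have \<theta>a: "\<theta> p (e a p x) = \<pi> j p (e a p x)" using \<theta>e(1) x by simp
      have "\<pi> j p (e a p u) \<oplus>\<^bsub>space_at M p\<^esub> \<theta>0 p (k \<odot>\<^bsub>space_at M p\<^esub> x')
          = k \<odot>\<^bsub>space_at M p\<^esub> (\<theta> p (e a p x) \<oplus>\<^bsub>space_at M p\<^esub> \<theta> p x')"
        using \<theta>a agree[OF x'] x'0 k x x' a proj by (simp add: P.proj_smult \<theta>0.hom_smult V.smult_r_distr)
      also have "\<theta> p (e a p x) \<oplus>\<^bsub>space_at M p\<^esub> \<theta> p x' = \<theta> p x"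
        using x x' a by (simp flip: \<theta>.hom_add xx)
      finally have eq: "\<pi> j p (e a p u) \<oplus>\<^bsub>space_at M p\<^esub> \<theta>0 p (k \<odot>\<^bsub>space_at M p\<^esub> x')
          = k \<odot>\<^bsub>space_at M p\<^esub> \<theta> p x" .
      show ?case
        unfolding W_def
      proof (rule bexI[of _ "k \<odot>\<^bsub>space_at M p\<^esub> x'"], intro conjI ballI)
        fix b assume b: "b \<in> A - (c - {a})"
        then show "e b p (k \<odot>\<^bsub>space_at M p\<^esub> x') = zer M p"
          using k x' x'0[OF b] by (simp add: proj_smult)
      next
        fix b assume b: "b \<in> c"
        then have "b \<in> A" using c by blast
        then show "e b p (\<pi> j p (e a p u) \<oplus>\<^bsub>space_at M p\<^esub> \<theta>0 p (k \<odot>\<^bsub>space_at M p\<^esub> x')) = zer M p"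
          unfolding eq using k x on b by (simp add: proj_smult)
      qed (use k x' in simp)
    qed
    then obtain y where y: "y \<in> car M p" "\<forall>b\<in>A - (c - {a}). e b p y = zer M p"
      "\<forall>b\<in>c. e b p (e a p u \<oplus>\<^bsub>space_at M p\<^esub> \<theta>0 p y) = zer M p"
      unfolding W_def by blast
    let ?v = "e a p u \<oplus>\<^bsub>space_at M p\<^esub> y"
    have eu: "e a p u \<in> car M p" using a u by simp
    have "\<theta>0 p (e a p u) = e a p u" using \<theta>0e[OF a(1) u(1)] a(3) by (simp add: h_def)
    then have \<theta>v: "\<theta>0 p ?v = e a p u \<oplus>\<^bsub>space_at M p\<^esub> \<theta>0 p y"
      using eu y(1) by (simp add: \<theta>0.hom_add)
    have "e b p ?v = zer M p" if b: "b \<in> A - c" for b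
    proof -
      have "b \<noteq> a" using b a by blast
      then show ?thesis using b y a u proj_orth[of b a] by (simp add: proj_add)
    qed
    then have "?v = zer M p"
      using F0 y(3) \<theta>v V.M.a_closed[OF eu y(1)] unfolding diag_injective_def by auto
    then have "e a p ?v = zer M p" using a by simp
    moreover have "e a p ?v = e a p u"
      using y a u by (simp add: proj_add proj_idem)
    ultimately show False using u(2) by simp
  qed
  then obtain j where "j \<in> J" and j: "\<forall>\<theta>. pmodule_hom K M M \<theta> \<longrightarrow>
    (\<forall>b\<in>insert a F. \<forall>x\<in>car M p. \<theta> p (e b p x) = \<pi> ((s(a := j)) b) p (e b p x)) \<longrightarrow>
    (\<forall>b\<in>c - insert a F. \<forall>x\<in>car M p. \<theta> p (e b p x) = e b p x) \<longrightarrow> diag_injective c p \<theta>"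
    by blast
  then show ?case using sJ by (intro exI[of _ "s(a := j)"]) auto
qed

text \<open>Among the bricks where \<open>x\<close> has a nonzero component, take one that is minimal for \<open>linked p\<close>. By minimality the
  part of \<open>x\<close> outside its class contributes nothing to the components of $\theta(x)$ in that class, so the diagonal
  block of the class kills the part of \<open>x\<close> inside, against its injectivity.\<close>

lemma injective_if_diag_injective:
  assumes \<theta>: "pmodule_hom K M M \<theta>" and F: "\<And>a. a \<in> A \<Longrightarrow> p \<in> supp a \<Longrightarrow> diag_injective (iso_class a) p \<theta>"
    and x: "x \<in> car M p" and 0: "\<theta> p x = zer M p"
  shows "x = zer M p"
proof (rule ccontr)
  interpret \<theta>: pmodule_hom K M M \<theta> by fact
  assume nz: "x \<noteq> zer M p"
  define X where "X = {a \<in> A. e a p x \<noteq> zer M p}"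
  have XA: "X \<subseteq> A" and Xs: "a \<in> X \<Longrightarrow> p \<in> supp a" for a
    using suppI[OF x] by (auto simp: X_def)
  have "finite X" using proj_fin[OF x] by (simp add: X_def)
  moreover have "X \<noteq> {}" using proj_sep[OF x] nz unfolding X_def by blast
  moreover have "asymp_on X (\<lambda>a b. linked p a b \<and> \<not> linked p b a)"
    by (rule asymp_onI) blast
  moreover have "transp_on X (\<lambda>a b. linked p a b \<and> \<not> linked p b a)"
    by (rule transp_onI) (use XA linked_trans in blast)
  ultimately obtain a where aX: "a \<in> X" and "\<forall>b\<in>X. b \<noteq> a \<longrightarrow> \<not> (linked p b a \<and> \<not> linked p a b)"
    using Finite_Set.bex_min_element[of X "\<lambda>a b. linked p a b \<and> \<not> linked p b a"] by blast
  then have min: "linked p a b" if "b \<in> X" "linked p b a" for b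
    using that by (cases "b = a") blast+
  have a: "a \<in> A" "p \<in> supp a" using aX XA Xs by auto
  define c where "c = iso_class a"
  have cA: "c \<subseteq> A" and ac: "a \<in> c" using iso_class_sub similar_refl[OF a(1)] a(1) by (auto simp: c_def iso_class_def)
  \<comment> \<open>\<open>E\<close> is the projection to the sum of all bricks in the class \<open>c\<close>.\<close>
  obtain E where E: "pmodule_hom K M M E"
    and Ee: "\<And>b p x. b \<in> A \<Longrightarrow> x \<in> car M p \<Longrightarrow>
      E p (e b p x) = (if b \<in> c then (\<lambda>p x. x) else (\<lambda>p x. zer M p)) p (e b p x)"
  proof -
    have "pmodule_hom K M M (if b \<in> c then (\<lambda>p x. x) else (\<lambda>p x. zer M p))" for b
      using pmodule_hom_id[OF pmodule_axioms]
      by (auto intro!: pmodule_homI pmodule_axioms)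
    then show ?thesis using assemble_endo[of "\<lambda>b. if b \<in> c then (\<lambda>p x. x) else (\<lambda>p x. zer M p)"] that by blast
  qed
  interpret E: pmodule_hom K M M E by fact
  have eE: "e d p (E p x) = (if d \<in> c then e d p x else zer M p)" if d: "d \<in> A" for d
  proof -
    have "e d p (E p x) = (if d \<in> c then e d else (\<lambda>p x. zer M p)) p x"
    proof (rule hom_eqI[OF pmodule_hom_comp[OF E proj_hom[OF d]] _ x])
      show "pmodule_hom K M M (if d \<in> c then e d else (\<lambda>p x. zer M p))"
        using proj_hom[OF d] by (auto intro!: pmodule_homI pmodule_axioms)
      show "e d p (E p (e b p x)) = (if d \<in> c then e d else (\<lambda>p x. zer M p)) p (e b p x)"
        if "b \<in> A" for b
        using Ee[OF that x] d that x proj_orth[OF d that _ x] by (cases "b = d") auto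
    qed
    then show ?thesis by auto
  qed
  have "e d p (\<theta> p (E p x)) = e d p (\<theta> p x)" if d: "d \<in> c" for d
  proof (rule hom_eqI[OF pmodule_hom_comp[OF pmodule_hom_comp[OF E \<theta>] proj_hom]
        pmodule_hom_comp[OF \<theta> proj_hom] x])
    show dA: "d \<in> A" "d \<in> A" using d cA by auto
    fix b assume b: "b \<in> A"
    show "e d p (\<theta> p (E p (e b p x))) = e d p (\<theta> p (e b p x))"
    proof (cases "b \<in> c")
      case True
      then show ?thesis using Ee[OF b x] by simp
    next
      case False
      have "e d p (\<theta> p (e b p x)) = zer M p"
      proof (rule ccontr)
        assume nz: "e d p (\<theta> p (e b p x)) \<noteq> zer M p"
        have bd: "linked p b d" by (rule linkedI[OF \<theta> x nz])
        have ad: "linked p d a"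
          using similar_linked(2)[OF a(1) dA(1) _ a(2)] d by (simp add: c_def iso_class_def)
        have ba: "linked p b a" by (rule linked_trans[OF b dA(1) a(1) bd ad])
        moreover have "b \<in> X" using nz \<theta>.hom_zero dA b by (auto simp: X_def)
        ultimately have "b \<in> c" using min b unfolding c_def iso_class_def similar_def by blast
        then show False using False by simp
      qed
      then show ?thesis using False Ee[OF b x] dA by simp
    qed
  qed
  then have "e d p (\<theta> p (E p x)) = zer M p" if "d \<in> c" for d using that 0 cA by auto
  moreover have "e d p (E p x) = zer M p" if "d \<in> A - c" for d using that eE by simp
  ultimately have "E p x = zer M p"
    using F[OF a] x unfolding diag_injective_def c_def by simp
  then have "e a p x = zer M p" using eE[OF a(1)] ac a(1) by simp
  then show False using aX by (simp add: X_def)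
qed

text \<open>The summands are selected at one point for each isomorphism class; connectedness spreads the injectivity of the
  diagonal block over the support. Bijectivity follows from injectivity since the spaces are
  finite-dimensional.\<close>

theorem exchange:
  assumes J: "decomp K M J \<pi>"
  obtains \<theta> j where "pmodule_hom K M M \<theta>" "\<And>p. bij_betw (\<theta> p) (car M p) (car M p)"
    "\<And>a. a \<in> A \<Longrightarrow> j a \<in> J"
    "\<And>a p x. a \<in> A \<Longrightarrow> x \<in> car M p \<Longrightarrow> \<theta> p (e a p x) = \<pi> (j a) p (e a p x)"
proof -
  interpret P: decomp K M J \<pi> by fact
  have "\<exists>s. (\<forall>b\<in>iso_class a. s b \<in> J) \<and> (\<forall>\<theta>. pmodule_hom K M M \<theta> \<longrightarrow>
    (\<forall>b\<in>iso_class a. \<forall>p. \<forall>x\<in>car M p. \<theta> p (e b p x) = \<pi> (s b) p (e b p x)) \<longrightarrow>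
    (\<forall>p\<in>supp a. diag_injective (iso_class a) p \<theta>))" if a: "a \<in> A" for a
  proof -
    obtain p where p: "p \<in> supp a" using supp_nonempty[OF a] by blast
    have sup: "p \<in> supp b" if "b \<in> iso_class a" for b
      using that similar_supp[OF a _ _ p] by (auto simp: iso_class_def)
    have "iso_class a \<subseteq> {b \<in> A. \<exists>x\<in>car M p. e b p x \<noteq> zer M p}"
      using sup iso_class_sub unfolding supp_def by blast
    then have fin: "finite (iso_class a)" using support_finite finite_subset by blast
    from select_summands[OF J iso_class_sub sup fin subset_refl]
    obtain s where s: "\<forall>b\<in>iso_class a. s b \<in> J" "\<And>\<theta>. pmodule_hom K M M \<theta> \<Longrightarrow>
      \<forall>b\<in>iso_class a. \<forall>x\<in>car M p. \<theta> p (e b p x) = \<pi> (s b) p (e b p x) \<Longrightarrow>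
      diag_injective (iso_class a) p \<theta>"
      unfolding Diff_cancel ball_empty by blast
    show ?thesis
      using s diag_injective_conn[OF a connected[OF a p]] by (intro exI[of _ s]) blast
  qed
  then obtain t where t: "\<And>a. a \<in> A \<Longrightarrow> (\<forall>b\<in>iso_class a. t a b \<in> J) \<and> (\<forall>\<theta>. pmodule_hom K M M \<theta> \<longrightarrow>
    (\<forall>b\<in>iso_class a. \<forall>p. \<forall>x\<in>car M p. \<theta> p (e b p x) = \<pi> (t a b) p (e b p x)) \<longrightarrow>
    (\<forall>p\<in>supp a. diag_injective (iso_class a) p \<theta>))"
    by metis
  \<comment> \<open>The choice must depend on the class only, not on the brick that represents it.\<close>
  define s where "s c = t (SOME a. a \<in> A \<and> iso_class a = c)" for c
  have rep: "\<exists>a'\<in>A. iso_class a' = iso_class a \<and> s (iso_class a) = t a' \<and> supp a' = supp a" if "a \<in> A" for a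
  proof -
    let ?a = "SOME a'. a' \<in> A \<and> iso_class a' = iso_class a"
    have r: "?a \<in> A \<and> iso_class ?a = iso_class a" by (rule someI[of _ a]) (use that in simp)
    then have "a \<in> iso_class ?a" "?a \<in> iso_class a" using that similar_refl by (auto simp: iso_class_def)
    then have "supp ?a = supp a" using r that similar_supp unfolding iso_class_def by blast
    then show ?thesis using r by (auto simp: s_def)
  qed
  have sJ: "\<And>a b. a \<in> A \<Longrightarrow> b \<in> iso_class a \<Longrightarrow> s (iso_class a) b \<in> J"
    and s: "\<And>a \<theta> p. a \<in> A \<Longrightarrow> pmodule_hom K M M \<theta> \<Longrightarrow>
      \<forall>b\<in>iso_class a. \<forall>p. \<forall>x\<in>car M p. \<theta> p (e b p x) = \<pi> (s (iso_class a) b) p (e b p x) \<Longrightarrow>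
      p \<in> supp a \<Longrightarrow> diag_injective (iso_class a) p \<theta>"
    using rep t by metis+
  define j where "j a = s (iso_class a) a" for a
  have jJ: "j a \<in> J" if "a \<in> A" for a
    unfolding j_def using sJ that similar_refl by (auto simp: iso_class_def)
  obtain \<theta> where \<theta>: "pmodule_hom K M M \<theta>"
    and \<theta>e: "\<And>a p x. a \<in> A \<Longrightarrow> x \<in> car M p \<Longrightarrow> \<theta> p (e a p x) = \<pi> (j a) p (e a p x)"
    using assemble_endo[of "\<lambda>a. \<pi> (j a)"] P.proj_hom jJ by blast
  interpret \<theta>: pmodule_hom K M M \<theta> by fact
  have "\<theta> p (e b p x) = \<pi> (s (iso_class a) b) p (e b p x)"
    if "a \<in> A" "b \<in> iso_class a" "x \<in> car M p" for a b p x
    using \<theta>e[of b x p] that iso_class_eq[OF that(1,2)] iso_class_sub by (auto simp: j_def)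
  then have "x = zer M p" if "x \<in> car M p" "\<theta> p x = zer M p" for p x
    using injective_if_diag_injective[OF \<theta> s[OF _ \<theta>] that] by blast
  then have inj: "inj_on (\<theta> p) (car M p)" for p by (rule \<theta>.hom_inj)
  have "\<theta> p ` car M p = car M p" for p
    by (rule injective_endo_surjective[OF \<theta>.component finite_dimensional inj])
  then have "bij_betw (\<theta> p) (car M p) (car M p)" for p
    using inj by (simp add: bij_betw_def)
  then show ?thesis using that \<theta> jJ \<theta>e by blast
qed

end

section \<open>Subquotients\<close>

lemma restrict_pmodule_simps [simp]:
  "space_at (restrict_pmodule M U) p = (space_at M p)\<lparr>carrier := U p\<rparr>"
  "map_at (restrict_pmodule M U) = map_at M"
  by (simp_all add: restrict_pmodule_def)

lemma restrict_pmodule: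
  fixes M :: "('p::order, 'k, 'v) pmod"
  assumes "pmodule K M" "subpmodule K U M"
  shows "pmodule K (restrict_pmodule M U)"
proof -
  interpret pmodule K M by fact
  note U = assms(2)[unfolded subpmodule_iff[OF assms(1)]]
  have vs: "vectorspace K ((space_at M p)\<lparr>carrier := U p\<rparr>)" for p
    using V.subspace_is_vs assms(2) unfolding subpmodule_def by blast
  show ?thesis
  proof (rule pmodule.intro)
    show "vectorspace K (space_at (restrict_pmodule M U) p)" for p using vs by simp
    fix p q :: 'p assume le: "p \<le> q"
    have sub: "x \<in> U p \<Longrightarrow> x \<in> car M p" for x using U by blast
    show "linear_map K (space_at (restrict_pmodule M U) p) (space_at (restrict_pmodule M U) q)
        (map_at (restrict_pmodule M U) p q)"
      using U le vs by (simp add: linear_map_iff map_add map_smult sub)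
  next
    fix p x assume "x \<in> car (restrict_pmodule M U) p"
    then have "x \<in> car M p" using U by auto
    then show "map_at (restrict_pmodule M U) p p x = x" by (simp add: map_id)
  next
    fix p q r :: 'p and x assume le: "p \<le> q" "q \<le> r" and "x \<in> car (restrict_pmodule M U) p"
    then have "x \<in> car M p" using U by auto
    then show "map_at (restrict_pmodule M U) p r x =
        map_at (restrict_pmodule M U) q r (map_at (restrict_pmodule M U) p q x)"
      unfolding restrict_pmodule_simps by (rule map_comp[OF le])
  qed
qed

lemma pmodule_image:
  fixes M :: "('p::order, 'k, 'v) pmod"
  assumes "pmodule K M"
    and surj: "\<And>p. f p ` car M p = car R p"
    and add: "\<And>p x y. x \<in> car M p \<Longrightarrow> y \<in> car M p \<Longrightarrow>
      f p (x \<oplus>\<^bsub>space_at M p\<^esub> y) = f p x \<oplus>\<^bsub>space_at R p\<^esub> f p y"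
    and smult: "\<And>p k x. k \<in> carrier K \<Longrightarrow> x \<in> car M p \<Longrightarrow>
      f p (k \<odot>\<^bsub>space_at M p\<^esub> x) = k \<odot>\<^bsub>space_at R p\<^esub> f p x"
    and zero: "\<And>p. f p (zer M p) = zer R p"
    and nat: "\<And>p q x. p \<le> q \<Longrightarrow> x \<in> car M p \<Longrightarrow> f q (map_at M p q x) = map_at R p q (f p x)"
  shows "pmodule K R" "pmodule_hom K M R f"
proof -
  interpret pmodule K M by fact
  have ex: "\<exists>x\<in>car M p. y = f p x" if "y \<in> car R p" for y p
    using surj[of p] that by auto
  have cl: "f p x \<in> car R p" if "x \<in> car M p" for x p
    using surj[of p] that by auto
  have vs: "vectorspace K (space_at R p)" for p
    by (rule vectorspace_image[OF space[of p], of "f p"]) (use surj add smult zero in auto)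
  show R: "pmodule K R"
  proof (rule pmodule.intro)
    show "vectorspace K (space_at R p)" for p by (rule vs)
    fix p q :: 'p assume le: "p \<le> q"
    show "linear_map K (space_at R p) (space_at R q) (map_at R p q)"
      unfolding linear_map_iff
    proof (intro conjI ballI vs)
      fix y assume "y \<in> car R p"
      then obtain x where x: "x \<in> car M p" "y = f p x" using ex by blast
      then show "map_at R p q y \<in> car R q" using cl[of "map_at M p q x" q] le by (simp add: nat)
    next
      fix y z assume "y \<in> car R p" "z \<in> car R p"
      then obtain x w where "x \<in> car M p" "y = f p x" "w \<in> car M p" "z = f p w" using ex by meson
      then show "map_at R p q (y \<oplus>\<^bsub>space_at R p\<^esub> z) =
          map_at R p q y \<oplus>\<^bsub>space_at R q\<^esub> map_at R p q z"
        using le by (simp add: map_add add flip: add nat)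
    next
      fix k y assume k: "k \<in> carrier K" and "y \<in> car R p"
      then obtain x where "x \<in> car M p" "y = f p x" using ex by meson
      then show "map_at R p q (k \<odot>\<^bsub>space_at R p\<^esub> y) = k \<odot>\<^bsub>space_at R q\<^esub> map_at R p q y"
        using le k by (simp flip: smult nat) (simp add: smult map_smult)
    qed
  next
    fix p y assume "y \<in> car R p"
    then obtain x where x: "x \<in> car M p" "y = f p x" using ex by blast
    show "map_at R p p y = y" using nat[OF order_refl x(1)] x by (simp add: map_id)
  next
    fix p q r :: 'p and y assume le: "p \<le> q" "q \<le> r" and "y \<in> car R p"
    then obtain x where x: "x \<in> car M p" "y = f p x" using ex by blast
    have "map_at R p r y = f r (map_at M q r (map_at M p q x))"
      using x nat[OF order_trans[OF le] x(1)] map_comp[OF le x(1)] by simp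
    also have "\<dots> = map_at R q r (map_at R p q y)"
      using x le by (simp add: nat)
    finally show "map_at R p r y = map_at R q r (map_at R p q y)" .
  qed
  show "pmodule_hom K M R f"
    by (rule pmodule_homI[OF pmodule_axioms R]) (use cl add smult nat in auto)
qed

text \<open>The map \<open>f\<close> induces an isomorphism from \<open>U/V\<close> to \<open>R\<close>.\<close>

locale subquotient = M: pmodule K M + R: pmodule K R
  for K :: "('k, 'm) ring_scheme"
    and M :: "('p::order, 'k, 'v) pmod" and U V :: "'p \<Rightarrow> 'v set"
    and R :: "('p, 'k, 'w) pmod" and f :: "'p \<Rightarrow> 'v \<Rightarrow> 'w" +
  assumes subU: "subpmodule K U M" and subV: "subpmodule K V M" and VU: "V p \<subseteq> U p"
    and f_add: "x \<in> U p \<Longrightarrow> y \<in> U p \<Longrightarrow>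
      f p (x \<oplus>\<^bsub>space_at M p\<^esub> y) = f p x \<oplus>\<^bsub>space_at R p\<^esub> f p y"
    and f_smult: "k \<in> carrier K \<Longrightarrow> x \<in> U p \<Longrightarrow>
      f p (k \<odot>\<^bsub>space_at M p\<^esub> x) = k \<odot>\<^bsub>space_at R p\<^esub> f p x"
    and f_natural: "p \<le> q \<Longrightarrow> x \<in> U p \<Longrightarrow> f q (map_at M p q x) = map_at R p q (f p x)"
    and f_surj: "f p ` U p = car R p"
    and f_ker: "x \<in> U p \<Longrightarrow> f p x = zer R p \<longleftrightarrow> x \<in> V p"

context subquotient
begin

lemmas U_rules = subU[unfolded subpmodule_iff[OF M.pmodule_axioms]]
lemmas V_rules = subV[unfolded subpmodule_iff[OF M.pmodule_axioms]]

lemma U_car: "x \<in> U p \<Longrightarrow> x \<in> car M p" using U_rules by blast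
lemma U_add: "x \<in> U p \<Longrightarrow> y \<in> U p \<Longrightarrow> x \<oplus>\<^bsub>space_at M p\<^esub> y \<in> U p" using U_rules by blast
lemma U_smult: "k \<in> carrier K \<Longrightarrow> x \<in> U p \<Longrightarrow> k \<odot>\<^bsub>space_at M p\<^esub> x \<in> U p" using U_rules by blast
lemma U_zero: "zer M p \<in> U p" using U_rules by blast
lemma U_map: "p \<le> q \<Longrightarrow> x \<in> U p \<Longrightarrow> map_at M p q x \<in> U q" using U_rules by blast
lemma V_zero: "zer M p \<in> V p" using V_rules by blast

lemma f_closed: "x \<in> U p \<Longrightarrow> f p x \<in> car R p" using f_surj by blast

lemma f_zero: "f p (zer M p) = zer R p" using f_ker[OF U_zero] V_zero by blast

lemma f_ex: "y \<in> car R p \<Longrightarrow> \<exists>x\<in>U p. f p x = y" using f_surj[of p] by (metis imageE)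

lemma U_minus: "x \<in> U p \<Longrightarrow> y \<in> U p \<Longrightarrow> x \<ominus>\<^bsub>space_at M p\<^esub> y \<in> U p"
  using U_add U_smult[of "\<ominus>\<^bsub>K\<^esub> \<one>\<^bsub>K\<^esub>" y p] U_car[of y p]
  by (simp add: a_minus_def M.V.smult_minus_1)

lemma f_minus:
  assumes "x \<in> U p" "y \<in> U p"
  shows "f p (x \<ominus>\<^bsub>space_at M p\<^esub> y) = f p x \<ominus>\<^bsub>space_at R p\<^esub> f p y"
proof -
  have "x \<ominus>\<^bsub>space_at M p\<^esub> y = x \<oplus>\<^bsub>space_at M p\<^esub> (\<ominus>\<^bsub>K\<^esub> \<one>\<^bsub>K\<^esub>) \<odot>\<^bsub>space_at M p\<^esub> y"
    using assms U_car by (simp add: a_minus_def M.V.smult_minus_1)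
  then show ?thesis
    using assms U_smult f_closed by (simp add: f_add f_smult a_minus_def R.V.smult_minus_1)
qed

lemma f_eq_iff:
  assumes "x \<in> U p" "y \<in> U p"
  shows "f p x = f p y \<longleftrightarrow> x \<ominus>\<^bsub>space_at M p\<^esub> y \<in> V p"
proof -
  have "f p x = f p y \<longleftrightarrow> f p x \<ominus>\<^bsub>space_at R p\<^esub> f p y = zer R p"
    using f_closed assms by (simp add: R.V.M.minus_other_side)
  also have "\<dots> \<longleftrightarrow> x \<ominus>\<^bsub>space_at M p\<^esub> y \<in> V p"
    using f_ker[OF U_minus[OF assms]] assms by (simp add: f_minus)
  finally show ?thesis .
qed

lemma compose_iso:
  assumes "pmodule_hom K R R' g" and bij: "\<And>p. bij_betw (g p) (car R p) (car R' p)"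
  shows "subquotient K M U V R' (\<lambda>p x. g p (f p x))"
proof -
  interpret g: pmodule_hom K R R' g by fact
  show ?thesis
  proof (intro subquotient.intro subquotient_axioms.intro subU subV VU M.pmodule_axioms
      g.N.pmodule_axioms)
    show "(\<lambda>x. g p (f p x)) ` U p = car R' p" for p
      using bij[of p] by (simp add: bij_betw_def flip: f_surj image_image)
    show "g p (f p x) = zer R' p \<longleftrightarrow> x \<in> V p" if "x \<in> U p" for p x
    proof -
      have "g p (f p x) = zer R' p \<longleftrightarrow> f p x = zer R p"
        using inj_on_eq_iff[OF bij_betw_imp_inj_on[OF bij] f_closed[OF that] R.V.M.zero_closed] by simp
      then show ?thesis using f_ker[OF that] by simp
    qed
  qed (simp_all add: f_add f_smult f_natural f_closed g.hom_add g.hom_smult g.natural)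
qed

lemma quotient_unique:
  assumes "subquotient K M U V R' f'"
  shows "pmodule_iso K R R'"
proof -
  interpret S: subquotient K M U V R' f' by fact
  define g where "g p y = f' p (SOME x. x \<in> U p \<and> f p x = y)" for p y
  have gf: "g p (f p x) = f' p x" if x: "x \<in> U p" for p x
  proof -
    let ?x = "SOME z. z \<in> U p \<and> f p z = f p x"
    have z: "?x \<in> U p \<and> f p ?x = f p x" by (rule someI[of _ x]) (use x in simp)
    then show ?thesis unfolding g_def using f_eq_iff S.f_eq_iff x by metis
  qed
  have "pmodule_hom K R R' g"
  proof (rule pmodule_homI[OF R.pmodule_axioms S.R.pmodule_axioms])
    fix p y assume "y \<in> car R p"
    then show "g p y \<in> car R' p" using f_ex gf S.f_closed by metis
  next
    fix p y z assume "y \<in> car R p" "z \<in> car R p"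
    then obtain x w where "x \<in> U p" "w \<in> U p" "f p x = y" "f p w = z" using f_ex by meson
    then show "g p (y \<oplus>\<^bsub>space_at R p\<^esub> z) = g p y \<oplus>\<^bsub>space_at R' p\<^esub> g p z"
      using gf[of x p] gf[of w p] gf[OF U_add[of x p w]] by (simp add: f_add S.f_add)
  next
    fix p k y assume "k \<in> carrier K" "y \<in> car R p"
    moreover then obtain x where "x \<in> U p" "f p x = y" using f_ex by meson
    ultimately show "g p (k \<odot>\<^bsub>space_at R p\<^esub> y) = k \<odot>\<^bsub>space_at R' p\<^esub> g p y"
      using gf[of x p] gf[OF U_smult[of k x p]] by (simp add: f_smult S.f_smult)
  next
    fix p q y assume "p \<le> q" "y \<in> car R p"
    moreover then obtain x where "x \<in> U p" "f p x = y" using f_ex by meson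
    ultimately show "g q (map_at R p q y) = map_at R' p q (g p y)"
      using gf[of x p] gf[OF U_map[of p q x]] by (simp add: f_natural S.f_natural)
  qed
  moreover have "bij_betw (g p) (car R p) (car R' p)" for p
    unfolding bij_betw_def
  proof
    show "inj_on (g p) (car R p)"
    proof (rule inj_onI)
      fix y z assume "y \<in> car R p" "z \<in> car R p" "g p y = g p z"
      moreover then obtain x w where "x \<in> U p" "w \<in> U p" "f p x = y" "f p w = z" using f_ex by meson
      ultimately show "y = z" using gf f_eq_iff S.f_eq_iff by metis
    qed
    have "g p ` car R p = (\<lambda>x. g p (f p x)) ` U p" by (simp add: image_image flip: f_surj)
    also have "\<dots> = f' p ` U p" using gf by simp
    finally show "g p ` car R p = car R' p" by (simp add: S.f_surj)
  qed
  ultimately show ?thesis unfolding pmodule_iso_def by blast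
qed

text \<open>A section of \<open>f\<close> embeds \<open>R\<close> into the element type of \<open>M\<close>, and the structure is moved along it. This
  keeps iterated subquotients within the element type in which common refinements are sought.\<close>

lemma transport_to_ambient_type:
  obtains R' :: "('p, 'k, 'v) pmod" and f' where "subquotient K M U V R' f'"
proof -
  define s where "s p = inv_into (U p) (f p)" for p
  have fs: "f p (s p y) = y" if "y \<in> car R p" for p y
    unfolding s_def using f_surj that by (metis f_inv_into_f)
  define R' :: "('p, 'k, 'v) pmod" where "R' =
    \<lparr>space_at = (\<lambda>p. \<lparr>carrier = s p ` car R p, mult = (\<lambda>_ _. s p (zer R p)), one = s p (zer R p),
        zero = s p (zer R p), add = (\<lambda>x y. s p (f p x \<oplus>\<^bsub>space_at R p\<^esub> f p y)),
        smult = (\<lambda>k x. s p (k \<odot>\<^bsub>space_at R p\<^esub> f p x))\<rparr>),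
     map_at = (\<lambda>p q x. s q (map_at R p q (f p x)))\<rparr>"
  have "pmodule_hom K R R' s"
    by (rule pmodule_image(2)[OF R.pmodule_axioms]) (simp_all add: R'_def fs)
  moreover have "bij_betw (s p) (car R p) (car R' p)" for p
    unfolding bij_betw_def using fs by (auto simp: R'_def intro: inj_on_inverseI)
  ultimately show ?thesis using that compose_iso by blast
qed

end

lemma subquotient_quot:
  assumes M: "pmodule K M" and U: "subpmodule K U M" and V: "subpmodule K V M" and VU: "\<And>p. V p \<subseteq> U p"
  shows "subquotient K M U V (quot_pmodule (restrict_pmodule M U) V) (\<lambda>p x. V p +>\<^bsub>space_at M p\<^esub> x)"
proof -
  interpret pmodule K M by fact
  let ?Q = "quot_pmodule (restrict_pmodule M U) V"
  note U' = U[unfolded subpmodule_iff[OF M]] and V' = V[unfolded subpmodule_iff[OF M]]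
  have coset: "V p +>\<^bsub>(space_at M p)\<lparr>carrier := X\<rparr>\<^esub> x = V p +>\<^bsub>space_at M p\<^esub> x" for p x X
    by (simp add: a_r_coset_def')
  have Vsp: "subspace K (V p) (space_at M p)" for p using V by (simp add: subpmodule_def)
  note ceq = coset_eq[OF space Vsp]
  have mem: "y \<in> V p +>\<^bsub>space_at M p\<^esub> x \<longleftrightarrow> (\<exists>v\<in>V p. y = v \<oplus>\<^bsub>space_at M p\<^esub> x)" for p x y
    by (auto simp: a_r_coset_def')
  have self: "x \<in> V p +>\<^bsub>space_at M p\<^esub> x" if "x \<in> car M p" for p x
    unfolding mem by (rule bexI[of _ "zer M p"]) (use that V' in auto)
  have sub: "x \<in> car M p" if "x \<in> U p" for x p using that U' by blast
  have subV: "x \<in> car M p" if "x \<in> V p" for x p using that V' by blast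
  have surj: "(\<lambda>x. V p +>\<^bsub>space_at M p\<^esub> x) ` car (restrict_pmodule M U) p = car ?Q p" for p
    by (auto simp: quot_pmodule_def quot_space_def A_RCOSETS_def' coset)
  have add: "V p +>\<^bsub>space_at M p\<^esub> (x \<oplus>\<^bsub>space_at M p\<^esub> y) =
      (V p +>\<^bsub>space_at M p\<^esub> x) \<oplus>\<^bsub>space_at ?Q p\<^esub> (V p +>\<^bsub>space_at M p\<^esub> y)"
    if xy: "x \<in> U p" "y \<in> U p" for p x y
  proof (rule Set.set_eqI)
    fix z
    have "z \<in> (V p +>\<^bsub>space_at M p\<^esub> x) \<oplus>\<^bsub>space_at ?Q p\<^esub> (V p +>\<^bsub>space_at M p\<^esub> y) \<longleftrightarrow>
      (\<exists>v\<in>V p. \<exists>w\<in>V p. z = (v \<oplus>\<^bsub>space_at M p\<^esub> x) \<oplus>\<^bsub>space_at M p\<^esub> (w \<oplus>\<^bsub>space_at M p\<^esub> y))"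
      by (simp add: quot_pmodule_def quot_space_def set_add_def' a_r_coset_def')
    also have "\<dots> \<longleftrightarrow> (\<exists>v\<in>V p. \<exists>w\<in>V p. z = (v \<oplus>\<^bsub>space_at M p\<^esub> w) \<oplus>\<^bsub>space_at M p\<^esub> (x \<oplus>\<^bsub>space_at M p\<^esub> y))"
      by (intro bex_cong refl) (use sub[OF xy(1)] sub[OF xy(2)] subV in \<open>simp add: V.M.add.m_ac\<close>)
    also have "\<dots> \<longleftrightarrow> z \<in> V p +>\<^bsub>space_at M p\<^esub> (x \<oplus>\<^bsub>space_at M p\<^esub> y)"
      unfolding mem
    proof
      assume "\<exists>v\<in>V p. z = v \<oplus>\<^bsub>space_at M p\<^esub> (x \<oplus>\<^bsub>space_at M p\<^esub> y)"
      then obtain v where "v \<in> V p" "z = v \<oplus>\<^bsub>space_at M p\<^esub> (x \<oplus>\<^bsub>space_at M p\<^esub> y)" by blast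
      then show "\<exists>v\<in>V p. \<exists>w\<in>V p. z = v \<oplus>\<^bsub>space_at M p\<^esub> w \<oplus>\<^bsub>space_at M p\<^esub> (x \<oplus>\<^bsub>space_at M p\<^esub> y)"
        using V' subV by (intro bexI[of _ v] bexI[of _ "zer M p"]) auto
    qed (use V' in blast)
    finally show "z \<in> V p +>\<^bsub>space_at M p\<^esub> (x \<oplus>\<^bsub>space_at M p\<^esub> y) \<longleftrightarrow>
      z \<in> (V p +>\<^bsub>space_at M p\<^esub> x) \<oplus>\<^bsub>space_at ?Q p\<^esub> (V p +>\<^bsub>space_at M p\<^esub> y)" by simp
  qed
  have smult: "V p +>\<^bsub>space_at M p\<^esub> (k \<odot>\<^bsub>space_at M p\<^esub> x) =
      k \<odot>\<^bsub>space_at ?Q p\<^esub> (V p +>\<^bsub>space_at M p\<^esub> x)" if k: "k \<in> carrier K" and x: "x \<in> U p" for p k x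
  proof -
    have "V p +>\<^bsub>space_at M p\<^esub> (k \<odot>\<^bsub>space_at M p\<^esub> y) = V p +>\<^bsub>space_at M p\<^esub> (k \<odot>\<^bsub>space_at M p\<^esub> x)"
      if y: "y \<in> V p +>\<^bsub>space_at M p\<^esub> x" for y
    proof -
      obtain v where v: "v \<in> V p" "y = v \<oplus>\<^bsub>space_at M p\<^esub> x" using y[unfolded mem] by blast
      then have "k \<odot>\<^bsub>space_at M p\<^esub> y = k \<odot>\<^bsub>space_at M p\<^esub> v \<oplus>\<^bsub>space_at M p\<^esub> k \<odot>\<^bsub>space_at M p\<^esub> x"
        using k sub[OF x] subV by (simp add: V.smult_r_distr)
      then show ?thesis using ceq k v V' sub[OF x] by simp
    qed
    then have "(\<Union>y\<in>V p +>\<^bsub>space_at M p\<^esub> x. V p +>\<^bsub>space_at M p\<^esub> (k \<odot>\<^bsub>space_at M p\<^esub> y)) =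
        V p +>\<^bsub>space_at M p\<^esub> (k \<odot>\<^bsub>space_at M p\<^esub> x)"
      using self[OF sub[OF x]] by blast
    then show ?thesis by (simp add: quot_pmodule_def quot_space_def coset)
  qed
  have nat: "V q +>\<^bsub>space_at M q\<^esub> (map_at M p q x) = map_at ?Q p q (V p +>\<^bsub>space_at M p\<^esub> x)"
    if le: "p \<le> q" and x: "x \<in> U p" for p q x
  proof -
    have "V q +>\<^bsub>space_at M q\<^esub> (map_at M p q y) = V q +>\<^bsub>space_at M q\<^esub> (map_at M p q x)"
      if y: "y \<in> V p +>\<^bsub>space_at M p\<^esub> x" for y
    proof -
      obtain v where v: "v \<in> V p" "y = v \<oplus>\<^bsub>space_at M p\<^esub> x" using y[unfolded mem] by blast
      then have "map_at M p q y = map_at M p q v \<oplus>\<^bsub>space_at M q\<^esub> map_at M p q x"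
        using le sub[OF x] subV by (simp add: map_add)
      then show ?thesis using ceq le v V' sub[OF x] by simp
    qed
    then have "(\<Union>y\<in>V p +>\<^bsub>space_at M p\<^esub> x. V q +>\<^bsub>space_at M q\<^esub> (map_at M p q y)) =
        V q +>\<^bsub>space_at M q\<^esub> (map_at M p q x)"
      using self[OF sub[OF x]] by blast
    then show ?thesis by (simp add: quot_pmodule_def coset)
  qed
  have zero: "V p +>\<^bsub>space_at M p\<^esub> zer M p = zer ?Q p" for p
  proof -
    have "V p +>\<^bsub>space_at M p\<^esub> zer M p = V p" using subV by (force simp: mem)
    then show ?thesis by (simp add: quot_pmodule_def quot_space_def)
  qed
  have "pmodule K ?Q"
    by (rule pmodule_image(1)[OF restrict_pmodule[OF M U] surj])
      (use add smult nat zero in \<open>simp_all\<close>)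
  then show ?thesis
  proof (intro subquotient.intro subquotient_axioms.intro M U V VU)
    show "(+>\<^bsub>space_at M p\<^esub>) (V p) ` U p = car ?Q p" for p using surj[of p] by simp
    fix x p assume x: "x \<in> U p"
    have "V p +>\<^bsub>space_at M p\<^esub> zer M p = V p" using subV by (force simp: mem)
    then show "V p +>\<^bsub>space_at M p\<^esub> x = zer ?Q p \<longleftrightarrow> x \<in> V p"
      using self[OF sub[OF x]] ceq[of "zer M p" p x] sub[OF x] zero by auto
  qed (use add smult nat in simp_all)
qed

section \<open>Refinements as homogeneous subquotients\<close>

text \<open>The condition under which \<open>U/V\<close> belongs to the neighborhood $\mathrm{EN}_\epsilon(M)$.\<close>

abbreviation nbhd :: "(real \<Rightarrow> 'p \<Rightarrow> 'p) \<Rightarrow> real \<Rightarrow> ('p::order, 'k, 'v) pmod \<Rightarrow>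
    ('p \<Rightarrow> 'v set) \<Rightarrow> ('p \<Rightarrow> 'v set) \<Rightarrow> bool" where
  "nbhd P \<epsilon> M U V \<equiv> \<forall>p. Im_shift P \<epsilon> M p \<subseteq> U p \<and> V p \<subseteq> Ker_shift P \<epsilon> M p"

context poset_flow
begin

lemma flow_le: "0 \<le> \<epsilon> \<Longrightarrow> P (- \<epsilon>) p \<le> p"
  using flow_ge[of \<epsilon> "P (- \<epsilon>) p"] flow_add[of \<epsilon> "- \<epsilon>"] flow_zero by (simp add: fun_eq_iff)

lemma Im_shift_eq: "Im_shift P \<epsilon> M p = map_at M (P (- \<epsilon>) p) p ` car M (P (- \<epsilon>) p)"
  by (simp add: Im_shift_def shift_hom_def shift_def flow_zero)

lemma Ker_shift_eq:
  "Ker_shift P \<epsilon> M p = {x \<in> car M p. map_at M p (P \<epsilon> p) x = zer M (P \<epsilon> p)}"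
  by (simp add: Ker_shift_def shift_hom_def shift_def flow_zero)

lemma nbhd_iff:
  "nbhd P \<epsilon> M U V \<longleftrightarrow> (\<forall>p. \<forall>z\<in>car M (P (- \<epsilon>) p). map_at M (P (- \<epsilon>) p) p z \<in> U p) \<and>
    (\<forall>p. \<forall>x\<in>V p. x \<in> car M p \<and> map_at M p (P \<epsilon> p) x = zer M (P \<epsilon> p))"
  by (auto simp: Im_shift_eq Ker_shift_eq)

lemma EN_iff:
  assumes "pmodule K M"
  shows "N \<in> EN K P \<epsilon> M \<longleftrightarrow> (\<exists>U V f. subquotient K M U V N f \<and> nbhd P \<epsilon> M U V)"
proof
  assume "N \<in> EN K P \<epsilon> M"
  then obtain U V where UV: "subpmodule K U M" "subpmodule K V M" "\<And>p. V p \<subseteq> U p"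
    "\<forall>p. Im_shift P \<epsilon> M p \<subseteq> U p \<and> V p \<subseteq> Ker_shift P \<epsilon> M p"
    and "pmodule_iso K N (quot_pmodule (restrict_pmodule M U) V)"
    unfolding EN_def by blast
  then obtain g where "pmodule_hom K (quot_pmodule (restrict_pmodule M U) V) N g"
    "\<And>p. bij_betw (g p) (car (quot_pmodule (restrict_pmodule M U) V) p) (car N p)"
    using pmodule_iso_sym unfolding pmodule_iso_def by blast
  then show "\<exists>U V f. subquotient K M U V N f \<and> nbhd P \<epsilon> M U V"
    using subquotient.compose_iso[OF subquotient_quot[OF assms UV(1-3)]] UV(4) by blast
next
  assume "\<exists>U V f. subquotient K M U V N f \<and> nbhd P \<epsilon> M U V"
  then obtain U V f where S: "subquotient K M U V N f"
    and UV: "nbhd P \<epsilon> M U V" by blast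
  interpret subquotient K M U V N f by fact
  have "pmodule_iso K N (quot_pmodule (restrict_pmodule M U) V)"
    by (rule quotient_unique[OF subquotient_quot[OF assms subU subV VU]])
  then show "N \<in> EN K P \<epsilon> M" unfolding EN_def using UV subU subV VU by blast
qed

end

lemma dsum_pmodule_simps [simp]:
  "x \<in> car (dsum_pmodule I S) p \<longleftrightarrow>
    x \<in> (\<Pi>\<^sub>E i\<in>I. car (S i) p) \<and> finite {i \<in> I. x i \<noteq> zer (S i) p}"
  "zer (dsum_pmodule I S) p = (\<lambda>i\<in>I. zer (S i) p)"
  "x \<oplus>\<^bsub>space_at (dsum_pmodule I S) p\<^esub> y = (\<lambda>i\<in>I. x i \<oplus>\<^bsub>space_at (S i) p\<^esub> y i)"
  "k \<odot>\<^bsub>space_at (dsum_pmodule I S) p\<^esub> x = (\<lambda>i\<in>I. k \<odot>\<^bsub>space_at (S i) p\<^esub> x i)"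
  "map_at (dsum_pmodule I S) p q x = (\<lambda>i\<in>I. map_at (S i) p q (x i))"
  by (auto simp: dsum_pmodule_def dsum_space_def)

text \<open>An isomorphism from \<open>M\<close> to an external direct sum; it yields the projections \<open>proj\<close> of an internal one.\<close>

locale summands = pmodule K M
  for K :: "('k, 'm) ring_scheme" and M :: "('p::order, 'k, 'v) pmod" +
  fixes I :: "'i set" and S :: "'i \<Rightarrow> ('p, 'k, 'w) pmod" and \<phi> :: "'p \<Rightarrow> 'v \<Rightarrow> 'i \<Rightarrow> 'w"
  assumes summand: "i \<in> I \<Longrightarrow> pmodule K (S i)"
    and iso_hom: "pmodule_hom K M (dsum_pmodule I S) \<phi>"
    and iso_bij: "bij_betw (\<phi> p) (car M p) (car (dsum_pmodule I S) p)"

context summands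
begin

definition \<psi> :: "'p \<Rightarrow> ('i \<Rightarrow> 'w) \<Rightarrow> 'v" where
  "\<psi> p = inv_into (car M p) (\<phi> p)"

definition emb :: "'i \<Rightarrow> 'p \<Rightarrow> 'w \<Rightarrow> 'v" where
  "emb i p y = \<psi> p (\<lambda>j\<in>I. if j = i then y else zer (S j) p)"

definition proj :: "'i \<Rightarrow> 'p \<Rightarrow> 'v \<Rightarrow> 'v" where
  "proj i p x = emb i p (\<phi> p x i)"

lemmas \<psi>_hom = pmodule_hom_inverse(1)[OF iso_hom iso_bij, folded \<psi>_def]
lemmas \<psi>\<phi> = pmodule_hom_inverse(2)[OF iso_hom iso_bij, folded \<psi>_def]
lemmas \<phi>\<psi> = pmodule_hom_inverse(3)[OF iso_hom iso_bij, folded \<psi>_def]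
lemmas \<psi>_closed = pmodule_hom_inverse(4)[OF iso_hom iso_bij, folded \<psi>_def]

lemma \<phi>_mem:
  assumes "x \<in> car M p"
  shows "\<phi> p x \<in> (\<Pi>\<^sub>E i\<in>I. car (S i) p)" "finite {i \<in> I. \<phi> p x i \<noteq> zer (S i) p}"
  using pmodule_hom.hom_closed[OF iso_hom assms] by simp_all

lemma component_hom: assumes i: "i \<in> I" shows "pmodule_hom K M (S i) (\<lambda>p x. \<phi> p x i)"
proof (rule pmodule_homI[OF pmodule_axioms summand[OF i]])
  show "\<phi> p x i \<in> car (S i) p" if "x \<in> car M p" for p x using \<phi>_mem(1)[OF that] i by blast
  show "\<phi> p (x \<oplus>\<^bsub>space_at M p\<^esub> y) i = \<phi> p x i \<oplus>\<^bsub>space_at (S i) p\<^esub> \<phi> p y i"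
    if "x \<in> car M p" "y \<in> car M p" for p x y
    using pmodule_hom.hom_add[OF iso_hom that] i by simp
  show "\<phi> p (k \<odot>\<^bsub>space_at M p\<^esub> x) i = k \<odot>\<^bsub>space_at (S i) p\<^esub> \<phi> p x i"
    if "k \<in> carrier K" "x \<in> car M p" for p k x
    using pmodule_hom.hom_smult[OF iso_hom that] i by simp
  show "\<phi> q (map_at M p q x) i = map_at (S i) p q (\<phi> p x i)"
    if "p \<le> q" "x \<in> car M p" for p q x
    using pmodule_hom.natural[OF iso_hom that] i by simp
qed

lemma components_eq:
  assumes "x \<in> car M p" "y \<in> car M p" "\<And>i. i \<in> I \<Longrightarrow> \<phi> p x i = \<phi> p y i"
  shows "x = y"
proof -
  have "\<phi> p x = \<phi> p y" using \<phi>_mem(1) assms by (meson PiE_ext)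
  then show ?thesis using \<psi>\<phi> assms by metis
qed

lemma components_exist:
  assumes "\<And>i. i \<in> I \<Longrightarrow> y i \<in> car (S i) p" "finite {i \<in> I. y i \<noteq> zer (S i) p}"
  shows "\<exists>x\<in>car M p. \<forall>i\<in>I. \<phi> p x i = y i"
proof -
  have "{i \<in> I. restrict y I i \<noteq> zer (S i) p} = {i \<in> I. y i \<noteq> zer (S i) p}" by auto
  then have y: "restrict y I \<in> car (dsum_pmodule I S) p" using assms by simp
  show ?thesis by (rule bexI[OF _ \<psi>_closed[OF y]]) (simp add: \<phi>\<psi>[OF y])
qed

lemma single_mem:
  assumes i: "i \<in> I" and y: "y \<in> car (S i) p"
  shows "(\<lambda>j\<in>I. if j = i then y else zer (S j) p) \<in> car (dsum_pmodule I S) p"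
proof -
  have "zer (S j) p \<in> car (S j) p" if "j \<in> I" for j
  proof -
    interpret Sj: pmodule K "S j" by (rule summand[OF that])
    show ?thesis by simp
  qed
  moreover have "finite {j \<in> I. (\<lambda>j\<in>I. if j = i then y else zer (S j) p) j \<noteq> zer (S j) p}"
    by (rule finite_subset[of _ "{i}"]) auto
  ultimately show ?thesis using y by simp
qed

lemma component_emb:
  "i \<in> I \<Longrightarrow> j \<in> I \<Longrightarrow> y \<in> car (S i) p \<Longrightarrow> \<phi> p (emb i p y) j = (if j = i then y else zer (S j) p)"
  unfolding emb_def using \<phi>\<psi>[OF single_mem] by simp

lemma emb_hom: assumes i: "i \<in> I" shows "pmodule_hom K (S i) M (emb i)"
proof -
  have z: "pmodule K (S j)" if "j \<in> I" for j using summand that .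
  have "pmodule_hom K (S i) (dsum_pmodule I S) (\<lambda>p y. \<lambda>j\<in>I. if j = i then y else zer (S j) p)"
  proof (rule pmodule_homI)
    show "(\<lambda>j\<in>I. if j = i then y else zer (S j) p) \<in> car (dsum_pmodule I S) p"
      if "y \<in> car (S i) p" for p y using single_mem[OF i that] .
  next
    fix p x y
    have "zer (S j) p \<oplus>\<^bsub>space_at (S j) p\<^esub> zer (S j) p = zer (S j) p" if "j \<in> I" for j
    proof -
      interpret Sj: pmodule K "S j" by (rule summand[OF that])
      show ?thesis by simp
    qed
    then show "(\<lambda>j\<in>I. if j = i then x \<oplus>\<^bsub>space_at (S i) p\<^esub> y else zer (S j) p) =
      (\<lambda>j\<in>I. if j = i then x else zer (S j) p) \<oplus>\<^bsub>space_at (dsum_pmodule I S) p\<^esub>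
      (\<lambda>j\<in>I. if j = i then y else zer (S j) p)" by (auto simp: fun_eq_iff)
  next
    fix p k x assume k: "k \<in> carrier K"
    have "k \<odot>\<^bsub>space_at (S j) p\<^esub> zer (S j) p = zer (S j) p" if "j \<in> I" for j
    proof -
      interpret Sj: pmodule K "S j" by (rule summand[OF that])
      show ?thesis using k by simp
    qed
    then show "(\<lambda>j\<in>I. if j = i then k \<odot>\<^bsub>space_at (S i) p\<^esub> x else zer (S j) p) =
      k \<odot>\<^bsub>space_at (dsum_pmodule I S) p\<^esub> (\<lambda>j\<in>I. if j = i then x else zer (S j) p)"
      by (auto simp: fun_eq_iff)
  next
    fix p q x assume le: "(p :: 'p) \<le> q"
    have "map_at (S j) p q (zer (S j) p) = zer (S j) q" if "j \<in> I" for j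
      by (rule pmodule.map_zero[OF summand[OF that] le])
    then show "(\<lambda>j\<in>I. if j = i then map_at (S i) p q x else zer (S j) q) =
      map_at (dsum_pmodule I S) p q (\<lambda>j\<in>I. if j = i then x else zer (S j) p)"
      by (auto simp: fun_eq_iff)
  qed (use summand[OF i] iso_hom[unfolded pmodule_hom_def] in blast)+
  moreover have "emb i = (\<lambda>p y. \<psi> p (\<lambda>j\<in>I. if j = i then y else zer (S j) p))"
    by (simp add: emb_def fun_eq_iff)
  ultimately show ?thesis using pmodule_hom_comp[OF _ \<psi>_hom] by simp
qed

lemma component_closed: "i \<in> I \<Longrightarrow> x \<in> car M p \<Longrightarrow> \<phi> p x i \<in> car (S i) p"
  using pmodule_hom.hom_closed[OF component_hom] .

lemma emb_closed: "i \<in> I \<Longrightarrow> y \<in> car (S i) p \<Longrightarrow> emb i p y \<in> car M p"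
  using pmodule_hom.hom_closed[OF emb_hom] .

lemma component_proj:
  "i \<in> I \<Longrightarrow> j \<in> I \<Longrightarrow> x \<in> car M p \<Longrightarrow> \<phi> p (proj i p x) j = (if j = i then \<phi> p x i else zer (S j) p)"
  unfolding proj_def by (simp add: component_emb component_closed)

lemma component_zero: "i \<in> I \<Longrightarrow> \<phi> p (zer M p) i = zer (S i) p"
  using pmodule_hom.hom_zero[OF component_hom] .

lemma proj_zero_iff:
  assumes "i \<in> I" "x \<in> car M p"
  shows "proj i p x = zer M p \<longleftrightarrow> \<phi> p x i = zer (S i) p"
proof
  assume "proj i p x = zer M p"
  then show "\<phi> p x i = zer (S i) p"
    using component_proj[OF assms(1,1,2)] component_zero[OF assms(1)] by metis
next
  assume "\<phi> p x i = zer (S i) p"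
  then show "proj i p x = zer M p"
    unfolding proj_def using pmodule_hom.hom_zero[OF emb_hom[OF assms(1)]] by simp
qed

lemma decomp_proj: "decomp K M I proj"
proof (intro decomp.intro decomp_axioms.intro pmodule_axioms)
  fix i assume i: "i \<in> I"
  show h: "pmodule_hom K M M (proj i)"
    unfolding proj_def by (rule pmodule_hom_comp[OF component_hom[OF i] emb_hom[OF i]])
  fix x p assume x: "x \<in> car M p"
  have c: "proj i p x \<in> car M p" by (rule pmodule_hom.hom_closed[OF h x])
  show "proj i p (proj i p x) = proj i p x"
    using component_proj[OF i i x] by (simp add: proj_def[of i p "proj i p x"]) (simp add: proj_def)
  fix j assume j: "j \<in> I" "j \<noteq> i"
  show "proj j p (proj i p x) = zer M p"
    using proj_zero_iff[OF j(1) c] component_proj[OF i j(1) x] j(2) by simp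
next
  fix x p assume x: "x \<in> car M p"
  have "{i \<in> I. proj i p x \<noteq> zer M p} = {i \<in> I. \<phi> p x i \<noteq> zer (S i) p}"
    using proj_zero_iff[OF _ x] by blast
  then show "finite {i \<in> I. proj i p x \<noteq> zer M p}" using \<phi>_mem(2)[OF x] by simp
next
  fix x p assume x: "x \<in> car M p" and 0: "\<And>i. i \<in> I \<Longrightarrow> proj i p x = zer M p"
  show "x = zer M p"
    by (rule components_eq[OF x]) (use 0 proj_zero_iff[OF _ x] component_zero in auto)
qed

text \<open>The surjections of the summands act componentwise. A preimage of a finitely supported family is again finitely
  supported if zero is chosen as preimage of zero.\<close>

lemma dsum_subquotient:
  assumes sq: "\<And>i. i \<in> I \<Longrightarrow> subquotient K (S i) (U i) (V i) (N i) (g i)"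
  shows "subquotient K M (\<lambda>p. {x \<in> car M p. \<forall>i\<in>I. \<phi> p x i \<in> U i p})
    (\<lambda>p. {x \<in> car M p. \<forall>i\<in>I. \<phi> p x i \<in> V i p}) (dsum_pmodule I N) (\<lambda>p x. \<lambda>i\<in>I. g i p (\<phi> p x i))"
proof -
  let ?U = "\<lambda>p. {x \<in> car M p. \<forall>i\<in>I. \<phi> p x i \<in> U i p}"
  let ?V = "\<lambda>p. {x \<in> car M p. \<forall>i\<in>I. \<phi> p x i \<in> V i p}"
  let ?F = "\<lambda>p x. \<lambda>i\<in>I. g i p (\<phi> p x i)"
  have pre: "subpmodule K (\<lambda>p. {x \<in> car M p. \<forall>i\<in>I. \<phi> p x i \<in> W i p}) M"
    if W: "\<And>i. i \<in> I \<Longrightarrow> subpmodule K (W i) (S i)" for W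
  proof -
    note W' = iffD1[OF subpmodule_iff[OF summand] W]
    show ?thesis
      unfolding subpmodule_iff[OF pmodule_axioms]
      using W' pmodule_hom.hom_add[OF component_hom] pmodule_hom.hom_smult[OF component_hom]
        pmodule_hom.natural[OF component_hom] component_zero
      by auto
  qed
  have U: "subpmodule K ?U M" by (rule pre) (use sq subquotient.subU in blast)
  have V: "subpmodule K ?V M" by (rule pre) (use sq subquotient.subV in blast)
  have VU: "?V p \<subseteq> ?U p" for p using subquotient.VU[OF sq] by blast
  have surj: "?F p ` ?U p = car (dsum_pmodule I N) p" for p
  proof
    show "?F p ` ?U p \<subseteq> car (dsum_pmodule I N) p"
    proof
      fix y assume "y \<in> ?F p ` ?U p"
      then obtain x where x: "x \<in> ?U p" "y = ?F p x" by blast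
      have "{i \<in> I. y i \<noteq> zer (N i) p} \<subseteq> {i \<in> I. \<phi> p x i \<noteq> zer (S i) p}"
        using x subquotient.f_zero[OF sq] by auto
      then have "finite {i \<in> I. y i \<noteq> zer (N i) p}"
        using \<phi>_mem(2)[of x p] x(1) finite_subset by blast
      moreover have "y i \<in> car (N i) p" if "i \<in> I" for i
        using x that subquotient.f_closed[OF sq[OF that]] by simp
      ultimately show "y \<in> car (dsum_pmodule I N) p" using x(2) by auto
    qed
    show "car (dsum_pmodule I N) p \<subseteq> ?F p ` ?U p"
    proof
      fix y assume y: "y \<in> car (dsum_pmodule I N) p"
      have "\<exists>z\<in>U i p. g i p z = y i \<and> (y i = zer (N i) p \<longrightarrow> z = zer (S i) p)" if i: "i \<in> I" for i
      proof (cases "y i = zer (N i) p")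
        case True
        then show ?thesis using subquotient.U_zero[OF sq[OF i]] subquotient.f_zero[OF sq[OF i]] by auto
      next
        case False
        have "y i \<in> car (N i) p" using y i by auto
        then show ?thesis using subquotient.f_ex[OF sq[OF i]] False by blast
      qed
      then obtain z where z: "\<And>i. i \<in> I \<Longrightarrow> z i \<in> U i p \<and> g i p (z i) = y i \<and>
          (y i = zer (N i) p \<longrightarrow> z i = zer (S i) p)" by metis
      have "finite {i \<in> I. z i \<noteq> zer (S i) p}"
        by (rule finite_subset[of _ "{i \<in> I. y i \<noteq> zer (N i) p}"]) (use y z in auto)
      then obtain x where x: "x \<in> car M p" "\<forall>i\<in>I. \<phi> p x i = z i"
        using components_exist[of z p] z subquotient.U_car[OF sq] by blast
      then have xU: "x \<in> ?U p" and Fx: "?F p x = restrict y I" using z by auto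
      have "y \<in> (\<Pi>\<^sub>E i\<in>I. car (N i) p)" using y by simp
      then have "restrict y I = y" by (rule PiE_restrict)
      then have "y = ?F p x" using Fx by simp
      then show "y \<in> ?F p ` ?U p" using xU by (rule image_eqI)
    qed
  qed
  have add: "?F p (x \<oplus>\<^bsub>space_at M p\<^esub> y) = ?F p x \<oplus>\<^bsub>space_at (dsum_pmodule I N) p\<^esub> ?F p y"
    if "x \<in> ?U p" "y \<in> ?U p" for p x y
    using that pmodule_hom.hom_add[OF component_hom] subquotient.f_add[OF sq]
    by (auto simp: fun_eq_iff)
  have smult: "?F p (k \<odot>\<^bsub>space_at M p\<^esub> x) = k \<odot>\<^bsub>space_at (dsum_pmodule I N) p\<^esub> ?F p x"
    if "k \<in> carrier K" "x \<in> ?U p" for p k x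
    using that pmodule_hom.hom_smult[OF component_hom] subquotient.f_smult[OF sq]
    by (auto simp: fun_eq_iff)
  have nat: "?F q (map_at M p q x) = map_at (dsum_pmodule I N) p q (?F p x)"
    if "p \<le> q" "x \<in> ?U p" for p q x
    using that pmodule_hom.natural[OF component_hom] subquotient.f_natural[OF sq]
    by (auto simp: fun_eq_iff)
  have zero: "?F p (zer M p) = zer (dsum_pmodule I N) p" for p
    using component_zero subquotient.f_zero[OF sq] by (auto simp: fun_eq_iff)
  have pm: "pmodule K (dsum_pmodule I N)"
    by (rule pmodule_image(1)[OF restrict_pmodule[OF pmodule_axioms U], of ?F])
      (use surj add smult nat zero in \<open>simp_all del: dsum_pmodule_simps\<close>)
  show ?thesis
  proof (intro subquotient.intro subquotient_axioms.intro pmodule_axioms pm U V VU surj)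
    fix x p assume x: "x \<in> ?U p"
    have "?F p x = zer (dsum_pmodule I N) p \<longleftrightarrow> (\<forall>i\<in>I. g i p (\<phi> p x i) = zer (N i) p)"
      by (auto simp: fun_eq_iff)
    also have "\<dots> \<longleftrightarrow> (\<forall>i\<in>I. \<phi> p x i \<in> V i p)" using subquotient.f_ker[OF sq] x by blast
    finally show "?F p x = zer (dsum_pmodule I N) p \<longleftrightarrow> x \<in> ?V p" using x by simp
  qed (use add smult nat in \<open>simp_all del: dsum_pmodule_simps\<close>)
qed

text \<open>This reduces refinements of \<open>M\<close> along a fixed decomposition to pairs of homogeneous submodules of \<open>M\<close>: a
  homogeneous submodule is the same as a family of submodules of the summands.\<close>

theorem EN_family_iff:
  fixes R :: "('p, 'k, 'u) pmod"
  assumes P: "poset_flow P" and \<epsilon>: "0 \<le> \<epsilon>"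
  shows "(\<exists>N :: 'i \<Rightarrow> ('p, 'k, 'w set) pmod.
      (\<forall>i\<in>I. N i \<in> EN K P \<epsilon> (S i)) \<and> pmodule_iso K R (dsum_pmodule I N)) \<longleftrightarrow>
    (\<exists>U V f. subquotient K M U V R f \<and> homogeneous I proj U \<and> homogeneous I proj V \<and>
      nbhd P \<epsilon> M U V)"
    (is "?external \<longleftrightarrow> ?internal")
proof
  interpret P: poset_flow P by fact
  assume ?external
  then obtain N :: "'i \<Rightarrow> ('p, 'k, 'w set) pmod" where N: "\<And>i. i \<in> I \<Longrightarrow> N i \<in> EN K P \<epsilon> (S i)"
    and iso: "pmodule_iso K R (dsum_pmodule I N)" by blast
  have "\<exists>U V g. subquotient K (S i) U V (N i) g \<and> nbhd P \<epsilon> (S i) U V" if "i \<in> I" for i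
    using N[OF that] unfolding P.EN_iff[OF summand[OF that]] .
  then obtain U V g where sq: "\<And>i. i \<in> I \<Longrightarrow> subquotient K (S i) (U i) (V i) (N i) (g i)"
    and Im: "\<And>i p. i \<in> I \<Longrightarrow> Im_shift P \<epsilon> (S i) p \<subseteq> U i p"
    and Ker: "\<And>i p. i \<in> I \<Longrightarrow> V i p \<subseteq> Ker_shift P \<epsilon> (S i) p"
    by metis
  let ?U = "\<lambda>p. {x \<in> car M p. \<forall>i\<in>I. \<phi> p x i \<in> U i p}"
  let ?V = "\<lambda>p. {x \<in> car M p. \<forall>i\<in>I. \<phi> p x i \<in> V i p}"
  note sub = dsum_subquotient[of U V N g, OF sq]
  obtain h where h: "pmodule_hom K (dsum_pmodule I N) R h"
    "\<And>p. bij_betw (h p) (car (dsum_pmodule I N) p) (car R p)"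
    using pmodule_iso_sym[OF iso] unfolding pmodule_iso_def by blast
  have "\<exists>f. subquotient K M ?U ?V R f"
    using subquotient.compose_iso[OF sub h] by blast
  moreover have "proj i p x \<in> car M p" if "i \<in> I" "x \<in> car M p" for i p x
    using decomp.proj_closed[OF decomp_proj that] .
  then have "homogeneous I proj ?U" "homogeneous I proj ?V"
    unfolding homogeneous_def
    using component_proj subquotient.U_zero[OF sq] subquotient.V_zero[OF sq] by auto
  moreover have "Im_shift P \<epsilon> M p \<subseteq> ?U p" for p
  proof
    fix x assume "x \<in> Im_shift P \<epsilon> M p"
    then obtain z where z: "z \<in> car M (P (- \<epsilon>) p)" "x = map_at M (P (- \<epsilon>) p) p z"
      unfolding P.Im_shift_eq by blast
    note le = P.flow_le[OF \<epsilon>, of p]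
    have "\<phi> p x i \<in> U i p" if i: "i \<in> I" for i
    proof -
      have "\<phi> p x i = map_at (S i) (P (- \<epsilon>) p) p (\<phi> (P (- \<epsilon>) p) z i)"
        unfolding z(2) using pmodule_hom.natural[OF component_hom[OF i] le z(1)] .
      then have "\<phi> p x i \<in> Im_shift P \<epsilon> (S i) p"
        unfolding P.Im_shift_eq using component_closed[OF i z(1)] by blast
      then show ?thesis using Im[OF i] by blast
    qed
    then show "x \<in> ?U p" using z le by simp
  qed
  moreover have "?V p \<subseteq> Ker_shift P \<epsilon> M p" for p
  proof
    fix x assume x: "x \<in> ?V p"
    note le = P.flow_ge[OF \<epsilon>, of p]
    have "\<phi> (P \<epsilon> p) (map_at M p (P \<epsilon> p) x) i = zer (S i) (P \<epsilon> p)" if i: "i \<in> I" for i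
    proof -
      have "\<phi> p x i \<in> Ker_shift P \<epsilon> (S i) p" using x Ker i by blast
      then show ?thesis
        using pmodule_hom.natural[OF component_hom[OF i] le, of x] x by (simp add: P.Ker_shift_eq)
    qed
    then have "map_at M p (P \<epsilon> p) x = zer M (P \<epsilon> p)"
      using x le by (intro components_eq[where p = "P \<epsilon> p"]) (simp_all add: component_zero)
    then show "x \<in> Ker_shift P \<epsilon> M p" using x by (simp add: P.Ker_shift_eq)
  qed
  ultimately show ?internal by blast
next
  interpret P: poset_flow P by fact
  assume ?internal
  then obtain U V f where sub: "subquotient K M U V R f"
    and hU: "homogeneous I proj U" and hV: "homogeneous I proj V"
    and Im: "\<And>p. Im_shift P \<epsilon> M p \<subseteq> U p" and Ker: "\<And>p. V p \<subseteq> Ker_shift P \<epsilon> M p" by blast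
  interpret F: subquotient K M U V R f by fact
  \<comment> \<open>The intersection of \<open>W\<close> with the summand \<open>S i\<close>.\<close>
  define Us where "Us W i p = {y \<in> car (S i) p. emb i p y \<in> W p}" for W :: "'p \<Rightarrow> 'v set" and i p
  have sub_Us: "subpmodule K (Us W i) (S i)" if W: "subpmodule K W M" and i: "i \<in> I" for W i
  proof -
    interpret Si: pmodule K "S i" by (rule summand[OF i])
    interpret emb: pmodule_hom K "S i" M "emb i" by (rule emb_hom[OF i])
    show ?thesis
      using W unfolding subpmodule_iff[OF Si.pmodule_axioms] subpmodule_iff[OF pmodule_axioms] Us_def
      by (auto simp: emb.hom_add emb.hom_smult emb.natural)
  qed
  have Us_mem: "{x \<in> car M p. \<forall>i\<in>I. \<phi> p x i \<in> Us W i p} = W p"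
    if W: "subpmodule K W M" and hW: "homogeneous I proj W" for W p
  proof (intro Set.set_eqI iffI)
    fix x assume "x \<in> {x \<in> car M p. \<forall>i\<in>I. \<phi> p x i \<in> Us W i p}"
    then show "x \<in> W p"
      using decomp.homogeneous_memI[OF decomp_proj W, of x p] by (simp add: Us_def proj_def)
  next
    fix x assume x: "x \<in> W p"
    then have "x \<in> car M p" using W unfolding subpmodule_iff[OF pmodule_axioms] by blast
    then show "x \<in> {x \<in> car M p. \<forall>i\<in>I. \<phi> p x i \<in> Us W i p}"
      using x hW component_closed unfolding homogeneous_def proj_def Us_def by blast
  qed
  define N where "N i = quot_pmodule (restrict_pmodule (S i) (Us U i)) (Us V i)" for i
  have sq: "subquotient K (S i) (Us U i) (Us V i) (N i) (\<lambda>p x. Us V i p +>\<^bsub>space_at (S i) p\<^esub> x)"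
    if i: "i \<in> I" for i
    unfolding N_def
    by (rule subquotient_quot[OF summand[OF i] sub_Us[OF F.subU i] sub_Us[OF F.subV i]])
      (use F.VU in \<open>auto simp: Us_def\<close>)
  have "pmodule_iso K R (dsum_pmodule I N)"
    using F.quotient_unique dsum_subquotient[of "Us U" "Us V" N, OF sq]
    unfolding Us_mem[OF F.subU hU] Us_mem[OF F.subV hV] by blast
  moreover have "N i \<in> EN K P \<epsilon> (S i)" if i: "i \<in> I" for i
    unfolding P.EN_iff[OF summand[OF i]]
  proof (intro exI conjI allI)
    show "subquotient K (S i) (Us U i) (Us V i) (N i) (\<lambda>p x. Us V i p +>\<^bsub>space_at (S i) p\<^esub> x)"
      by (rule sq[OF i])
    fix p
    interpret Si: pmodule K "S i" by (rule summand[OF i])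
    interpret emb: pmodule_hom K "S i" M "emb i" by (rule emb_hom[OF i])
    show "Im_shift P \<epsilon> (S i) p \<subseteq> Us U i p"
    proof
      fix y assume "y \<in> Im_shift P \<epsilon> (S i) p"
      then obtain z where z: "z \<in> car (S i) (P (- \<epsilon>) p)" "y = map_at (S i) (P (- \<epsilon>) p) p z"
        unfolding P.Im_shift_eq by blast
      then have "emb i p y \<in> Im_shift P \<epsilon> M p"
        unfolding P.Im_shift_eq using emb.natural[OF P.flow_le[OF \<epsilon>] z(1)] by auto
      then show "y \<in> Us U i p" using Im z P.flow_le[OF \<epsilon>] by (auto simp: Us_def)
    qed
    show "Us V i p \<subseteq> Ker_shift P \<epsilon> (S i) p"
    proof
      fix y assume y: "y \<in> Us V i p"
      let ?q = "P \<epsilon> p"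
      note le = P.flow_ge[OF \<epsilon>, of p]
      have yS: "y \<in> car (S i) p" "emb i p y \<in> V p" using y by (simp_all add: Us_def)
      have "emb i ?q (map_at (S i) p ?q y) = zer M ?q"
        using Ker yS emb.natural[OF le yS(1)] by (auto simp: P.Ker_shift_eq)
      then have "map_at (S i) p ?q y = zer (S i) ?q"
        using component_emb[OF i i Si.map_closed[OF le yS(1)]] component_zero[OF i] by simp
      then show "y \<in> Ker_shift P \<epsilon> (S i) p" using yS by (simp add: P.Ker_shift_eq)
    qed
  qed
  ultimately show ?external by blast
qed

end

text \<open>The module is the direct sum of the image and the kernel of \<open>h\<close>.\<close>

lemma indecomposable_idempotent:
  assumes ind: "indecomposable K X" and h: "pmodule_hom K X X h"
    and idem: "\<And>p x. x \<in> car X p \<Longrightarrow> h p (h p x) = h p x"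
  shows "(\<forall>p. \<forall>x\<in>car X p. h p x = zer X p) \<or> (\<forall>p. \<forall>x\<in>car X p. h p x = x)"
proof -
  interpret h: pmodule_hom K X X h by fact
  define U where "U p = h p ` car X p" for p
  define W where "W p = {x \<in> car X p. h p x = zer X p}" for p
  have U_iff: "x \<in> U p \<longleftrightarrow> x \<in> car X p \<and> h p x = x" for x p
  proof
    assume "x \<in> U p"
    then obtain z where "z \<in> car X p" "x = h p z" unfolding U_def by blast
    then show "x \<in> car X p \<and> h p x = x" using idem by simp
  next
    assume "x \<in> car X p \<and> h p x = x"
    then show "x \<in> U p" unfolding U_def by (intro image_eqI[of _ _ x]) simp_all
  qed
  have "subpmodule K U X"
    unfolding subpmodule_iff[OF h.M.pmodule_axioms]
    by (auto simp: U_iff h.hom_add h.hom_smult h.natural subset_iff)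
  moreover have "subpmodule K W X"
    unfolding subpmodule_iff[OF h.M.pmodule_axioms]
    by (auto simp: W_def h.hom_add h.hom_smult h.natural)
  moreover have "U p <+>\<^bsub>space_at X p\<^esub> W p = car X p" for p
  proof
    show "U p <+>\<^bsub>space_at X p\<^esub> W p \<subseteq> car X p" by (auto simp: set_add_def' U_iff W_def)
    show "car X p \<subseteq> U p <+>\<^bsub>space_at X p\<^esub> W p"
    proof
      fix x assume x: "x \<in> car X p"
      let ?w = "x \<ominus>\<^bsub>space_at X p\<^esub> h p x"
      have "h p ?w = h p x \<ominus>\<^bsub>space_at X p\<^esub> h p x" using x idem by (simp add: h.hom_minus)
      also have "\<dots> = zer X p"
        unfolding a_minus_def by (rule h.M.V.M.r_neg[OF h.hom_closed[OF x]])
      finally have "?w \<in> W p" using x by (simp add: W_def)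
      moreover have "h p x \<in> U p" using x by (simp add: U_def)
      moreover have "x = h p x \<oplus>\<^bsub>space_at X p\<^esub> ?w"
        using x by (simp add: a_minus_def h.M.V.M.add.m_lcomm[of "h p x" p x] h.M.V.M.r_neg)
      ultimately show "x \<in> U p <+>\<^bsub>space_at X p\<^esub> W p" unfolding set_add_def' by blast
    qed
  qed
  moreover have "U p \<inter> W p = {zer X p}" for p by (auto simp: U_iff W_def)
  ultimately have "zero_pmodule (restrict_pmodule X U) \<or> zero_pmodule (restrict_pmodule X W)"
    using ind unfolding indecomposable_def by blast
  then show ?thesis
  proof
    assume "zero_pmodule (restrict_pmodule X U)"
    then have "U p = {zer X p}" for p by (simp add: zero_pmodule_def)
    then show ?thesis unfolding U_def by blast
  next
    assume "zero_pmodule (restrict_pmodule X W)"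
    then have W0: "W p = {zer X p}" for p by (simp add: zero_pmodule_def)
    have "h p x = x" if x: "x \<in> car X p" for p x
    proof -
      let ?w = "x \<ominus>\<^bsub>space_at X p\<^esub> h p x"
      have "h p ?w = h p x \<ominus>\<^bsub>space_at X p\<^esub> h p x" using x idem by (simp add: h.hom_minus)
      also have "\<dots> = zer X p"
        unfolding a_minus_def by (rule h.M.V.M.r_neg[OF h.hom_closed[OF x]])
      finally have "?w \<in> W p" using x by (simp add: W_def)
      then have "?w = zer X p" using W0 by blast
      then show ?thesis using x by simp
    qed
    then show ?thesis by blast
  qed
qed

text \<open>An idempotent endomorphism that lives on the summand \<open>S i\<close> is an idempotent of an indecomposable
  module.\<close>

lemma (in summands) proj_primitive:
  assumes i: "i \<in> I" and ind: "indecomposable K (S i)" and h: "pmodule_hom K M M h"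
    and idem: "\<And>p x. x \<in> car M p \<Longrightarrow> h p (h p x) = h p x"
    and hp: "\<And>p x. x \<in> car M p \<Longrightarrow> h p (proj i p x) = h p x"
    and ph: "\<And>p x. x \<in> car M p \<Longrightarrow> proj i p (h p x) = h p x"
  shows "(\<forall>p. \<forall>x\<in>car M p. h p x = zer M p) \<or> (\<forall>p. \<forall>x\<in>car M p. h p x = proj i p x)"
proof -
  interpret h: pmodule_hom K M M h by fact
  define h' where "h' p y = \<phi> p (h p (emb i p y)) i" for p y
  have "pmodule_hom K (S i) (S i) h'"
    unfolding h'_def[abs_def]
    by (rule pmodule_hom_comp[OF pmodule_hom_comp[OF emb_hom[OF i] h] component_hom[OF i]])
  moreover have "h' p (h' p y) = h' p y" if y: "y \<in> car (S i) p" for p y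
  proof -
    have c: "h p (emb i p y) \<in> car M p" using emb_closed[OF i y] by simp
    have "emb i p (h' p y) = h p (emb i p y)"
      unfolding h'_def using ph[OF emb_closed[OF i y]] by (simp add: proj_def)
    then show ?thesis using idem[OF emb_closed[OF i y]] by (simp add: h'_def)
  qed
  moreover have hh': "h p x = emb i p (h' p (\<phi> p x i))" if x: "x \<in> car M p" for p x
  proof -
    have c: "proj i p x \<in> car M p" using decomp.proj_closed[OF decomp_proj i x] .
    show ?thesis using ph[OF c] hp[OF x] by (simp add: h'_def proj_def)
  qed
  ultimately have "(\<forall>p. \<forall>y\<in>car (S i) p. h' p y = zer (S i) p) \<or> (\<forall>p. \<forall>y\<in>car (S i) p. h' p y = y)"
    using indecomposable_idempotent[OF ind] by blast
  then show ?thesis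
  proof
    assume "\<forall>p. \<forall>y\<in>car (S i) p. h' p y = zer (S i) p"
    then have "\<forall>p. \<forall>x\<in>car M p. h p x = zer M p"
      using hh' component_closed[OF i] pmodule_hom.hom_zero[OF emb_hom[OF i]] by simp
    then show ?thesis ..
  next
    assume "\<forall>p. \<forall>y\<in>car (S i) p. h' p y = y"
    then have "\<forall>p. \<forall>x\<in>car M p. h p x = proj i p x"
      using hh' component_closed[OF i] by (simp add: proj_def)
    then show ?thesis ..
  qed
qed

lemma decomposition_summands:
  assumes "pmodule K M" and "decomposition K M I S"
  obtains \<phi> where "summands K M I S \<phi>"
proof -
  obtain \<phi> where "pmodule_hom K M (dsum_pmodule I S) \<phi>"
    "\<And>p. bij_betw (\<phi> p) (car M p) (car (dsum_pmodule I S) p)"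
    using assms(2) unfolding decomposition_def pmodule_iso_def by blast
  moreover have "pmodule K (S i)" if "i \<in> I" for i
    using assms(2) that by (simp add: decomposition_def indecomposable_def)
  ultimately have "summands K M I S \<phi>"
    by (intro summands.intro summands_axioms.intro assms(1))
  then show ?thesis using that by blast
qed

section \<open>Changing the decomposition of a subquotient\<close>

context subquotient
begin

lemma compose:
  assumes "subquotient K R U1 V1 R' k"
  shows "subquotient K M (\<lambda>p. {x \<in> U p. f p x \<in> U1 p}) (\<lambda>p. {x \<in> U p. f p x \<in> V1 p})
    R' (\<lambda>p x. k p (f p x))"
proof -
  interpret S: subquotient K R U1 V1 R' k by fact
  have sub: "subpmodule K (\<lambda>p. {x \<in> U p. f p x \<in> W p}) M" if "subpmodule K W R" for W
    using that U_rules unfolding subpmodule_iff[OF M.pmodule_axioms] subpmodule_iff[OF R.pmodule_axioms]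
    by (auto simp: f_add f_smult f_natural f_zero)
  have surj: "(\<lambda>x. k p (f p x)) ` {x \<in> U p. f p x \<in> U1 p} = car R' p" for p
  proof -
    have "f p ` {x \<in> U p. f p x \<in> U1 p} = U1 p"
    proof
      show "U1 p \<subseteq> f p ` {x \<in> U p. f p x \<in> U1 p}"
      proof
        fix y assume y: "y \<in> U1 p"
        then obtain x where "x \<in> U p" "f p x = y" using f_ex S.U_car by blast
        then show "y \<in> f p ` {x \<in> U p. f p x \<in> U1 p}" using y by blast
      qed
    qed blast
    then show ?thesis using S.f_surj[of p] by (metis image_image)
  qed
  show ?thesis
    by (intro subquotient.intro subquotient_axioms.intro M.pmodule_axioms S.R.pmodule_axioms
        sub[OF S.subU] sub[OF S.subV] surj)
      (use S.VU S.f_ker in \<open>auto simp: f_add f_smult f_natural S.f_add S.f_smult S.f_natural\<close>)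
qed

lemma image_subpmodule:
  assumes "subpmodule K S M" and SU: "\<And>p. S p \<subseteq> U p"
  shows "subpmodule K (\<lambda>p. f p ` S p) R"
  unfolding subpmodule_iff[OF R.pmodule_axioms]
proof (intro conjI allI ballI impI)
  note S = assms(1)[unfolded subpmodule_iff[OF M.pmodule_axioms]]
  have Sz: "zer M p \<in> S p" and Sa: "x \<in> S p \<Longrightarrow> y \<in> S p \<Longrightarrow> x \<oplus>\<^bsub>space_at M p\<^esub> y \<in> S p"
    and Ss: "k \<in> carrier K \<Longrightarrow> x \<in> S p \<Longrightarrow> k \<odot>\<^bsub>space_at M p\<^esub> x \<in> S p"
    and Sm: "p \<le> q \<Longrightarrow> x \<in> S p \<Longrightarrow> map_at M p q x \<in> S q" for k x y p q
    using S by blast+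
  have SU': "x \<in> S p \<Longrightarrow> x \<in> U p" for x p using SU by blast
  show "f p ` S p \<subseteq> car R p" for p using SU' f_closed by blast
  show "zer R p \<in> f p ` S p" for p using f_zero by (intro image_eqI[OF _ Sz]) simp
  fix p x assume x: "x \<in> f p ` S p"
  then obtain a where a: "a \<in> S p" "x = f p a" by blast
  show "k \<odot>\<^bsub>space_at R p\<^esub> x \<in> f p ` S p" if "k \<in> carrier K" for k
    by (rule image_eqI[of _ _ "k \<odot>\<^bsub>space_at M p\<^esub> a"]) (simp_all add: that a Ss SU' f_smult)
  show "map_at R p q x \<in> f q ` S q" if "p \<le> q" for q
    by (rule image_eqI[of _ _ "map_at M p q a"]) (simp_all add: that a Sm SU' f_natural)
  fix y assume "y \<in> f p ` S p"
  then obtain b where b: "b \<in> S p" "y = f p b" by blast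
  show "x \<oplus>\<^bsub>space_at R p\<^esub> y \<in> f p ` S p"
    by (rule image_eqI[of _ _ "a \<oplus>\<^bsub>space_at M p\<^esub> b"]) (simp_all add: a b Sa SU' f_add)
qed

text \<open>The map \<open>l\<close> vanishes on $S \cap V$, so it descends to the image of \<open>S\<close> in \<open>R\<close>.\<close>

lemma factor:
  assumes "subquotient K M S T R' l" and SU: "\<And>p. S p \<subseteq> U p" and SV: "\<And>p. S p \<inter> V p \<subseteq> T p"
  shows "\<exists>k. subquotient K R (\<lambda>p. f p ` S p) (\<lambda>p. f p ` T p) R' k"
proof -
  interpret S: subquotient K M S T R' l by fact
  have SU': "x \<in> S p \<Longrightarrow> x \<in> U p" for x p using SU by blast
  define k where "k p y = l p (SOME x. x \<in> S p \<and> f p x = y)" for p y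
  have lf: "l p x = l p y" if xy: "x \<in> S p" "y \<in> S p" and "f p x = f p y" for p x y
  proof -
    have "x \<ominus>\<^bsub>space_at M p\<^esub> y \<in> S p \<inter> V p"
      using S.U_minus[OF xy] f_eq_iff[OF SU'[OF xy(1)] SU'[OF xy(2)]] \<open>f p x = f p y\<close> by simp
    then show ?thesis using S.f_eq_iff[OF xy] SV by blast
  qed
  have kf: "k p (f p x) = l p x" if x: "x \<in> S p" for p x
  proof -
    let ?x = "SOME z. z \<in> S p \<and> f p z = f p x"
    have z: "?x \<in> S p \<and> f p ?x = f p x" by (rule someI[of _ x]) (use x in simp)
    then show ?thesis unfolding k_def using lf x by blast
  qed
  have "subquotient K R (\<lambda>p. f p ` S p) (\<lambda>p. f p ` T p) R' k"
  proof (intro subquotient.intro subquotient_axioms.intro R.pmodule_axioms S.R.pmodule_axioms)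
    show "subpmodule K (\<lambda>p. f p ` S p) R" by (rule image_subpmodule[OF S.subU SU])
    show "subpmodule K (\<lambda>p. f p ` T p) R"
      by (rule image_subpmodule[OF S.subV]) (use S.VU SU in blast)
    show "f p ` T p \<subseteq> f p ` S p" for p using S.VU by blast
    show "k p ` f p ` S p = car R' p" for p
      using S.f_surj[of p] kf by (simp add: image_image)
  next
    fix p x assume "x \<in> f p ` S p"
    then obtain a where a: "a \<in> S p" "x = f p a" by blast
    show "k p x = zer R' p \<longleftrightarrow> x \<in> f p ` T p"
    proof
      assume "k p x = zer R' p"
      then show "x \<in> f p ` T p" using a kf S.f_ker by auto
    next
      assume "x \<in> f p ` T p"
      then obtain t where t: "t \<in> T p" "x = f p t" by blast
      then have "t \<in> S p" using S.VU by blast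
      then show "k p x = zer R' p" using t kf S.f_ker by simp
    qed
    show "k p (c \<odot>\<^bsub>space_at R p\<^esub> x) = c \<odot>\<^bsub>space_at R' p\<^esub> k p x" if "c \<in> carrier K" for c
      using kf[OF S.U_smult[OF that a(1)]] kf[OF a(1)] a that SU' by (simp add: f_smult S.f_smult)
    show "k q (map_at R p q x) = map_at R' p q (k p x)" if "p \<le> q" for q
      using kf[OF S.U_map[OF that a(1)]] kf[OF a(1)] a that SU' by (simp add: f_natural S.f_natural)
    fix y assume "y \<in> f p ` S p"
    then obtain b where b: "b \<in> S p" "y = f p b" by blast
    show "k p (x \<oplus>\<^bsub>space_at R p\<^esub> y) = k p x \<oplus>\<^bsub>space_at R' p\<^esub> k p y"
      using kf[OF S.U_add[OF a(1) b(1)]] kf[OF a(1)] kf[OF b(1)] a b SU' by (simp add: f_add S.f_add)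
  qed
  then show ?thesis by blast
qed

lemma homogeneous_preimage_proj:
  assumes "homogeneous A e V" "decomp K M A e" "homogeneous A e U"
    and "a \<in> A" "x \<in> U p" "y \<in> U p" "f p x = f p y"
  shows "f p (e a p x) = f p (e a p y)"
proof -
  interpret D: decomp K M A e by fact
  have U: "e a p x \<in> U p" "e a p y \<in> U p" using assms unfolding homogeneous_def by blast+
  have "x \<ominus>\<^bsub>space_at M p\<^esub> y \<in> V p" using assms f_eq_iff by blast
  then have "e a p (x \<ominus>\<^bsub>space_at M p\<^esub> y) \<in> V p" using assms unfolding homogeneous_def by blast
  then have "e a p x \<ominus>\<^bsub>space_at M p\<^esub> e a p y \<in> V p"
    using D.proj_minus[OF assms(4)] U_car assms(5,6) by simp
  then show ?thesis using f_eq_iff[OF U] by simp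
qed

text \<open>A projection preserves \<open>U\<close> and \<open>V\<close>, so it acts on the quotient.\<close>

lemma push_decomp:
  assumes "decomp K M A e" and hU: "homogeneous A e U" and hV: "homogeneous A e V"
  obtains e' where "decomp K R A e'" "\<And>a p x. a \<in> A \<Longrightarrow> x \<in> U p \<Longrightarrow> e' a p (f p x) = f p (e a p x)"
proof -
  interpret D: decomp K M A e by fact
  define e' where "e' a p y = f p (e a p (SOME x. x \<in> U p \<and> f p x = y))" for a p y
  have e': "e' a p (f p x) = f p (e a p x)" if a: "a \<in> A" and x: "x \<in> U p" for a p x
  proof -
    let ?x = "SOME z. z \<in> U p \<and> f p z = f p x"
    have z: "?x \<in> U p \<and> f p ?x = f p x" by (rule someI[of _ x]) (use x in simp)
    then show ?thesis unfolding e'_def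
      using homogeneous_preimage_proj[OF hV assms(1) hU a _ x] by blast
  qed
  have eU: "e a p x \<in> U p" if "a \<in> A" "x \<in> U p" for a p x
    using hU that unfolding homogeneous_def by blast
  have "decomp K R A e'"
  proof (intro decomp.intro decomp_axioms.intro R.pmodule_axioms)
    fix a assume a: "a \<in> A"
    show "pmodule_hom K R R (e' a)"
    proof (rule pmodule_homI[OF R.pmodule_axioms R.pmodule_axioms])
      fix p y assume "y \<in> car R p"
      then obtain x where x: "x \<in> U p" "f p x = y" using f_ex by blast
      then show "e' a p y \<in> car R p" using e'[OF a x(1)] f_closed eU[OF a] by simp
      show "e' a p (k \<odot>\<^bsub>space_at R p\<^esub> y) = k \<odot>\<^bsub>space_at R p\<^esub> e' a p y" if "k \<in> carrier K" for k
        using e'[OF a x(1)] e'[OF a U_smult[OF that x(1)]] x that eU[OF a x(1)] U_car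
        by (simp add: f_smult D.proj_smult[OF a])
      show "e' a q (map_at R p q y) = map_at R p q (e' a p y)" if "p \<le> q" for q
        using e'[OF a x(1)] e'[OF a U_map[OF that x(1)]] x that eU[OF a x(1)] U_car
        by (simp add: f_natural D.proj_natural[OF a])
      fix z assume "z \<in> car R p"
      then obtain w where w: "w \<in> U p" "f p w = z" using f_ex by blast
      show "e' a p (y \<oplus>\<^bsub>space_at R p\<^esub> z) = e' a p y \<oplus>\<^bsub>space_at R p\<^esub> e' a p z"
        using e'[OF a x(1)] e'[OF a w(1)] e'[OF a U_add[OF x(1) w(1)]] x w
          eU[OF a x(1)] eU[OF a w(1)] U_car
        by (simp add: f_add D.proj_add[OF a])
    qed
    fix y p assume "y \<in> car R p"
    then obtain x where x: "x \<in> U p" "f p x = y" using f_ex by blast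
    show "e' a p (e' a p y) = e' a p y"
      using e'[OF a x(1)] e'[OF a eU[OF a x(1)]] x U_car by (simp add: D.proj_idem[OF a])
    fix b assume b: "b \<in> A" "b \<noteq> a"
    show "e' b p (e' a p y) = zer R p"
      using e'[OF a x(1)] e'[OF b(1) eU[OF a x(1)]] x U_car b(2) f_zero
      by (simp add: D.proj_orth[OF b(1) a])
  next
    fix y p assume "y \<in> car R p"
    then obtain x where x: "x \<in> U p" "f p x = y" using f_ex by blast
    have "{a \<in> A. e' a p y \<noteq> zer R p} \<subseteq> {a \<in> A. e a p x \<noteq> zer M p}"
      using e'[OF _ x(1)] x(2) f_zero by auto
    then show "finite {a \<in> A. e' a p y \<noteq> zer R p}"
      using D.proj_fin[OF U_car[OF x(1)]] finite_subset by blast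
  next
    fix y p assume "y \<in> car R p" and 0: "\<And>a. a \<in> A \<Longrightarrow> e' a p y = zer R p"
    then obtain x where x: "x \<in> U p" "f p x = y" using f_ex by blast
    have "e a p x \<in> V p" if "a \<in> A" for a
      using 0[OF that] e'[OF that x(1)] x f_ker[OF eU[OF that x(1)]] by simp
    then have "x \<in> V p" by (rule D.homogeneous_memI[OF subV U_car[OF x(1)]])
    then show "y = zer R p" using x f_ker by blast
  qed
  then show ?thesis using that e' by blast
qed

lemma push_thin_decomp:
  assumes "thin_decomp K M A e" and hU: "homogeneous A e U" and hV: "homogeneous A e V"
  obtains e' where "thin_decomp K R A e'"
    "\<And>a p x. a \<in> A \<Longrightarrow> x \<in> U p \<Longrightarrow> e' a p (f p x) = f p (e a p x)"
proof -
  interpret T: thin_decomp K M A e by fact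
  obtain e' where D: "decomp K R A e'"
    and e': "\<And>a p x. a \<in> A \<Longrightarrow> x \<in> U p \<Longrightarrow> e' a p (f p x) = f p (e a p x)"
    using push_decomp[OF T.decomp_axioms hU hV] by blast
  have eU: "e a p x \<in> U p" if "a \<in> A" "x \<in> U p" for a p x
    using hU that unfolding homogeneous_def by blast
  have "thin_decomp K R A e'"
  proof (intro thin_decomp.intro locally_finite_decomp.intro D
      locally_finite_decomp_axioms.intro thin_decomp_axioms.intro)
    fix p
    have "{a \<in> A. \<exists>y\<in>car R p. e' a p y \<noteq> zer R p} \<subseteq> {a \<in> A. \<exists>x\<in>car M p. e a p x \<noteq> zer M p}"
    proof
      fix a assume "a \<in> {a \<in> A. \<exists>y\<in>car R p. e' a p y \<noteq> zer R p}"
      then obtain y where a: "a \<in> A" and y: "y \<in> car R p" "e' a p y \<noteq> zer R p" by blast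
      obtain x where x: "x \<in> U p" "f p x = y" using f_ex y by blast
      then have "e a p x \<noteq> zer M p" using e'[OF a x(1)] y f_zero by auto
      then show "a \<in> {a \<in> A. \<exists>x\<in>car M p. e a p x \<noteq> zer M p}" using a U_car[OF x(1)] by blast
    qed
    then show "finite {a \<in> A. \<exists>y\<in>car R p. e' a p y \<noteq> zer R p}"
      using T.support_finite finite_subset by blast
  next
    fix a y p z assume a: "a \<in> A" and yz: "y \<in> car R p" "z \<in> car R p" and nz: "e' a p y \<noteq> zer R p"
    obtain x w where x: "x \<in> U p" "f p x = y" and w: "w \<in> U p" "f p w = z" using f_ex yz by blast
    have "e a p x \<noteq> zer M p" using e'[OF a x(1)] nz x(2) f_zero by auto
    then obtain k where k: "k \<in> carrier K" "e a p w = k \<odot>\<^bsub>space_at M p\<^esub> e a p x"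
      using T.thin[OF a U_car[OF x(1)] U_car[OF w(1)]] by blast
    then have "e' a p z = k \<odot>\<^bsub>space_at R p\<^esub> e' a p y"
      using e'[OF a x(1)] e'[OF a w(1)] x w eU[OF a x(1)] by (simp add: f_smult)
    then show "\<exists>k\<in>carrier K. e' a p z = k \<odot>\<^bsub>space_at R p\<^esub> e' a p y" using k by blast
  qed
  then show ?thesis using that e' by blast
qed

end

text \<open>In this form, pulling back a subquotient along an automorphism is an instance of composing
  subquotients.\<close>

lemma automorphism_subquotient:
  assumes \<theta>: "pmodule_hom K M M \<theta>" and bij: "\<And>p. bij_betw (\<theta> p) (car M p) (car M p)"
  shows "subquotient K M (car M) (\<lambda>p. {zer M p}) M \<theta>"
proof -
  interpret \<theta>: pmodule_hom K M M \<theta> by fact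
  show ?thesis
  proof (intro subquotient.intro subquotient_axioms.intro \<theta>.M.pmodule_axioms)
    show "\<theta> p ` car M p = car M p" for p using bij by (simp add: bij_betw_def)
    show "\<theta> p x = zer M p \<longleftrightarrow> x \<in> {zer M p}" if "x \<in> car M p" for p x
      using inj_onD[OF bij_betw_imp_inj_on[OF bij] _ that \<theta>.M.V.M.zero_closed] by auto
  qed (auto simp: subpmodule_iff[OF \<theta>.M.pmodule_axioms] \<theta>.hom_add \<theta>.hom_smult \<theta>.natural)
qed

text \<open>The transition map into \<open>p\<close> over distance $\epsilon+\delta$ factors as one over distance $\epsilon$, whose image lies in \<open>U\<close>,
  followed by one over distance $\delta$, which \<open>f\<close> carries into \<open>U1\<close>. For the kernels the order is reversed.\<close>

lemma compose_nbhd: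
  assumes "poset_flow P" and \<epsilon>: "0 \<le> \<epsilon>" and \<delta>: "0 \<le> \<delta>"
    and "subquotient K M U V R f" and UV: "nbhd P \<epsilon> M U V"
    and "subquotient K R U1 V1 R' k" and UV1: "nbhd P \<delta> R U1 V1"
  shows "nbhd P (\<epsilon> + \<delta>) M (\<lambda>p. {x \<in> U p. f p x \<in> U1 p}) (\<lambda>p. {x \<in> U p. f p x \<in> V1 p})"
proof -
  interpret P: poset_flow P by fact
  interpret F: subquotient K M U V R f by fact
  interpret G: subquotient K R U1 V1 R' k by fact
  note UV = UV[unfolded P.nbhd_iff] and UV1 = UV1[unfolded P.nbhd_iff]
  show ?thesis
    unfolding P.nbhd_iff
  proof (intro conjI allI ballI)
    fix p z assume z: "z \<in> car M (P (- (\<epsilon> + \<delta>)) p)"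
    let ?q = "P (- \<delta>) p"
    have q: "P (- (\<epsilon> + \<delta>)) p = P (- \<epsilon>) ?q"
      using P.flow_add[of "- \<epsilon>" "- \<delta>"] by simp
    have le: "P (- \<epsilon>) ?q \<le> ?q" "?q \<le> p" using P.flow_le \<epsilon> \<delta> by auto
    define w where "w = map_at M (P (- \<epsilon>) ?q) ?q z"
    have w: "w \<in> U ?q" using UV z unfolding q w_def by blast
    have eq: "map_at M (P (- (\<epsilon> + \<delta>)) p) p z = map_at M ?q p w"
      unfolding q w_def using F.M.map_comp[OF le] z q by simp
    have "f p (map_at M ?q p w) = map_at R ?q p (f ?q w)" using F.f_natural[OF le(2) w] .
    moreover have "map_at R ?q p (f ?q w) \<in> U1 p" using UV1 F.f_closed[OF w] by blast
    ultimately show "map_at M (P (- (\<epsilon> + \<delta>)) p) p z \<in> {x \<in> U p. f p x \<in> U1 p}"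
      unfolding eq using F.U_map[OF le(2) w] by simp
  next
    fix p x assume x: "x \<in> {x \<in> U p. f p x \<in> V1 p}"
    then show "x \<in> car M p" using F.U_car by blast
    let ?q = "P \<delta> p"
    have q: "P (\<epsilon> + \<delta>) p = P \<epsilon> ?q" using P.flow_add[of \<epsilon> \<delta>] by simp
    have le: "p \<le> ?q" "?q \<le> P \<epsilon> ?q" using P.flow_ge \<epsilon> \<delta> by auto
    have "f ?q (map_at M p ?q x) = zer R ?q" using x UV1 F.f_natural[OF le(1)] by simp
    then have "map_at M p ?q x \<in> V ?q" using F.f_ker F.U_map[OF le(1)] x by blast
    then have "map_at M ?q (P \<epsilon> ?q) (map_at M p ?q x) = zer M (P \<epsilon> ?q)" using UV by blast
    then show "map_at M p (P (\<epsilon> + \<delta>) p) x = zer M (P (\<epsilon> + \<delta>) p)"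
      unfolding q using F.M.map_comp[OF le F.U_car] x by simp
  qed
qed

lemma automorphism_nbhd:
  assumes P: "poset_flow P" and \<epsilon>: "0 \<le> \<epsilon>" and \<theta>: "pmodule_hom K M M \<theta>"
    and bij: "\<And>p. bij_betw (\<theta> p) (car M p) (car M p)"
    and sub: "subquotient K M U V R f" and near: "nbhd P \<epsilon> M U V"
  shows "nbhd P \<epsilon> M (\<lambda>p. {x \<in> car M p. \<theta> p x \<in> U p}) (\<lambda>p. {x \<in> car M p. \<theta> p x \<in> V p})"
proof -
  interpret P: poset_flow P by fact
  interpret \<theta>: pmodule_hom K M M \<theta> by fact
  have "nbhd P 0 M (car M) (\<lambda>p. {zer M p})"
    unfolding P.nbhd_iff by (simp add: P.flow_zero)
  from compose_nbhd[OF P order_refl \<epsilon> automorphism_subquotient[OF \<theta> bij] this sub near]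
  show ?thesis by simp
qed

text \<open>Let \<open>\<theta>\<close> map each brick \<open>a\<close> into the summand \<open>j a\<close>. If two bricks went to the same summand, the idempotent
  $\theta e_a \theta^{-1}$ would be neither zero nor the identity on this indecomposable summand. So \<open>j\<close> is injective,
  which gives $\theta e_a = \pi_{j a} \theta$ for the projections $\pi$ of \<open>M\<close>, and preimages under \<open>\<theta>\<close> of homogeneous submodules are
  homogeneous for the bricks.\<close>

lemma (in summands) transfer_from_indecomposables:
  assumes "poset_flow P" and \<epsilon>: "0 \<le> \<epsilon>"
    and "brick_decomp K M B e" and ind: "\<And>i. i \<in> I \<Longrightarrow> indecomposable K (S i)"
    and sub: "subquotient K M U V R f" and hU: "homogeneous I proj U" and hV: "homogeneous I proj V"
    and near: "nbhd P \<epsilon> M U V"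
  obtains U' V' f' where "subquotient K M U' V' R f'" "homogeneous B e U'" "homogeneous B e V'"
    "nbhd P \<epsilon> M U' V'"
proof -
  interpret P: poset_flow P by fact
  interpret B: brick_decomp K M B e by fact
  interpret D: decomp K M I proj by (rule decomp_proj)
  obtain \<theta> j where \<theta>: "pmodule_hom K M M \<theta>" and bij: "\<And>p. bij_betw (\<theta> p) (car M p) (car M p)"
    and jI: "\<And>a. a \<in> B \<Longrightarrow> j a \<in> I"
    and \<theta>e: "\<And>a p x. a \<in> B \<Longrightarrow> x \<in> car M p \<Longrightarrow> \<theta> p (e a p x) = proj (j a) p (e a p x)"
    using B.exchange[OF decomp_proj] by blast
  interpret \<theta>: pmodule_hom K M M \<theta> by fact
  note inv = pmodule_hom_inverse[OF \<theta> bij]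
  define \<eta> where "\<eta> p = inv_into (car M p) (\<theta> p)" for p
  note inv = inv[folded \<eta>_def]
  have proj_\<theta>e: "proj i p (\<theta> p (e a p x)) = (if i = j a then \<theta> p (e a p x) else zer M p)"
    if "i \<in> I" "a \<in> B" "x \<in> car M p" for i a p x
    using that \<theta>e D.proj_idem[OF jI] D.proj_orth[OF _ jI] by simp
  have inj: "a = b" if a: "a \<in> B" and b: "b \<in> B" and ab: "j a = j b" for a b
  proof (rule ccontr)
    assume ne: "a \<noteq> b"
    \<comment> \<open>The projection to the image of the brick \<open>a\<close>.\<close>
    define \<kappa> where "\<kappa> p x = \<theta> p (e a p (\<eta> p x))" for p x
    have \<kappa>\<theta>: "\<kappa> p (\<theta> p x) = \<theta> p (e a p x)" if "x \<in> car M p" for p x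
      using inv(2)[OF that] by (simp add: \<kappa>_def)
    have \<kappa>: "pmodule_hom K M M \<kappa>"
      unfolding \<kappa>_def[abs_def]
      by (rule pmodule_hom_comp[OF pmodule_hom_comp[OF inv(1) B.proj_hom[OF a]] \<theta>])
    have "\<kappa> p (proj (j a) p x) = \<kappa> p x" if x: "x \<in> car M p" for p x
    proof -
      have "\<kappa> p (proj (j a) p (\<theta> p (\<eta> p x))) = \<kappa> p (\<theta> p (\<eta> p x))"
      proof (rule B.hom_eqI[OF pmodule_hom_comp[OF pmodule_hom_comp[OF \<theta> D.proj_hom[OF jI[OF a]]] \<kappa>]
            pmodule_hom_comp[OF \<theta> \<kappa>] inv(4)[OF x]])
        fix c assume c: "c \<in> B"
        have y: "\<eta> p x \<in> car M p" by (rule inv(4)[OF x])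
        show "\<kappa> p (proj (j a) p (\<theta> p (e c p (\<eta> p x)))) = \<kappa> p (\<theta> p (e c p (\<eta> p x)))"
          using proj_\<theta>e[OF jI[OF a] c y] \<kappa>\<theta>[of "e c p (\<eta> p x)" p] B.proj_orth[OF a c _ y]
            pmodule_hom.hom_zero[OF \<kappa>] c y by (cases "c = a") auto
      qed
      then show ?thesis using inv(3)[OF x] by simp
    qed
    moreover have "proj (j a) p (\<kappa> p x) = \<kappa> p x" if "x \<in> car M p" for p x
      using proj_\<theta>e[OF jI[OF a] a inv(4)[OF that]] by (simp add: \<kappa>_def)
    moreover have "\<kappa> p (\<kappa> p x) = \<kappa> p x" if x: "x \<in> car M p" for p x
      using \<kappa>\<theta>[of "e a p (\<eta> p x)" p] B.proj_idem[OF a inv(4)[OF x]] a inv(4)[OF x]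
      by (simp add: \<kappa>_def)
    ultimately consider "\<forall>p. \<forall>x\<in>car M p. \<kappa> p x = zer M p" | "\<forall>p. \<forall>x\<in>car M p. \<kappa> p x = proj (j a) p x"
      using proj_primitive[OF jI[OF a] ind[OF jI[OF a]] \<kappa>] by blast
    then show False
    proof cases
      case 1
      obtain p x where x: "x \<in> car M p" "e a p x \<noteq> zer M p"
        using B.supp_nonempty[OF a] unfolding B.supp_def by blast
      have "\<theta> p (e a p x) = zer M p" using 1 x(1) by (simp flip: \<kappa>\<theta>[OF x(1)])
      then have "\<theta> p (e a p x) = \<theta> p (zer M p)" by simp
      then show False
        using x a inj_onD[OF bij_betw_imp_inj_on[OF bij]] by (metis B.proj_closed V.M.zero_closed)
    next
      case 2
      obtain p x where x: "x \<in> car M p" "e b p x \<noteq> zer M p"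
        using B.supp_nonempty[OF b] unfolding B.supp_def by blast
      have "\<theta> p (e b p x) = proj (j a) p (\<theta> p (e b p x))"
        using proj_\<theta>e[OF jI[OF a] b x(1)] ab by simp
      also have "\<dots> = \<theta> p (e a p (e b p x))" using 2 \<kappa>\<theta>[of "e b p x" p] x b by simp
      also have "\<dots> = \<theta> p (zer M p)" using B.proj_orth[OF a b ne x(1)] by simp
      finally show False
        using x b inj_onD[OF bij_betw_imp_inj_on[OF bij]] by (metis B.proj_closed V.M.zero_closed)
    qed
  qed
  have comm: "\<theta> p (e a p x) = proj (j a) p (\<theta> p x)" if a: "a \<in> B" and x: "x \<in> car M p" for a p x
  proof (rule B.hom_eqI[OF pmodule_hom_comp[OF B.proj_hom[OF a] \<theta>]
        pmodule_hom_comp[OF \<theta> D.proj_hom[OF jI[OF a]]] x])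
    fix c assume c: "c \<in> B"
    show "\<theta> p (e a p (e c p x)) = proj (j a) p (\<theta> p (e c p x))"
      using proj_\<theta>e[OF jI[OF a] c x] B.proj_orth[OF a c _ x] B.proj_idem[OF a x] inj[OF a c]
      by (cases "c = a") auto
  qed
  have hom: "homogeneous B e (\<lambda>p. {x \<in> car M p. \<theta> p x \<in> W p})" if "homogeneous I proj W" for W
    using that comm jI unfolding homogeneous_def by simp
  show ?thesis
    by (rule that[OF subquotient.compose[OF automorphism_subquotient[OF \<theta> bij] sub]
          hom[OF hU] hom[OF hV] automorphism_nbhd[OF assms(1) \<epsilon> \<theta> bij sub near]])
qed

text \<open>Apply \<open>exchange\<close> to the bricks of the thin decomposition. The image under \<open>\<theta>\<close> of a submodule that is homogeneous for
  them is homogeneous for \<open>\<pi>\<close>, because \<open>\<theta>\<close> sends each brick component into one summand of \<open>\<pi>\<close>.\<close>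

lemma transfer_from_thin:
  fixes R :: "('p::order, 'k, 'v) pmod" and A :: "'a set"
  assumes "poset_flow P" and \<delta>: "0 \<le> \<delta>"
    and "thin_decomp K R A e" and \<pi>: "decomp K R J \<pi>"
    and sub: "subquotient K R U V R' k" and hU: "homogeneous A e U" and hV: "homogeneous A e V"
    and near: "nbhd P \<delta> R U V"
  obtains U' V' k' where "subquotient K R U' V' R' k'" "homogeneous J \<pi> U'" "homogeneous J \<pi> V'"
    "nbhd P \<delta> R U' V'"
proof -
  interpret P: poset_flow P by fact
  interpret T: thin_decomp K R A e by fact
  interpret S: subquotient K R U V R' k by fact
  interpret D: decomp K R J \<pi> by fact
  obtain B :: "('a \<times> 'p set) set" and f where "brick_decomp K R B f"
    and fe: "\<And>b. b \<in> B \<Longrightarrow> \<exists>a\<in>A. \<forall>p. \<forall>x\<in>car R p. f b p x = e a p x \<or> f b p x = zer R p"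
    by (rule T.refine_to_bricks, rule that)
  interpret B: brick_decomp K R B f by fact
  obtain \<theta> j where \<theta>: "pmodule_hom K R R \<theta>" and bij: "\<And>p. bij_betw (\<theta> p) (car R p) (car R p)"
    and jJ: "\<And>b. b \<in> B \<Longrightarrow> j b \<in> J"
    and \<theta>f: "\<And>b p x. b \<in> B \<Longrightarrow> x \<in> car R p \<Longrightarrow> \<theta> p (f b p x) = \<pi> (j b) p (f b p x)"
    using B.exchange[OF \<pi>] by blast
  interpret \<theta>: pmodule_hom K R R \<theta> by fact
  define \<eta> where "\<eta> p = inv_into (car R p) (\<theta> p)" for p
  note inv = pmodule_hom_inverse[OF \<theta> bij, folded \<eta>_def]
  interpret \<eta>: pmodule_hom K R R \<eta> by (rule inv(1))
  have hom: "homogeneous J \<pi> (\<lambda>p. {y \<in> car R p. \<eta> p y \<in> W p})"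
    if W: "subpmodule K W R" and hW: "homogeneous A e W" for W
    unfolding homogeneous_def
  proof (intro ballI allI)
    fix i p y assume i: "i \<in> J" and "y \<in> {y \<in> car R p. \<eta> p y \<in> W p}"
    then have y: "y \<in> car R p" "\<eta> p y \<in> W p" by auto
    note W' = W[unfolded subpmodule_iff[OF T.pmodule_axioms]]
    let ?x = "\<eta> p y"
    have x: "?x \<in> car R p" using y by simp
    have "\<eta> p (\<pi> i p (\<theta> p ?x)) \<in> W p"
      using x
    proof (induction rule: B.decomp_induct)
      case zero
      then show ?case using i W' by simp
    next
      case (add y z)
      then show ?case using i W' by (simp add: \<theta>.hom_add D.proj_add \<eta>.hom_add)
    next
      case (proj b)
      have "f b p ?x \<in> W p"
        using fe[OF proj] hW x y(2) W' unfolding homogeneous_def by metis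
      moreover have "\<pi> i p (\<theta> p (f b p ?x)) = (if i = j b then \<theta> p (f b p ?x) else zer R p)"
        using \<theta>f[OF proj x] D.proj_idem[OF jJ[OF proj]] D.proj_orth[OF i jJ[OF proj]]
          B.proj_closed[OF proj x] by simp
      ultimately show ?case using inv(2)[OF B.proj_closed[OF proj x]] W' by simp
    qed
    then show "\<pi> i p y \<in> {y \<in> car R p. \<eta> p y \<in> W p}" using y i inv(3) by simp
  qed
  show ?thesis
    by (rule that[OF subquotient.compose[OF automorphism_subquotient[OF inv(1,5)] sub]
          hom[OF S.subU hU] hom[OF S.subV hV] automorphism_nbhd[OF assms(1) \<delta> inv(1,5) sub near]])
qed

text \<open>The decomposition of \<open>M\<close> descends to its refinement \<open>R\<close>. After \<open>transfer_from_thin\<close> the subquotient of \<open>R\<close> is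
  homogeneous for it, and so is its preimage in \<open>M\<close>.\<close>

lemma extend_refinement:
  fixes M :: "('p::order, 'k, 'v) pmod"
  assumes P: "poset_flow P" and \<epsilon>: "0 \<le> \<epsilon>" and \<delta>: "0 \<le> \<delta>"
    and M: "pmodule K M" and ref: "refinement K P \<epsilon> M R"
    and thin: "thin_decomp K R A e"
    and sub: "subquotient K R U1 V1 R' k" and hU: "homogeneous A e U1" and hV: "homogeneous A e V1"
    and near: "nbhd P \<delta> R U1 V1"
  shows "refinement K P (\<epsilon> + \<delta>) M R'"
proof -
  obtain I :: "('p \<times> nat) set" and S :: "'p \<times> nat \<Rightarrow> ('p, 'k, 'v) pmod"
      and N' :: "'p \<times> nat \<Rightarrow> ('p, 'k, 'v set) pmod" where dec: "decomposition K M I S"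
    and N': "(\<forall>i\<in>I. N' i \<in> EN K P \<epsilon> (S i)) \<and> pmodule_iso K R (dsum_pmodule I N')"
    using ref unfolding refinement_def by blast
  obtain \<phi> where "summands K M I S \<phi>" using decomposition_summands[OF M dec] by blast
  then interpret M: summands K M I S \<phi> .
  obtain U V f where f: "subquotient K M U V R f" and h: "homogeneous I M.proj U" "homogeneous I M.proj V"
    and UV: "nbhd P \<epsilon> M U V"
    using M.EN_family_iff[OF P \<epsilon>, of R] N' by blast
  interpret F: subquotient K M U V R f by fact
  obtain \<pi> where \<pi>: "decomp K R I \<pi>"
    and \<pi>f: "\<And>i p x. i \<in> I \<Longrightarrow> x \<in> U p \<Longrightarrow> \<pi> i p (f p x) = f p (M.proj i p x)"
    using F.push_decomp[OF M.decomp_proj h] by blast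
  obtain U' V' k' where k': "subquotient K R U' V' R' k'"
    and h': "homogeneous I \<pi> U'" "homogeneous I \<pi> V'" and UV': "nbhd P \<delta> R U' V'"
    using transfer_from_thin[OF P \<delta> thin \<pi> sub hU hV near] by blast
  have hom: "homogeneous I M.proj (\<lambda>p. {x \<in> U p. f p x \<in> W p})" if "homogeneous I \<pi> W" for W
    using h(1) that \<pi>f unfolding homogeneous_def by (simp flip: \<pi>f)
  have "\<exists>N :: 'p \<times> nat \<Rightarrow> ('p, 'k, 'v set) pmod. (\<forall>i\<in>I. N i \<in> EN K P (\<epsilon> + \<delta>) (S i)) \<and> pmodule_iso K R' (dsum_pmodule I N)"
    unfolding M.EN_family_iff[OF P add_nonneg_nonneg[OF \<epsilon> \<delta>], of R']
    using F.compose[OF k'] hom[OF h'(1)] hom[OF h'(2)] compose_nbhd[OF P \<epsilon> \<delta> f UV k' UV'] by blast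
  then show ?thesis unfolding refinement_def using dec by blast
qed

text \<open>The set \<open>T\<close> plays the part of $S \cap (V + V')$. It is closed under addition because on a line a nonzero
  element of \<open>V\<close> or \<open>V'\<close> generates all of it. The image of \<open>T\<close> in \<open>R\<close>, which is \<open>U/V\<close>, satisfies the kernel condition since
  components in \<open>V\<close> vanish there and components in \<open>V'\<close> die after a shift by $\delta$.\<close>

lemma common_subquotient:
  assumes P: "poset_flow P" and "thin_decomp K N A e"
    and "subquotient K N U V R f" and hU: "homogeneous A e U" and hV: "homogeneous A e V"
    and UV: "nbhd P \<epsilon> N U V" and \<epsilon>: "0 \<le> \<epsilon>"
    and "subquotient K N U' V' R' f'" and hU': "homogeneous A e U'" and hV': "homogeneous A e V'"
    and UV': "nbhd P \<delta> N U' V'" and \<delta>: "0 \<le> \<delta>"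
  defines "S \<equiv> \<lambda>p. U p \<inter> U' p" and "T \<equiv> \<lambda>p. {x \<in> U p \<inter> U' p. \<forall>a\<in>A. e a p x \<in> V p \<union> V' p}"
  shows "subpmodule K S N" "subpmodule K T N" "\<And>p. T p \<subseteq> S p" "homogeneous A e S" "homogeneous A e T"
    "\<And>p. S p \<inter> V p \<subseteq> T p" "\<And>p. S p \<inter> V' p \<subseteq> T p"
    "nbhd P \<delta> R (\<lambda>p. f p ` S p) (\<lambda>p. f p ` T p)"
proof -
  interpret P: poset_flow P by fact
  interpret D: thin_decomp K N A e by fact
  interpret F: subquotient K N U V R f by fact
  interpret F': subquotient K N U' V' R' f' by fact
  have eU: "e a p x \<in> U p" if "a \<in> A" "x \<in> U p" for a p x using hU that unfolding homogeneous_def by blast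
  have eV: "e a p x \<in> V p" if "a \<in> A" "x \<in> V p" for a p x using hV that unfolding homogeneous_def by blast
  have eU': "e a p x \<in> U' p" if "a \<in> A" "x \<in> U' p" for a p x using hU' that unfolding homogeneous_def by blast
  have eV': "e a p x \<in> V' p" if "a \<in> A" "x \<in> V' p" for a p x using hV' that unfolding homogeneous_def by blast
  have V: "zer N p \<in> V p" "x \<in> V p \<Longrightarrow> y \<in> V p \<Longrightarrow> x \<oplus>\<^bsub>space_at N p\<^esub> y \<in> V p"
    "k \<in> carrier K \<Longrightarrow> x \<in> V p \<Longrightarrow> k \<odot>\<^bsub>space_at N p\<^esub> x \<in> V p"
    "p \<le> q \<Longrightarrow> x \<in> V p \<Longrightarrow> map_at N p q x \<in> V q" for p q x y k
    using F.V_rules by blast+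
  have V': "zer N p \<in> V' p" "x \<in> V' p \<Longrightarrow> y \<in> V' p \<Longrightarrow> x \<oplus>\<^bsub>space_at N p\<^esub> y \<in> V' p"
    "k \<in> carrier K \<Longrightarrow> x \<in> V' p \<Longrightarrow> k \<odot>\<^bsub>space_at N p\<^esub> x \<in> V' p"
    "p \<le> q \<Longrightarrow> x \<in> V' p \<Longrightarrow> map_at N p q x \<in> V' q" for p q x y k
    using F'.V_rules by blast+
  show S: "subpmodule K S N"
    unfolding subpmodule_iff[OF D.pmodule_axioms] S_def
    by (simp add: subset_iff F.U_car F.U_add F.U_smult F.U_zero F.U_map
        F'.U_add F'.U_smult F'.U_zero F'.U_map)
  have line: "e a p y \<in> W"
    if W: "\<And>k x. k \<in> carrier K \<Longrightarrow> x \<in> W \<Longrightarrow> k \<odot>\<^bsub>space_at N p\<^esub> x \<in> W"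
      and a: "a \<in> A" and xy: "x \<in> car N p" "y \<in> car N p" and x: "e a p x \<in> W" "e a p x \<noteq> zer N p"
    for W  and a p x y
  proof -
    obtain k where "k \<in> carrier K" "e a p y = k \<odot>\<^bsub>space_at N p\<^esub> e a p x"
      using D.thin[OF a xy x(2)] by blast
    then show ?thesis using W[OF _ x(1)] by simp
  qed
  have add: "e a p (x \<oplus>\<^bsub>space_at N p\<^esub> y) \<in> V p \<union> V' p"
    if a: "a \<in> A" and xy: "x \<in> car N p" "y \<in> car N p"
      and mem: "e a p x \<in> V p \<union> V' p" "e a p y \<in> V p \<union> V' p" for a p x y
  proof (cases "e a p x = zer N p")
    case True
    then show ?thesis using mem(2) a xy by (simp add: D.proj_add)
  next
    case False
    show ?thesis
    proof (cases "e a p x \<in> V p")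
      case True
      have "e a p y \<in> V p" by (rule line[OF V(3) a xy True False])
      then show ?thesis using V(2)[OF True] a xy by (simp add: D.proj_add)
    next
      case nV: False
      then have x: "e a p x \<in> V' p" using mem(1) by blast
      have "e a p y \<in> V' p" by (rule line[OF V'(3) a xy x False])
      then show ?thesis using V'(2)[OF x] a xy by (simp add: D.proj_add)
    qed
  qed
  show "subpmodule K T N"
    unfolding subpmodule_iff[OF D.pmodule_axioms]
  proof (intro conjI allI ballI impI)
    show "T p \<subseteq> car N p" for p using F.U_car by (auto simp: T_def)
    show "zer N p \<in> T p" for p using F.U_zero F'.U_zero V(1) by (simp add: T_def)
    fix p x assume "x \<in> T p"
    then have x: "x \<in> U p" "x \<in> U' p" "\<And>a. a \<in> A \<Longrightarrow> e a p x \<in> V p \<union> V' p" by (auto simp: T_def)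
    note xN = F.U_car[OF x(1)]
    show "k \<odot>\<^bsub>space_at N p\<^esub> x \<in> T p" if k: "k \<in> carrier K" for k
    proof -
      have "e a p (k \<odot>\<^bsub>space_at N p\<^esub> x) \<in> V p \<union> V' p" if a: "a \<in> A" for a
        using x(3)[OF a] V(3)[OF k] V'(3)[OF k] D.proj_smult[OF a k xN] by auto
      then show ?thesis using F.U_smult[OF k x(1)] F'.U_smult[OF k x(2)] by (simp add: T_def)
    qed
    show "map_at N p q x \<in> T q" if le: "p \<le> q" for q
    proof -
      have "e a q (map_at N p q x) \<in> V q \<union> V' q" if a: "a \<in> A" for a
        using x(3)[OF a] V(4)[OF le] V'(4)[OF le] D.proj_natural[OF a le xN] by auto
      then show ?thesis using F.U_map[OF le x(1)] F'.U_map[OF le x(2)] by (simp add: T_def)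
    qed
    fix y assume "y \<in> T p"
    then have y: "y \<in> U p" "y \<in> U' p" "\<And>a. a \<in> A \<Longrightarrow> e a p y \<in> V p \<union> V' p" by (auto simp: T_def)
    have "e a p (x \<oplus>\<^bsub>space_at N p\<^esub> y) \<in> V p \<union> V' p" if a: "a \<in> A" for a
      by (rule add[OF a xN F.U_car[OF y(1)] x(3)[OF a] y(3)[OF a]])
    then show "x \<oplus>\<^bsub>space_at N p\<^esub> y \<in> T p"
      using F.U_add[OF x(1) y(1)] F'.U_add[OF x(2) y(2)] by (simp add: T_def)
  qed
  show "T p \<subseteq> S p" for p by (auto simp: S_def T_def)
  show "homogeneous A e S" unfolding homogeneous_def S_def using eU eU' by blast
  show "homogeneous A e T"
    unfolding homogeneous_def
  proof (intro ballI allI)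
    fix a p x assume a: "a \<in> A" and "x \<in> T p"
    then have x: "x \<in> U p" "x \<in> U' p" "e a p x \<in> V p \<union> V' p" by (auto simp: T_def)
    have "e b p (e a p x) \<in> V p \<union> V' p" if b: "b \<in> A" for b
      using x(3) D.proj_idem[OF a F.U_car[OF x(1)]] D.proj_orth[OF b a _ F.U_car[OF x(1)]] V(1)
      by (cases "b = a") auto
    then show "e a p x \<in> T p" using eU[OF a x(1)] eU'[OF a x(2)] by (simp add: T_def)
  qed
  show "S p \<inter> V p \<subseteq> T p" for p using eV by (auto simp: S_def T_def)
  show "S p \<inter> V' p \<subseteq> T p" for p using eV' by (auto simp: S_def T_def)
  note near = UV'[unfolded P.nbhd_iff]
  show "nbhd P \<delta> R (\<lambda>p. f p ` S p) (\<lambda>p. f p ` T p)"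
    unfolding P.nbhd_iff
  proof (intro conjI allI ballI)
    fix p z assume z: "z \<in> car R (P (- \<delta>) p)"
    note le = P.flow_le[OF \<delta>, of p]
    obtain x where x: "x \<in> U (P (- \<delta>) p)" "f (P (- \<delta>) p) x = z" using F.f_ex[OF z] by blast
    have "map_at N (P (- \<delta>) p) p x \<in> S p"
      unfolding S_def using F.U_map[OF le x(1)] near F.U_car[OF x(1)] by blast
    moreover have "map_at R (P (- \<delta>) p) p z = f p (map_at N (P (- \<delta>) p) p x)"
      using F.f_natural[OF le x(1)] x(2) by simp
    ultimately show "map_at R (P (- \<delta>) p) p z \<in> f p ` S p" by blast
  next
    fix p y assume "y \<in> f p ` T p"
    then obtain x where xT: "x \<in> T p" and y: "y = f p x" by blast
    then have x: "x \<in> U p" "\<And>a. a \<in> A \<Longrightarrow> e a p x \<in> V p \<union> V' p" by (auto simp: T_def)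
    show "y \<in> car R p" unfolding y by (rule F.f_closed[OF x(1)])
    note le = P.flow_ge[OF \<delta>, of p]
    have "map_at N p (P \<delta> p) x \<in> V (P \<delta> p)"
    proof (rule D.homogeneous_memI[OF F.subV])
      show "map_at N p (P \<delta> p) x \<in> car N (P \<delta> p)" using F.U_car[OF x(1)] le by simp
      fix a assume a: "a \<in> A"
      have "map_at N p (P \<delta> p) (e a p x) \<in> V (P \<delta> p)"
      proof (cases "e a p x \<in> V p")
        case True
        then show ?thesis by (rule V(4)[OF le])
      next
        case False
        then have "e a p x \<in> V' p" using x(2)[OF a] by blast
        then have "map_at N p (P \<delta> p) (e a p x) = zer N (P \<delta> p)" using near by blast
        then show ?thesis using V(1) by simp
      qed
      then show "e a (P \<delta> p) (map_at N p (P \<delta> p) x) \<in> V (P \<delta> p)"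
        using D.proj_natural[OF a le F.U_car[OF x(1)]] by simp
    qed
    then show "map_at R p (P \<delta> p) y = zer R (P \<delta> p)"
      unfolding y using F.f_natural[OF le x(1)] F.f_ker[OF F.U_map[OF le x(1)]] by simp
  qed
qed

lemma homogeneous_image:
  assumes "homogeneous A e S" "\<And>p. S p \<subseteq> U p"
    and "\<And>a p x. a \<in> A \<Longrightarrow> x \<in> U p \<Longrightarrow> e' a p (f p x) = f p (e a p x)"
  shows "homogeneous A e' (\<lambda>p. f p ` S p)"
  using assms unfolding homogeneous_def by (auto simp: subset_iff)

section \<open>The triangle inequality\<close>

lemma (in summands) thin_proj:
  assumes fd: "\<And>p. V.fin_dim p" and thin: "\<And>i. i \<in> I \<Longrightarrow> pointwise_dim_le_one K (S i)"
  shows "thin_decomp K M I proj"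
proof (intro thin_decomp.intro locally_finite_decomp.intro decomp_proj
    locally_finite_decomp_axioms.intro thin_decomp_axioms.intro)
  show "finite {i \<in> I. \<exists>x\<in>car M p. proj i p x \<noteq> zer M p}" for p
    by (rule decomp.finite_support[OF decomp_proj fd])
next
  fix i x p y assume i: "i \<in> I" and xy: "x \<in> car M p" "y \<in> car M p" and nz: "proj i p x \<noteq> zer M p"
  obtain k where k: "k \<in> carrier K" "\<phi> p y i = k \<odot>\<^bsub>space_at (S i) p\<^esub> \<phi> p x i"
    using dim_le_one_multiple[OF pmodule.space[OF summand[OF i]], of p "\<phi> p x i" "\<phi> p y i"]
      thin[OF i] component_closed[OF i] xy nz proj_zero_iff[OF i xy(1)]
    unfolding pointwise_dim_le_one_def by blast
  then have "proj i p y = k \<odot>\<^bsub>space_at M p\<^esub> proj i p x"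
    unfolding proj_def k(2) using pmodule_hom.hom_smult[OF emb_hom[OF i] k(1)] component_closed[OF i xy(1)]
    by simp
  then show "\<exists>k\<in>carrier K. proj i p y = k \<odot>\<^bsub>space_at M p\<^esub> proj i p x" using k(1) by blast
qed

lemma refinement_homogeneous:
  fixes N :: "('p::order, 'k, 'v) pmod"
  assumes P: "poset_flow P" and \<epsilon>: "0 \<le> \<epsilon>" and N: "pmodule K N" and ref: "refinement K P \<epsilon> N R"
    and brick: "brick_decomp K N B e"
  obtains U V f where "subquotient K N U V R f" "homogeneous B e U" "homogeneous B e V" "nbhd P \<epsilon> N U V"
proof -
  obtain I :: "('p \<times> nat) set" and S :: "'p \<times> nat \<Rightarrow> ('p, 'k, 'v) pmod"
      and N' :: "'p \<times> nat \<Rightarrow> ('p, 'k, 'v set) pmod" where dec: "decomposition K N I S"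
    and N': "(\<forall>i\<in>I. N' i \<in> EN K P \<epsilon> (S i)) \<and> pmodule_iso K R (dsum_pmodule I N')"
    using ref unfolding refinement_def by blast
  obtain \<phi> where "summands K N I S \<phi>" using decomposition_summands[OF N dec] by blast
  then interpret N: summands K N I S \<phi> .
  obtain U V f where f: "subquotient K N U V R f" and h: "homogeneous I N.proj U" "homogeneous I N.proj V"
    and UV: "nbhd P \<epsilon> N U V"
    using N.EN_family_iff[OF P \<epsilon>, of R] N' by blast
  have ind: "indecomposable K (S i)" if "i \<in> I" for i
    using dec that by (simp add: decomposition_def)
  show ?thesis
    by (rule N.transfer_from_indecomposables[OF P \<epsilon> brick ind f h UV]) (use that in blast)+
qed

text \<open>The common refinement is \<open>S/T\<close> from \<open>common_subquotient\<close>, seen once as a subquotient of \<open>R1\<close> and once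
  of \<open>R2\<close>.\<close>

lemma refinement_triangle:
  fixes R1 R2 :: "('p::order, 'k, 'u) pmod"
  assumes P: "poset_flow P" and \<epsilon>: "0 \<le> \<epsilon>" and \<delta>: "0 \<le> \<delta>"
    and M: "pmodule K M" and N: "pmodule K N" and Q: "pmodule K Q"
    and brick: "brick_decomp K N B e"
    and refs: "refinement K P \<epsilon> M R1" "refinement K P \<epsilon> N R1"
      "refinement K P \<delta> N R2" "refinement K P \<delta> Q R2"
  shows "\<exists>R3 :: ('p, 'k, 'u) pmod. refinement K P (\<epsilon> + \<delta>) M R3 \<and> refinement K P (\<epsilon> + \<delta>) Q R3"
proof -
  interpret B: brick_decomp K N B e by fact
  note thin = B.thin_decomp_axioms
  obtain U V f where f: "subquotient K N U V R1 f" and h: "homogeneous B e U" "homogeneous B e V"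
    and UV: "nbhd P \<epsilon> N U V" by (rule refinement_homogeneous[OF P \<epsilon> N refs(2) brick])
  obtain U' V' f' where f': "subquotient K N U' V' R2 f'" and h': "homogeneous B e U'" "homogeneous B e V'"
    and UV': "nbhd P \<delta> N U' V'" by (rule refinement_homogeneous[OF P \<delta> N refs(3) brick])
  define S where "S p = U p \<inter> U' p" for p
  define T where "T p = {x \<in> U p \<inter> U' p. \<forall>a\<in>B. e a p x \<in> V p \<union> V' p}" for p
  note C = common_subquotient[OF P thin f h UV \<epsilon> f' h' UV' \<delta>, folded S_def T_def]
  have near': "nbhd P \<epsilon> R2 (\<lambda>p. f' p ` S p) (\<lambda>p. f' p ` T p)"
    using common_subquotient(8)[OF P thin f' h' UV' \<delta> f h UV \<epsilon>]
    unfolding S_def T_def by (simp only: Int_commute Un_commute simp_thms)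
  interpret F: subquotient K N U V R1 f by fact
  interpret F': subquotient K N U' V' R2 f' by fact
  let ?Q = "quot_pmodule (restrict_pmodule N S) T"
  have SU: "S p \<subseteq> U p" "S p \<subseteq> U' p" for p by (auto simp: S_def)
  note TS = C(3)
  note q = subquotient_quot[OF N C(1,2,3)]
  obtain k where k: "subquotient K R1 (\<lambda>p. f p ` S p) (\<lambda>p. f p ` T p) ?Q k"
    using F.factor[OF q SU(1) C(6)] by blast
  obtain k' where k': "subquotient K R2 (\<lambda>p. f' p ` S p) (\<lambda>p. f' p ` T p) ?Q k'"
    using F'.factor[OF q SU(2) C(7)] by blast
  obtain R3 :: "('p, 'k, 'u) pmod" and k3
    where k3: "subquotient K R1 (\<lambda>p. f p ` S p) (\<lambda>p. f p ` T p) R3 k3"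
    by (rule subquotient.transport_to_ambient_type[OF k])
  obtain g where g: "pmodule_hom K ?Q R3 g" "\<And>p. bij_betw (g p) (car ?Q p) (car R3 p)"
    using subquotient.quotient_unique[OF k k3] unfolding pmodule_iso_def by blast
  note k3' = subquotient.compose_iso[OF k' g]
  obtain e1 where e1: "thin_decomp K R1 B e1"
    "\<And>a p x. a \<in> B \<Longrightarrow> x \<in> U p \<Longrightarrow> e1 a p (f p x) = f p (e a p x)"
    using F.push_thin_decomp[OF thin h] by blast
  obtain e2 where e2: "thin_decomp K R2 B e2"
    "\<And>a p x. a \<in> B \<Longrightarrow> x \<in> U' p \<Longrightarrow> e2 a p (f' p x) = f' p (e a p x)"
    using F'.push_thin_decomp[OF thin h'] by blast
  have TU: "T p \<subseteq> U p" "T p \<subseteq> U' p" for p using SU TS by blast+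
  have hS: "homogeneous B e1 (\<lambda>p. f p ` S p)" "homogeneous B e2 (\<lambda>p. f' p ` S p)"
    by (rule homogeneous_image[where e = e, OF C(4)], fact SU, fact e1(2),
        rule homogeneous_image[where e = e, OF C(4)], fact SU, fact e2(2))
  have hT: "homogeneous B e1 (\<lambda>p. f p ` T p)" "homogeneous B e2 (\<lambda>p. f' p ` T p)"
    by (rule homogeneous_image[where e = e, OF C(5)], fact TU, fact e1(2),
        rule homogeneous_image[where e = e, OF C(5)], fact TU, fact e2(2))
  have "refinement K P (\<epsilon> + \<delta>) M R3"
    by (rule extend_refinement[OF P \<epsilon> \<delta> M refs(1) e1(1) k3 hS(1) hT(1) C(8)])
  moreover have "refinement K P (\<delta> + \<epsilon>) Q R3"
    by (rule extend_refinement[OF P \<delta> \<epsilon> Q refs(4) e2(1) k3' hS(2) hT(2) near'])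
  ultimately show ?thesis by (auto simp: add.commute)
qed

lemma ennreal_le_Inf_add_Inf:
  fixes c :: ennreal
  assumes "\<And>x y. x \<in> X \<Longrightarrow> y \<in> Y \<Longrightarrow> c \<le> x + y"
  shows "c \<le> Inf X + Inf Y"
proof (rule ennreal_le_epsilon)
  fix d :: real assume "Inf X + Inf Y < Orderings.top" and d: "0 < d"
  then have fin: "Inf X \<noteq> Orderings.top" "Inf Y \<noteq> Orderings.top"
    by (metis ennreal_add_eq_top less_irrefl)+
  have half: "a < a + ennreal (d / 2)" if "a \<noteq> Orderings.top" for a
    using ennreal_add_left_cancel_less[of a 0 "ennreal (d / 2)"] that d by simp
  obtain x y where "x \<in> X" "x < Inf X + ennreal (d / 2)" "y \<in> Y" "y < Inf Y + ennreal (d / 2)"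
    using half[OF fin(1)] half[OF fin(2)] unfolding Inf_less_iff by blast
  then have "c \<le> (Inf X + ennreal (d / 2)) + (Inf Y + ennreal (d / 2))"
    using assms add_mono by (meson less_imp_le order_trans)
  also have "\<dots> = Inf X + Inf Y + (ennreal (d / 2) + ennreal (d / 2))"
    by (simp only: ac_simps)
  also have "ennreal (d / 2) + ennreal (d / 2) = ennreal d"
    using d by (simp flip: ennreal_plus)
  finally show "c \<le> Inf X + Inf Y + ennreal d" .
qed

theorem theorem4p22:
  fixes K :: "('k, 'm) ring_scheme"
    and P :: "real \<Rightarrow> 'p::order \<Rightarrow> 'p"
    and M :: "('p, 'k, 'a) pmod"
    and N :: "('p, 'k, 'b) pmod"
    and Q :: "('p, 'k, 'c) pmod"
    and \<Lambda> :: "'i set"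
    and N' :: "'i \<Rightarrow> ('p, 'k, 'd) pmod"
  assumes "field K"
    and "poset_flow P"
    and "pfd K M" and "pfd K N" and "pfd K Q"
    and "decomposition K N \<Lambda> N'"
    and "\<forall>i\<in>\<Lambda>. pointwise_dim_le_one K (N' i)"
  shows "f_R K P M Q \<le> f_R K P M N + f_R K P N Q"
proof -
  have mods: "pmodule K M" "pmodule K N" "pmodule K Q" using assms(3-5) by (simp_all add: pfd_def)
  obtain \<phi> where "summands K N \<Lambda> N' \<phi>" using decomposition_summands[OF mods(2) assms(6)] by blast
  then interpret N: summands K N \<Lambda> N' \<phi> .
  have "thin_decomp K N \<Lambda> N.proj"
    by (rule N.thin_proj) (use assms(4,7) in \<open>simp_all add: pfd_def\<close>)
  then interpret T: thin_decomp K N \<Lambda> N.proj .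
  obtain B :: "('i \<times> 'p set) set" and e where brick: "brick_decomp K N B e"
    by (rule T.refine_to_bricks)
  have triangle: "f_R K P M Q \<le> ennreal \<epsilon> + ennreal \<delta>"
    if \<epsilon>: "0 \<le> \<epsilon>" and \<delta>: "0 \<le> \<delta>"
      and "\<exists>R :: ('p, 'k, nat \<Rightarrow> 'k) pmod. refinement K P \<epsilon> M R \<and> refinement K P \<epsilon> N R"
      and "\<exists>R :: ('p, 'k, nat \<Rightarrow> 'k) pmod. refinement K P \<delta> N R \<and> refinement K P \<delta> Q R"
    for \<epsilon> \<delta>
  proof -
    have "\<exists>R :: ('p, 'k, nat \<Rightarrow> 'k) pmod. refinement K P (\<epsilon> + \<delta>) M R \<and> refinement K P (\<epsilon> + \<delta>) Q R"
      using refinement_triangle[OF assms(2) \<epsilon> \<delta> mods brick] that(3,4) by blast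
    then have "f_R K P M Q \<le> ennreal (\<epsilon> + \<delta>)"
      unfolding f_R_def
      by (intro Inf_lower CollectI exI[of _ "\<epsilon> + \<delta>"] conjI refl add_nonneg_nonneg \<epsilon> \<delta>)
    then show ?thesis using \<epsilon> \<delta> by simp
  qed
  show ?thesis
    unfolding f_R_def[of K P M N] f_R_def[of K P N Q]
    by (rule ennreal_le_Inf_add_Inf) (use triangle in blast)
qed

end
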